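(* Let $\nu>0$ and let $n,m\to+\infty$ in such a way that $m/n\to\nu$. Let $F$ be a $2$-connected graph with $v_F\ge3$ vertices and $e_F$ edges. Assume that $X$ and $Q$ are independent and $\mathbb{P}\{Q>0\}>0$. Let $\mathcal{N}_F$ be the number of copies of $F$ in $G_{[n,m]}$, and let $\sigma_F^2=\mathrm{Var}(N_F)$, where $N_F$ is the number of copies of $F$ in $G(X,Q)$. (i) If $\mathbb{E}X^{2v_F}<\infty$ (and $\sigma_F^2>0$), then $(\mathcal{N}_F-\mathbb{E}\mathcal{N}_F)/(\sigma_F\sqrt m)$ converges in distribution to the standard normal distribution. (ii) Let $b>0$ and $1<\gamma<2v_F$. Assume that $$\mathbb{P}\{X>t\}=(b+o(1))\,t^{-\gamma}\qquad\text{as } t\to+\infty.$$ Assume, in addition, that $F$ is balanced and that $$1+(v_F-1)\left(1-\frac{1}{\alpha e_F}\right)<\gamma,\qquad\text{where }\alpha=\gamma/v_F .$$ Then $(\mathcal{N}_F-B_m)/m^{1/\alpha}$ converges in distribution to $G_{\alpha,a}$, where $a=b\,(a_F/v_F!)^{\gamma/v_F}\,\mathbb{E}Q^{\gamma e_F/v_F}$ and where $B_m$ and $G_{\alpha,a}$ are as defined in the context.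
   Context: All graphs are finite and simple. A graph $F$ is $2$-connected if it is connected and stays connected after removal of any one of its vertices. $v_H$ and $e_H$ denote the numbers of vertices and edges of a graph $H$. $F$ is balanced if $e_F/v_F=\max\{e_H/v_H:\ H\subset F,\ e_H\ge 1\}$, the maximum being over subgraphs $H$ of $F$. A copy of $F$ in a graph $G$ is a (not necessarily induced) subgraph of $G$ isomorphic to $F$. $a_F$ is the number of distinct copies of $F$ in the complete graph on $v_F$ vertices. Model. $(X,Q)$ is a random vector with values in $\{0,1,2,\dots\}\times[0,1]$; its distribution does not depend on $n,m$. For an integer $x\ge 1$ and $p\in[0,1]$, $G(x,p)$ is the Bernoulli random graph on $\{1,\dots,x\}$ in which each pair of vertices is adjacent independently with probability $p$; $G(0,p)$ is the empty graph. $G(X,Q)$ is the corresponding mixture, $N_F$ is the number of copies of $F$ in $G(X,Q)$, and $N_F^*=\mathbb{E}(N_F\mid X,Q)=a_F\binom{X}{v_F}Q^{e_F}$. The random graph $G_{[n,m]}$: let $(X_1,Q_1),\dots,(X_m,Q_m)$ be independent copies of $(X,Q)$ and put $\tilde X_i=\min\{X_i,n\}$. Given these, let $\mathcal{V}_{n,1},\dots,\mathcal{V}_{n,m}$ be independent random subsets of $[n]=\{1,\dots,n\}$, where $\mathcal{V}_{n,i}$ is uniformly distributed among the subsets of size $\tilde X_i$. Let $G_{n,1},\dots,G_{n,m}$ be independent random graphs, where $G_{n,i}$ has vertex set $\mathcal{V}_{n,i}$ and each pair of vertices in $\mathcal{V}_{n,i}$ is adjacent in $G_{n,i}$ independently with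 probability $Q_i$. Let $\mathcal{E}_{n,i}$ be the edge set of $G_{n,i}$. Then $G_{[n,m]}$ is the graph with vertex set $[n]$ and edge set $\mathcal{E}_{n,1}\cup\dots\cup\mathcal{E}_{n,m}$. Centering and limit law in (ii). Under the assumptions of (ii), $\mathbb{P}\{N_F^*>t\}=(a+o(1))t^{-\alpha}$ as $t\to+\infty$, with $0<\alpha<2$. Let $N_{F,1}^*,\dots,N_{F,m}^*$ be i.i.d. copies of $N_F^*$ and $S_F^*=N_{F,1}^*+\dots+N_{F,m}^*$. $G_{\alpha,a}$ denotes the stable distribution, defined by $a$ and $\alpha$, to which the distribution of $m^{-1/\alpha}(S_F^*-B_m)$ converges (generalized central limit theorem of Gnedenko and Kolmogorov). Here $B_m=m\,\mathbb{E}N_F^*$ for $1<\alpha<2$ and $B_m\equiv0$ for $0<\alpha<1$; for $\alpha=1$, $B_m=c^{\star}_{\alpha,a}\ln m$, where the constant $c^{\star}_{\alpha,a}>0$ depends on $a$ and $\alpha$.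
   Formalization: For α=1 the centering c*·ln m admits no limit law (S_F*/m grows like a·ln m); it is replaced by B_m = m·E[N_F*; N_F* ≤ m], with G_{1,a} the resulting stable limit, and any other centering under which the sums S_F* converge is shown to work for the count with the same limit. *)

theory Defs
  imports "HOL-Probability.Probability"
begin

section \<open>Finite simple graphs and copies\<close>

type_synonym 'a graph = "'a set \<times> 'a set set"

abbreviation verts :: "'a graph \<Rightarrow> 'a set" where "verts \<equiv> fst"
abbreviation edges :: "'a graph \<Rightarrow> 'a set set" where "edges \<equiv> snd"

abbreviation num_verts :: "'a graph \<Rightarrow> nat" where "num_verts G \<equiv> card (verts G)"
abbreviation num_edges :: "'a graph \<Rightarrow> nat" where "num_edges G \<equiv> card (edges G)"

definition all_pairs :: "'a set \<Rightarrow> 'a set set" where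
  "all_pairs V = {e. e \<subseteq> V \<and> card e = 2}"

definition simple_graph :: "'a graph \<Rightarrow> bool" where
  "simple_graph G \<longleftrightarrow> finite (verts G) \<and> edges G \<subseteq> all_pairs (verts G)"

definition complete_on :: "'a set \<Rightarrow> 'a graph" where
  "complete_on V = (V, all_pairs V)"

definition subgraph :: "'a graph \<Rightarrow> 'a graph \<Rightarrow> bool" where
  "subgraph H G \<longleftrightarrow> simple_graph H \<and> verts H \<subseteq> verts G \<and> edges H \<subseteq> edges G"

definition graph_iso :: "'a graph \<Rightarrow> 'b graph \<Rightarrow> bool" where
  "graph_iso G H \<longleftrightarrow>
     (\<exists>f. bij_betw f (verts G) (verts H) \<and> (\<lambda>e. f ` e) ` edges G = edges H)"

definition connected_graph :: "'a graph \<Rightarrow> bool" where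
  "connected_graph G \<longleftrightarrow> verts G \<noteq> {} \<and>
     (\<forall>u\<in>verts G. \<forall>w\<in>verts G. (u, w) \<in> {(x, y). {x, y} \<in> edges G}\<^sup>*)"

definition remove_vertex :: "'a \<Rightarrow> 'a graph \<Rightarrow> 'a graph" where
  "remove_vertex u G = (verts G - {u}, {e \<in> edges G. u \<notin> e})"

definition two_connected :: "'a graph \<Rightarrow> bool" where
  "two_connected G \<longleftrightarrow> connected_graph G \<and> (\<forall>u\<in>verts G. connected_graph (remove_vertex u G))"

definition balanced :: "'a graph \<Rightarrow> bool" where
  "balanced G \<longleftrightarrow> real (num_edges G) / real (num_verts G) =
     Max {real (num_edges H) / real (num_verts H) | H. subgraph H G \<and> num_edges H \<ge> 1}"

definition num_copies :: "'a graph \<Rightarrow> 'b graph \<Rightarrow> nat" where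
  "num_copies F G = card {H. subgraph H G \<and> graph_iso F H}"

text \<open>The number of copies of \<open>F\<close> in the complete graph on as many vertices as \<open>F\<close>.\<close>

definition copies_in_complete :: "'a graph \<Rightarrow> nat" where
  "copies_in_complete F = num_copies F (complete_on {1..num_verts F})"


section \<open>The random graphs\<close>

definition bernoulli_graph :: "nat set \<Rightarrow> real \<Rightarrow> nat graph pmf" where
  "bernoulli_graph V p =
     map_pmf (\<lambda>f. (V, {e \<in> all_pairs V. f e})) (Pi_pmf (all_pairs V) False (\<lambda>_. bernoulli_pmf p))"

text \<open>
  Throughout, \<open>D\<close> is the joint law of \<open>(X, Q)\<close>, a measure on
  \<open>count_space UNIV \<Otimes>\<^sub>M borel\<close>. The first definition is the law of \<open>G(X, Q)\<close>.
\<close>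

definition mixed_bernoulli_graph :: "(nat \<times> real) measure \<Rightarrow> nat graph measure" where
  "mixed_bernoulli_graph D = bind D (\<lambda>(x, q). measure_pmf (bernoulli_graph {1..x} q))"

definition layer_graph :: "nat \<Rightarrow> nat \<Rightarrow> real \<Rightarrow> nat graph pmf" where
  "layer_graph n x q =
     bind_pmf (pmf_of_set {V. V \<subseteq> {1..n} \<and> card V = min x n}) (\<lambda>V. bernoulli_graph V q)"

text \<open>The law of the union of \<open>m\<close> layers on \<open>[n]\<close>, given the values \<open>w i\<close> of \<open>(X\<^sub>i, Q\<^sub>i)\<close>.\<close>

definition superposition_given :: "nat \<Rightarrow> nat \<Rightarrow> (nat \<Rightarrow> nat \<times> real) \<Rightarrow> nat graph pmf" where
  "superposition_given n m w =
     map_pmf (\<lambda>g. ({1..n}, \<Union>i\<in>{1..m}. edges (g i)))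
       (Pi_pmf {1..m} ({}, {}) (\<lambda>i. layer_graph n (fst (w i)) (snd (w i))))"

definition superposition_graph :: "(nat \<times> real) measure \<Rightarrow> nat \<Rightarrow> nat \<Rightarrow> nat graph measure" where
  "superposition_graph D n m =
     bind (PiM {1..m} (\<lambda>_. D)) (\<lambda>w. measure_pmf (superposition_given n m w))"

text \<open>
  The conditional mean of the number of copies of \<open>F\<close> in \<open>G(X, Q)\<close> given \<open>X = x\<close>, \<open>Q = q\<close>;
  see \<open>expectation_num_copies_bernoulli_graph\<close> below.
\<close>

definition mean_copies :: "'a graph \<Rightarrow> nat \<Rightarrow> real \<Rightarrow> real" where
  "mean_copies F x q =
     real (copies_in_complete F) * real (x choose num_verts F) * q ^ num_edges F"


subsection \<open>The mixtures are probability measures\<close>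

lemma measurable_prob_finite_pmf:
  assumes S: "finite S" "\<And>w. w \<in> space N \<Longrightarrow> set_pmf (p w) \<subseteq> S"
    and p: "\<And>s. (\<lambda>w. pmf (p w) s) \<in> borel_measurable N"
  shows "(\<lambda>w. measure (measure_pmf (p w)) A) \<in> borel_measurable N"
proof -
  have "measure (measure_pmf (p w)) A = (\<Sum>s\<in>A \<inter> S. pmf (p w) s)" if "w \<in> space N" for w
  proof -
    have "measure (measure_pmf (p w)) A = measure (measure_pmf (p w)) (A \<inter> S)"
      using S(2)[OF that] by (intro measure_prob_cong_0) (auto simp: set_pmf_eq)
    then show ?thesis using S(1) by (simp add: measure_measure_pmf_finite)
  qed
  then show ?thesis
    using p by (subst measurable_cong[where g="\<lambda>w. \<Sum>s\<in>A \<inter> S. pmf (p w) s"]) auto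
qed

lemma measurable_kernel_finite_pmf:
  assumes "finite S" "\<And>w. w \<in> space N \<Longrightarrow> set_pmf (p w) \<subseteq> S"
    and "\<And>s. (\<lambda>w. pmf (p w) s) \<in> borel_measurable N"
  shows "(\<lambda>w. measure_pmf (p w)) \<in> measurable N (subprob_algebra (count_space UNIV))"
proof (rule measurable_subprob_algebra)
  show "(\<lambda>w. emeasure (measure_pmf (p w)) A) \<in> borel_measurable N" for A
    using measurable_prob_finite_pmf[OF assms, where A=A]
    by (simp add: measure_pmf.emeasure_eq_measure)
qed (auto intro: measure_pmf.subprob_space_axioms)

lemma finite_all_pairs: "finite V \<Longrightarrow> finite (all_pairs V)"
  unfolding all_pairs_def by (rule finite_subset[of _ "Pow V"]) auto

lemma set_pmf_bernoulli_graph: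
  "set_pmf (bernoulli_graph V q) \<subseteq> {V} \<times> Pow (all_pairs V)"
  by (auto simp: bernoulli_graph_def)

lemma pmf_bernoulli_pmf:
  "pmf (bernoulli_pmf p) c = (if c then min 1 (max 0 p) else 1 - min 1 (max 0 p))"
  by (cases c) (simp_all add: bernoulli_pmf.rep_eq)

lemma measurable_pmf_bernoulli_graph:
  assumes V: "finite V"
  shows "(\<lambda>q. pmf (bernoulli_graph V q) g) \<in> borel_measurable borel"
  unfolding bernoulli_graph_def pmf_map
proof (rule measurable_prob_finite_pmf[where S="PiE_dflt (all_pairs V) False (\<lambda>_. UNIV)"])
  show "finite (PiE_dflt (all_pairs V) False (\<lambda>_. UNIV))"
    by (rule finite_PiE_dflt) (auto simp: V finite_all_pairs)
  show "set_pmf (Pi_pmf (all_pairs V) False (\<lambda>_. bernoulli_pmf w))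
          \<subseteq> PiE_dflt (all_pairs V) False (\<lambda>_. UNIV)" for w
    using set_Pi_pmf_subset'[OF finite_all_pairs[OF V]] by (fastforce simp: PiE_dflt_def)
  show "(\<lambda>w. pmf (Pi_pmf (all_pairs V) False (\<lambda>_. bernoulli_pmf w)) s) \<in> borel_measurable borel" for s
  proof (cases "\<forall>x. x \<notin> all_pairs V \<longrightarrow> s x = False")
    case True
    have "(\<lambda>w. \<Prod>x\<in>all_pairs V. pmf (bernoulli_pmf w) (s x)) \<in> borel_measurable borel"
      unfolding pmf_bernoulli_pmf by (intro borel_measurable_prod) measurable
    then show ?thesis using True by (simp add: pmf_Pi finite_all_pairs V)
  next
    case False
    then have "(\<lambda>w. pmf (Pi_pmf (all_pairs V) False (\<lambda>_. bernoulli_pmf w)) s) = (\<lambda>_. 0)"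
      by (simp only: pmf_Pi finite_all_pairs[OF V] if_False)
    then show ?thesis by simp
  qed
qed

lemma measurable_bernoulli_kernel:
  "(\<lambda>(x, q). measure_pmf (bernoulli_graph {1..x} q))
     \<in> measurable (count_space UNIV \<Otimes>\<^sub>M borel) (subprob_algebra (count_space UNIV))"
proof (rule measurable_pair_measure_countable1)
  fix x :: nat
  have "(\<lambda>q. measure_pmf (bernoulli_graph {1..x} q))
      \<in> measurable borel (subprob_algebra (count_space UNIV))"
    by (rule measurable_kernel_finite_pmf[OF _ set_pmf_bernoulli_graph])
       (auto simp: finite_all_pairs intro: measurable_pmf_bernoulli_graph)
  then show "(\<lambda>q. case (x, q) of (x, q) \<Rightarrow> measure_pmf (bernoulli_graph {1..x} q))
      \<in> measurable borel (subprob_algebra (count_space UNIV))" by simp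
qed simp

lemma layer_vertex_sets:
  "finite {V. V \<subseteq> {1..n::nat} \<and> card V = min x n}" "{V. V \<subseteq> {1..n::nat} \<and> card V = min x n} \<noteq> {}"
proof -
  show "finite {V. V \<subseteq> {1..n::nat} \<and> card V = min x n}"
    by (rule finite_subset[of _ "Pow {1..n}"]) auto
  have "{1..min x n} \<subseteq> {1..n} \<and> card {1..min x n} = min x n" by auto
  then show "{V. V \<subseteq> {1..n::nat} \<and> card V = min x n} \<noteq> {}" by blast
qed

lemma set_pmf_layer_graph:
  "set_pmf (layer_graph n x q) \<subseteq> Pow {1..n} \<times> Pow (all_pairs {1..n})"
proof
  fix g assume "g \<in> set_pmf (layer_graph n x q)"
  then obtain V where "V \<subseteq> {1..n}" "g \<in> set_pmf (bernoulli_graph V q)"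
    using layer_vertex_sets[of n x] by (auto simp: layer_graph_def set_pmf_of_set)
  then show "g \<in> Pow {1..n} \<times> Pow (all_pairs {1..n})"
    using set_pmf_bernoulli_graph[of V q] by (fastforce simp: all_pairs_def)
qed

lemma measurable_pmf_layer_graph:
  "(\<lambda>w. pmf (layer_graph n (fst w) (snd w)) g) \<in> borel_measurable (count_space UNIV \<Otimes>\<^sub>M borel)"
proof (rule measurable_pair_measure_countable1)
  fix x :: nat
  let ?S = "{V. V \<subseteq> {1..n} \<and> card V = min x n}"
  have eq: "pmf (layer_graph n x q) g = (\<Sum>V\<in>?S. pmf (bernoulli_graph V q) g) / real (card ?S)" for q
    unfolding layer_graph_def pmf_bind
    by (rule integral_pmf_of_set[OF layer_vertex_sets(2,1)])
  have "(\<lambda>q. (\<Sum>V\<in>?S. pmf (bernoulli_graph V q) g) / real (card ?S)) \<in> borel_measurable borel"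
    by (intro borel_measurable_divide borel_measurable_sum borel_measurable_const
          measurable_pmf_bernoulli_graph) (auto intro: finite_subset)
  then show "(\<lambda>q. pmf (layer_graph n (fst (x, q)) (snd (x, q))) g) \<in> borel_measurable borel"
    by (simp add: eq)
qed simp

lemma measurable_superposition_kernel:
  assumes D: "sets D = sets (count_space UNIV \<Otimes>\<^sub>M borel)"
  shows "(\<lambda>w. measure_pmf (superposition_given n m w))
           \<in> measurable (PiM {1..m} (\<lambda>_. D)) (subprob_algebra (count_space UNIV))"
proof -
  let ?G = "Pow {1..n} \<times> Pow (all_pairs {1..n})"
  let ?T = "PiE_dflt {1..m} ({}, {}) (\<lambda>_. ?G)"
  let ?u = "\<lambda>g :: nat \<Rightarrow> nat graph. ({1..n}, \<Union>i\<in>{1..m}. edges (g i))"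
  let ?p = "\<lambda>w. Pi_pmf {1..m} ({}, {}) (\<lambda>i. layer_graph n (fst (w i)) (snd (w i)))"
  have T: "finite ?T" by (rule finite_PiE_dflt) (auto simp: finite_all_pairs)
  have sub: "set_pmf (?p w) \<subseteq> ?T" for w
    using set_Pi_pmf_subset'[of "{1..m}" "({}, {})" "\<lambda>i. layer_graph n (fst (w i)) (snd (w i))"]
      set_pmf_layer_graph by (fastforce simp: PiE_dflt_def)
  have meas: "(\<lambda>w. pmf (?p w) s) \<in> borel_measurable (PiM {1..m} (\<lambda>_. D))" for s
  proof (cases "\<forall>x. x \<notin> {1..m} \<longrightarrow> s x = ({}, {})")
    case True
    have "(\<lambda>w. pmf (layer_graph n (fst (w i)) (snd (w i))) (s i))
        \<in> borel_measurable (PiM {1..m} (\<lambda>_. D))" if "i \<in> {1..m}" for i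
    proof -
      have "(\<lambda>w. pmf (layer_graph n (fst w) (snd w)) (s i)) \<in> borel_measurable D"
        using measurable_pmf_layer_graph measurable_cong_sets[OF D refl] by blast
      from measurable_compose[OF measurable_component_singleton[OF that] this] show ?thesis .
    qed
    then have "(\<lambda>w. \<Prod>i\<in>{1..m}. pmf (layer_graph n (fst (w i)) (snd (w i))) (s i))
        \<in> borel_measurable (PiM {1..m} (\<lambda>_. D))"
      by (intro borel_measurable_prod)
    then show ?thesis using True by (simp add: pmf_Pi)
  next
    case False
    then have "(\<lambda>w. pmf (?p w) s) = (\<lambda>_. 0)" by (simp only: pmf_Pi finite_atLeastAtMost if_False)
    then show ?thesis by simp
  qed
  show ?thesis
  proof (rule measurable_kernel_finite_pmf[where S="?u ` ?T"])
    show "finite (?u ` ?T)" using T by simp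
    show "set_pmf (superposition_given n m w) \<subseteq> ?u ` ?T" for w
      unfolding superposition_given_def set_map_pmf by (intro image_mono sub)
    show "(\<lambda>w. pmf (superposition_given n m w) s) \<in> borel_measurable (PiM {1..m} (\<lambda>_. D))" for s
      unfolding superposition_given_def pmf_map
      by (rule measurable_prob_finite_pmf[OF T sub meas])
  qed
qed

lemma prob_space_mixed_bernoulli_graph:
  assumes "prob_space D" and D: "sets D = sets (count_space UNIV \<Otimes>\<^sub>M borel)"
  shows "prob_space (mixed_bernoulli_graph D)" "sets (mixed_bernoulli_graph D) = UNIV"
proof -
  interpret prob_space D by fact
  have meas: "(\<lambda>(x, q). measure_pmf (bernoulli_graph {1..x} q))
      \<in> measurable D (subprob_algebra (count_space UNIV))"
    using measurable_bernoulli_kernel measurable_cong_sets[OF D refl] by blast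
  show "prob_space (mixed_bernoulli_graph D)" unfolding mixed_bernoulli_graph_def
    by (rule prob_space_bind[OF _ meas]) (auto intro!: AE_I2 measure_pmf.prob_space_axioms)
  show "sets (mixed_bernoulli_graph D) = UNIV" unfolding mixed_bernoulli_graph_def
    by (subst sets_bind[where N="count_space UNIV"]) (auto simp: not_empty)
qed

lemma prob_space_superposition_graph:
  assumes "prob_space D" and D: "sets D = sets (count_space UNIV \<Otimes>\<^sub>M borel)"
  shows "prob_space (superposition_graph D n m)" "sets (superposition_graph D n m) = UNIV"
proof -
  interpret prob_space "PiM {1..m} (\<lambda>_. D)" by (intro prob_space_PiM assms(1))
  show "prob_space (superposition_graph D n m)" unfolding superposition_graph_def
    by (rule prob_space_bind[OF _ measurable_superposition_kernel[OF D]])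
       (auto intro!: AE_I2 measure_pmf.prob_space_axioms)
  show "sets (superposition_graph D n m) = UNIV" unfolding superposition_graph_def
    by (subst sets_bind[where N="count_space UNIV", OF _ not_empty]) simp_all
qed


subsection \<open>The conditional mean number of copies\<close>

lemma finite_complete_subgraphs:
  assumes "finite V"
  shows "finite {H. subgraph H (complete_on V) \<and> P H}"
proof (rule finite_subset)
  show "{H. subgraph H (complete_on V) \<and> P H} \<subseteq> Pow V \<times> Pow (all_pairs V)"
    by (auto simp: subgraph_def complete_on_def)
qed (auto simp: assms finite_all_pairs)

lemma graph_iso_card:
  assumes "graph_iso F H" "simple_graph F"
  shows "num_verts H = num_verts F" "num_edges H = num_edges F"
proof -
  obtain f where f: "bij_betw f (verts F) (verts H)" "(\<lambda>e. f ` e) ` edges F = edges H"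
    using assms(1) by (auto simp: graph_iso_def)
  then show "num_verts H = num_verts F" by (simp add: bij_betw_same_card)
  have "inj_on (\<lambda>e. f ` e) (edges F)"
    by (rule inj_on_subset[OF inj_on_image_Pow[OF bij_betw_imp_inj_on[OF f(1)]]])
       (use assms(2) in \<open>auto simp: simple_graph_def all_pairs_def\<close>)
  from card_image[OF this] show "num_edges H = num_edges F" by (simp add: f(2))
qed

lemma prob_edges_subset_bernoulli_graph:
  assumes V: "finite V" and A: "A \<subseteq> all_pairs V" and q: "0 \<le> q" "q \<le> 1"
  shows "measure_pmf.prob (bernoulli_graph V q) {G. A \<subseteq> edges G} = q ^ card A"
proof -
  have fin: "finite (all_pairs V)" using V by (rule finite_all_pairs)
  have "(\<lambda>f. (V, {e \<in> all_pairs V. f e})) -` {G. A \<subseteq> edges G}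
      = Pi (all_pairs V) (\<lambda>e. if e \<in> A then {True} else UNIV)"
    using A by (auto simp: Pi_def split: if_splits)
  then have "measure_pmf.prob (bernoulli_graph V q) {G. A \<subseteq> edges G}
      = (\<Prod>e\<in>all_pairs V. measure_pmf.prob (bernoulli_pmf q) (if e \<in> A then {True} else UNIV))"
    by (simp add: bernoulli_graph_def measure_Pi_pmf_Pi[OF fin])
  also have "\<dots> = (\<Prod>e\<in>all_pairs V. if e \<in> A then q else 1)"
    using q by (intro prod.cong refl) (auto simp: measure_pmf_single)
  also have "\<dots> = q ^ card A"
    using A fin by (simp add: prod.If_cases Int_absorb1)
  finally show ?thesis .
qed

lemma num_copies_complete_le:
  assumes "finite V" "finite W" "card V = card W"
  shows "num_copies F (complete_on V) \<le> num_copies F (complete_on W)"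
proof -
  obtain h where h: "bij_betw h V W"
    using finite_same_card_bij[OF assms] by blast
  note inj = bij_betw_imp_inj_on[OF h]
  define \<phi> where "\<phi> = (\<lambda>H :: _ graph. (h ` verts H, (\<lambda>e. h ` e) ` edges H))"
  have pairs: "h ` e \<in> all_pairs (h ` U)" if "e \<in> all_pairs U" "U \<subseteq> V" for e U
    using that inj_on_subset[OF inj, of e] by (auto simp: all_pairs_def card_image)
  have "\<phi> H \<in> {H. subgraph H (complete_on W) \<and> graph_iso F H}"
    if H: "H \<in> {H. subgraph H (complete_on V) \<and> graph_iso F H}" for H
  proof -
    have s: "simple_graph H" "verts H \<subseteq> V" and i: "graph_iso F H"
      using H by (auto simp: subgraph_def complete_on_def)
    have VW: "h ` verts H \<subseteq> W" using s(2) h by (auto simp: bij_betw_def)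
    have E: "edges (\<phi> H) \<subseteq> all_pairs (h ` verts H)"
      using s pairs by (auto simp: \<phi>_def simple_graph_def)
    have "subgraph (\<phi> H) (complete_on W)"
    proof -
      have "all_pairs (h ` verts H) \<subseteq> all_pairs W"
        using VW by (fastforce simp: all_pairs_def)
      then show ?thesis
        using s VW E by (auto simp: subgraph_def complete_on_def simple_graph_def \<phi>_def)
    qed
    moreover obtain f where f: "bij_betw f (verts F) (verts H)" "(\<lambda>e. f ` e) ` edges F = edges H"
      using i by (auto simp: graph_iso_def)
    have "bij_betw (h \<circ> f) (verts F) (verts (\<phi> H))"
      by (rule bij_betw_trans[OF f(1)])
         (use s(2) inj in \<open>auto simp: \<phi>_def intro: inj_on_imp_bij_betw inj_on_subset\<close>)
    moreover have "(\<lambda>e. (h \<circ> f) ` e) ` edges F = edges (\<phi> H)"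
      unfolding \<phi>_def snd_conv f(2)[symmetric] image_image image_comp[symmetric] ..
    ultimately show ?thesis unfolding graph_iso_def by blast
  qed
  moreover have "inj_on \<phi> {H. subgraph H (complete_on V) \<and> graph_iso F H}"
  proof (rule inj_onI)
    fix H K
    assume "H \<in> {H. subgraph H (complete_on V) \<and> graph_iso F H}"
      and "K \<in> {H. subgraph H (complete_on V) \<and> graph_iso F H}" and eq: "\<phi> H = \<phi> K"
    then have sub: "verts H \<subseteq> V" "verts K \<subseteq> V" "edges H \<subseteq> Pow V" "edges K \<subseteq> Pow V"
      by (auto simp: subgraph_def complete_on_def all_pairs_def)
    have "verts H = verts K"
      using eq sub inj_on_image_eq_iff[OF inj] by (auto simp: \<phi>_def)
    moreover have "edges H = edges K"
      using eq sub inj_on_image_eq_iff[OF inj_on_image_Pow[OF inj]] by (auto simp: \<phi>_def)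
    ultimately show "H = K" by (rule prod_eqI)
  qed
  ultimately show ?thesis unfolding num_copies_def
    by (intro card_inj_on_le[OF _ _ finite_complete_subgraphs[OF assms(2)]]) auto
qed

lemma num_copies_complete:
  assumes F: "simple_graph F" and V: "finite V"
  shows "num_copies F (complete_on V) = copies_in_complete F * (card V choose num_verts F)"
proof -
  let ?C = "\<lambda>W. {H. subgraph H (complete_on W) \<and> graph_iso F H}"
  let ?S = "{W. W \<subseteq> V \<and> card W = num_verts F}"
  have fin: "finite W" if "W \<in> ?S" for W using that V by (auto intro: finite_subset)
  have verts: "verts H = W" if "H \<in> ?C W" "W \<in> ?S" for H W
    using that graph_iso_card(1)[OF _ F, of H] fin[OF that(2)]
    by (intro card_subset_eq) (auto simp: subgraph_def complete_on_def)
  have "?C V = (\<Union>W\<in>?S. ?C W)"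
  proof (intro equalityI subsetI)
    fix H assume H: "H \<in> ?C V"
    then have "verts H \<in> ?S"
      using graph_iso_card(1)[OF _ F, of H] by (auto simp: subgraph_def complete_on_def)
    moreover have "H \<in> ?C (verts H)"
      using H by (auto simp: subgraph_def complete_on_def simple_graph_def)
    ultimately show "H \<in> (\<Union>W\<in>?S. ?C W)" by blast
  next
    fix H assume "H \<in> (\<Union>W\<in>?S. ?C W)"
    then show "H \<in> ?C V" by (fastforce simp: subgraph_def complete_on_def all_pairs_def)
  qed
  then have "card (?C V) = card (\<Union>W\<in>?S. ?C W)" by simp
  also have "\<dots> = (\<Sum>W\<in>?S. card (?C W))"
  proof (rule card_UN_disjoint)
    show "finite ?S" by (rule finite_subset[of _ "Pow V"]) (use V in auto)
    show "\<forall>W\<in>?S. finite (?C W)" using fin finite_complete_subgraphs by blast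
    have "?C W \<inter> ?C W' = {}" if W: "W \<in> ?S" "W' \<in> ?S" "W \<noteq> W'" for W W'
    proof (rule equals0I)
      fix H assume H: "H \<in> ?C W \<inter> ?C W'"
      from W(3) verts[OF IntD1[OF H] W(1)] verts[OF IntD2[OF H] W(2)] show False by (elim notE) simp
    qed
    then show "\<forall>W\<in>?S. \<forall>W'\<in>?S. W \<noteq> W' \<longrightarrow> ?C W \<inter> ?C W' = {}" by (intro ballI impI)
  qed
  also have "\<dots> = (\<Sum>W\<in>?S. copies_in_complete F)"
  proof (intro sum.cong refl)
    fix W assume W: "W \<in> ?S"
    then have c: "card W = card {1..num_verts F}"
      unfolding mem_Collect_eq card_atLeastAtMost diff_Suc_1 by (rule conjunct2)
    have "num_copies F (complete_on W) = num_copies F (complete_on {1..num_verts F})"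
      by (rule le_antisym[OF num_copies_complete_le[OF fin[OF W] _ c]
            num_copies_complete_le[OF _ fin[OF W] c[symmetric]]]) (rule finite_atLeastAtMost)+
    then show "card (?C W) = copies_in_complete F"
      unfolding num_copies_def copies_in_complete_def .
  qed
  also have "\<dots> = copies_in_complete F * (card V choose num_verts F)"
    using n_subsets[OF V] by simp
  finally show ?thesis by (simp add: num_copies_def)
qed

lemma expectation_num_copies_bernoulli_graph:
  assumes F: "simple_graph F" and q: "0 \<le> q" "q \<le> 1"
  shows "measure_pmf.expectation (bernoulli_graph {1..x} q) (\<lambda>G. real (num_copies F G))
           = mean_copies F x q"
proof -
  let ?V = "{1..x}" and ?p = "measure_pmf (bernoulli_graph {1..x} q)"
  let ?C = "{H. subgraph H (complete_on ?V) \<and> graph_iso F H}"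
  have fin: "finite ?C" by (rule finite_complete_subgraphs) simp
  have eq: "real (num_copies F G) = (\<Sum>H\<in>?C. indicator {G. edges H \<subseteq> edges G} G)"
    if "G \<in> set_pmf (bernoulli_graph ?V q)" for G
  proof -
    have "verts G = ?V" "edges G \<subseteq> all_pairs ?V"
      using that set_pmf_bernoulli_graph by force+
    then have "{H. subgraph H G \<and> graph_iso F H} = {H \<in> ?C. edges H \<subseteq> edges G}"
      by (auto simp: subgraph_def complete_on_def)
    then show ?thesis
      using fin by (simp add: num_copies_def indicator_def sum.If_cases Int_def conj_commute)
  qed
  have "measure_pmf.expectation (bernoulli_graph ?V q) (\<lambda>G. real (num_copies F G))
      = (\<integral>G. (\<Sum>H\<in>?C. indicator {G. edges H \<subseteq> edges G} G) \<partial>?p)"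
    using eq by (intro integral_cong_AE) (auto simp: AE_measure_pmf_iff)
  also have "\<dots> = (\<Sum>H\<in>?C. measure ?p {G. edges H \<subseteq> edges G})"
    by (subst Bochner_Integration.integral_sum) (auto simp: measure_pmf.emeasure_eq_measure)
  also have "\<dots> = (\<Sum>H\<in>?C. q ^ num_edges F)"
  proof (intro sum.cong refl)
    fix H assume "H \<in> ?C"
    then show "measure ?p {G. edges H \<subseteq> edges G} = q ^ num_edges F"
      using prob_edges_subset_bernoulli_graph[of ?V "edges H" q] q graph_iso_card(2)[OF _ F, of H]
      by (auto simp: subgraph_def complete_on_def)
  qed
  also have "\<dots> = mean_copies F x q"
    using num_copies_complete[OF F, of ?V] by (simp add: mean_copies_def num_copies_def)
  finally show ?thesis .
qed


section \<open>Stable limit laws\<close>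

definition stable_distribution :: "real measure \<Rightarrow> bool" where
  "stable_distribution G \<longleftrightarrow> real_distribution G \<and> \<not> (\<exists>c. AE x in G. x = c) \<and>
     (\<forall>s>0. \<forall>t>0. \<exists>u>0. \<exists>d. distr (G \<Otimes>\<^sub>M G) borel (\<lambda>(x, y). s * x + t * y)
                         = distr G borel (\<lambda>x. u * x + d))"

text \<open>The law of \<open>m\<^bsup>-1/\<alpha>\<^esup> (Z\<^sub>1 + \<dots> + Z\<^sub>m - B m)\<close> for independent \<open>Z\<^sub>i\<close> with law \<open>\<mu>\<close>.\<close>

definition normalized_sum ::
    "real \<Rightarrow> (nat \<Rightarrow> real) \<Rightarrow> real measure \<Rightarrow> nat \<Rightarrow> real measure" where
  "normalized_sum \<alpha> B \<mu> m =
     distr (PiM {1..m} (\<lambda>_. \<mu>)) borel (\<lambda>z. real m powr (- 1 / \<alpha>) * ((\<Sum>i=1..m. z i) - B m))"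

text \<open>\<open>\<mu>\<close> is the law of some \<open>Z \<ge> 0\<close> with \<open>P(Z > t) = (a + o(1)) t\<^bsup>-\<alpha>\<^esup>\<close> as \<open>t \<rightarrow> \<infinity>\<close>.\<close>

definition power_tail_law :: "real \<Rightarrow> real \<Rightarrow> real measure \<Rightarrow> bool" where
  "power_tail_law \<alpha> a \<mu> \<longleftrightarrow> real_distribution \<mu> \<and> (AE z in \<mu>. 0 \<le> z) \<and>
     ((\<lambda>t. measure \<mu> {t<..} * t powr \<alpha>) \<longlongrightarrow> a) at_top"

text \<open>
  For \<open>\<alpha> = 1\<close> the mean may be infinite and the generalized central limit theorem centers
  with truncated means. These are \<open>a ln m + o(ln m)\<close> under a tail \<open>(a + o(1)) t\<^bsup>-1\<^esup>\<close>, but the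
  error term need not converge, so no multiple of \<open>m ln m\<close> centers all laws with this tail.
\<close>

definition centering :: "real \<Rightarrow> real measure \<Rightarrow> nat \<Rightarrow> real" where
  "centering \<alpha> \<mu> m =
     (if \<alpha> > 1 then real m * (\<integral>z. z \<partial>\<mu>)
      else if \<alpha> = 1 then real m * (\<integral>z. z * indicator {..real m} z \<partial>\<mu>)
      else 0)"

text \<open>
  For \<open>0 < \<alpha> < 2\<close> and \<open>a > 0\<close>: the stable law, determined by \<open>\<alpha>\<close> and \<open>a\<close>, to which the
  generalized central limit theorem of Gnedenko and Kolmogorov gives convergence.
\<close>

definition stable_limit :: "real \<Rightarrow> real \<Rightarrow> real measure" where
  "stable_limit \<alpha> a = (THE G. stable_distribution G \<and>
     (\<forall>\<mu>. power_tail_law \<alpha> a \<mu> \<longrightarrow> weak_conv_m (normalized_sum \<alpha> (centering \<alpha> \<mu>) \<mu>) G))"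

end

theory Submission
  imports Defs
begin

text \<open>
  By 2-connectedness of \<open>F\<close>, a copy of \<open>F\<close> whose edges come from at least two layers uses up
  too many vertices to be frequent: if its edges are colored by \<open>r \<ge> 2\<close> layers and the color
  classes span \<open>v\<^sub>1, \<dots>, v\<^sub>r\<close> vertices, then \<open>v\<^sub>1 + \<dots> + v\<^sub>r \<ge> v + r\<close>, while the layers contain
  such edges with probability \<open>O(n\<^bsup>-(v\<^sub>1 + \<dots> + v\<^sub>r)\<^esup>)\<close> up to a correction for the classes spanning
  all \<open>v\<close> vertices. Hence the number of copies differs, in mean, by \<open>o(\<surd>m)\<close> respectively
  \<open>o(m\<^bsup>1/\<alpha>\<^esup>)\<close> from the sum of the numbers of copies in the separate layers. These are
  independent, so part (i) is the central limit theorem. In part (ii) the conditional variance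
  of \<open>N\<^sub>F\<close> given \<open>(X, Q)\<close> is \<open>O(X\<^bsup>2v-2\<^esup>)\<close>, so that \<open>N\<^sub>F\<close> may be replaced by \<open>N\<^sub>F\<^sup>*\<close>, which has a power
  tail. The generalized central limit theorem follows from the convergence of \<open>m E f(m\<^bsup>-1/\<alpha>\<^esup> Z)\<close> for
  the compensated exponentials \<open>f(x) = e\<^bsup>itx\<^esup> - 1 - it c(x)\<close>, whose limit only depends on the tail
  of \<open>Z\<close>; rescaling \<open>Z\<close> in this limit shows that the limit law is stable.
\<close>


section \<open>Construction of a law from a limit of characteristic functions\<close>

text \<open>The obstacle that shapes part (ii) is the lack of moments. For \<gamma> \<le> v the
  moment of X of order v is infinite, so a color class spanning all v vertices costs an extra factor
  n^\<theta> with \<theta> = v - \<kappa>, where \<kappa> is the order of some finite moment, and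
  the expected overlap grows like n^\<theta>. It is negligible if \<theta> < 1/\<alpha>. This is
  where the condition on \<gamma> enters: a 2-connected graph has e \<ge> v, so the condition
  implies v - 1 < \<gamma>, which leaves room for \<theta> < 1 when \<alpha> \<le> 1. Similarly
  X^(2v - 2) need not have a mean; the conditional variance therefore enters only through a
  fractional power, obtained by interpolation with the trivial bound 2 on the difference of two
  exponentials.

  Since N_F has no finite variance in this regime, all comparisons are made between characteristic
  functions. These are bounded, multiply over independent layers and carry an arbitrary centering as
  a factor of modulus 1. No formula for the stable law is required: it is produced by tightness from
  the limit of characteristic functions.\<close>

lemma norm_iexp_diff_le: "cmod (iexp x - iexp y) \<le> \<bar>x - y\<bar>"
proof -
  have "iexp x - iexp y = iexp y * (iexp (x - y) - 1)"
    by (simp add: algebra_simps flip: exp_add)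
  then have "cmod (iexp x - iexp y) = cmod (iexp (x - y) - 1)"
    by (simp add: norm_mult)
  also have "\<dots> \<le> \<bar>x - y\<bar>"
    using iexp_approx1[of "x - y" 0] by simp
  finally show ?thesis .
qed

lemma norm_iexp_diff_le_2: "cmod (iexp x - iexp y) \<le> 2"
  using norm_triangle_ineq4[of "iexp x" "iexp y"] by simp

text \<open>Averaging \<open>1 - Re (char M)\<close> over a Gaussian, a probability measure with known characteristic
  function, turns the usual tightness estimate into Fubini's theorem for bounded functions.\<close>

lemma (in real_distribution) expectation_gauss_complement:
  "expectation (\<lambda>x. 1 - exp (- (c * x)\<^sup>2 / 2))
     = (\<integral>s. 1 - Re (char M (c * s)) \<partial>std_normal_distribution)"
proof -
  interpret N: real_distribution std_normal_distribution
    by (rule real_dist_normal_dist)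
  interpret P: pair_prob_space M std_normal_distribution ..
  have 1: "1 - exp (- (c * x)\<^sup>2 / 2) = (\<integral>s. 1 - cos (c * s * x) \<partial>std_normal_distribution)" for x
  proof -
    have "complex_of_real (exp (- (c * x)\<^sup>2 / 2)) = char std_normal_distribution (c * x)"
      by (simp add: char_std_normal_distribution)
    then have "exp (- (c * x)\<^sup>2 / 2) = Re (char std_normal_distribution (c * x))"
      by (metis Re_complex_of_real)
    also have "\<dots> = (\<integral>s. Re (iexp (c * x * s)) \<partial>std_normal_distribution)"
      unfolding char_def by (intro integral_Re[symmetric] N.integrable_const_bound[where B=1]) auto
    also have "\<dots> = (\<integral>s. cos (c * s * x) \<partial>std_normal_distribution)"
      by (simp add: Re_exp mult_ac)
    finally show ?thesis
      by (subst Bochner_Integration.integral_diff)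
         (auto intro!: N.integrable_const_bound[where B=1] N.prob_space[unfolded N.space_eq_univ] simp: N.prob_space[unfolded N.space_eq_univ] simp del: N.prob_space)
  qed
  have "expectation (\<lambda>x. 1 - exp (- (c * x)\<^sup>2 / 2))
      = (\<integral>x. (\<integral>s. 1 - cos (c * s * x) \<partial>std_normal_distribution) \<partial>M)"
    unfolding 1 ..
  also have "\<dots> = (\<integral>s. (\<integral>x. 1 - cos (c * s * x) \<partial>M) \<partial>std_normal_distribution)"
    by (subst P.Fubini_integral) (auto intro!: P.P.integrable_const_bound[where B=2] order_trans[OF abs_triangle_ineq4] abs_cos_le_one
        simp: order_trans[OF add_left_mono[OF abs_cos_le_one]])
  also have "\<dots> = (\<integral>s. 1 - Re (char M (c * s)) \<partial>std_normal_distribution)"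
  proof (intro Bochner_Integration.integral_cong refl)
    fix s
    have "Re (char M (c * s)) = (\<integral>x. Re (iexp (c * s * x)) \<partial>M)"
      unfolding char_def by (intro integral_Re[symmetric] integrable_const_bound[where B=1]) auto
    also have "\<dots> = (\<integral>x. cos (c * s * x) \<partial>M)"
      by (simp add: Re_exp mult_ac)
    finally show "(\<integral>x. 1 - cos (c * s * x) \<partial>M) = 1 - Re (char M (c * s))"
      by (subst Bochner_Integration.integral_diff)
         (auto intro!: integrable_const_bound[where B=1] simp: prob_space[unfolded space_eq_univ] simp del: prob_space)
  qed
  finally show ?thesis .
qed

text \<open>Markov's inequality for 1 - exp(- x^2 / (2 K^2)), which is at least 1 - exp(-1/2) \<ge>
  1/3 when |x| \<ge> K. This is the origin of the factor 3.\<close>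

lemma (in real_distribution) prob_abs_ge_le_char:
  assumes K: "K > 0"
  shows "prob {x. \<bar>x\<bar> \<ge> K}
      \<le> 3 * (\<integral>s. 1 - Re (char M (s / K)) \<partial>std_normal_distribution)"
proof -
  have e: "exp (- 1 / 2 :: real) \<le> 2 / 3"
  proof -
    have "1 + 1/2 \<le> exp (1 / 2 :: real)" by (rule exp_ge_add_one_self)
    then have "inverse (exp (1/2 :: real)) \<le> inverse (3/2)" by (intro le_imp_inverse_le) auto
    then show ?thesis by (simp add: exp_minus)
  qed
  have "prob {x. \<bar>x\<bar> \<ge> K} = expectation (indicator {x. \<bar>x\<bar> \<ge> K})" by simp
  also have "\<dots> \<le> expectation (\<lambda>x. 3 * (1 - exp (- (1 / K * x)\<^sup>2 / 2)))"
  proof (intro integral_mono integrable_const_bound[where B=3])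
    fix x :: real
    show "indicator {x. \<bar>x\<bar> \<ge> K} x \<le> 3 * (1 - exp (- (1 / K * x)\<^sup>2 / 2))"
    proof (cases "\<bar>x\<bar> \<ge> K")
      case True
      then have "1 \<le> \<bar>1 / K * x\<bar>" using K by (simp add: abs_mult)
      then have "1 \<le> (1 / K * x)\<^sup>2" using abs_le_square_iff[of 1 "1 / K * x"] by simp
      then have "exp (- (1 / K * x)\<^sup>2 / 2) \<le> exp (- 1 / 2)" by simp
      also note e
      finally show ?thesis using True by (simp del: times_divide_eq_left mult_1)
    qed simp
  qed (auto simp: indicator_def)
  also have "\<dots> = 3 * (\<integral>s. 1 - Re (char M (1 / K * s)) \<partial>std_normal_distribution)"
    unfolding expectation_gauss_complement[symmetric] by (rule integral_mult_right_zero)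
  finally show ?thesis by simp
qed

text \<open>Each of the finitely many exceptional laws is tight on its own; the largest of their
  radii and the common one serves all.\<close>

lemma tight_if_eventually_tight:
  assumes M: "\<And>n. real_distribution (M n)"
    and ev: "\<And>\<epsilon>. \<epsilon> > 0 \<Longrightarrow> \<exists>K>0. \<forall>\<^sub>F n in sequentially. measure (M n) {x. \<bar>x\<bar> \<ge> K} < \<epsilon>"
  shows "tight M"
  unfolding tight_def
proof (intro conjI allI impI)
  interpret real_distribution "M n" for n by (rule M)
  show "real_distribution (M n)" for n by (rule M)
  fix \<epsilon> :: real assume \<epsilon>: "\<epsilon> > 0"
  have one: "\<exists>K>0. measure (M n) {x. \<bar>x\<bar> \<ge> K} < \<epsilon>" for n
  proof -
    have "(\<lambda>k. measure (M n) {x. \<bar>x\<bar> \<ge> real k}) \<longlonglongrightarrow> measure (M n) (\<Inter>k. {x. \<bar>x\<bar> \<ge> real k})"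
      by (rule finite_Lim_measure_decseq) (auto simp: decseq_def)
    moreover have "(\<Inter>k. {x::real. \<bar>x\<bar> \<ge> real k}) = {}"
    proof (intro equals0I)
      fix x :: real assume "x \<in> (\<Inter>k. {x. \<bar>x\<bar> \<ge> real k})"
      moreover obtain k where "\<bar>x\<bar> < real k" using reals_Archimedean2 by blast
      ultimately show False by (auto dest: spec[of _ k])
    qed
    ultimately have "(\<lambda>k. measure (M n) {x. \<bar>x\<bar> \<ge> real k}) \<longlonglongrightarrow> 0" by simp
    from order_tendstoD(2)[OF this \<epsilon>] eventually_gt_at_top[of 0]
    have "\<forall>\<^sub>F k in sequentially. 0 < k \<and> measure (M n) {x. \<bar>x\<bar> \<ge> real k} < \<epsilon>"
      by eventually_elim auto
    then show ?thesis by (auto simp: eventually_sequentially) (metis of_nat_0_less_iff order_refl)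
  qed
  from ev[OF \<epsilon>] obtain K0 N where K0: "K0 > 0" "\<And>n. n \<ge> N \<Longrightarrow> measure (M n) {x. \<bar>x\<bar> \<ge> K0} < \<epsilon>"
    by (auto simp: eventually_sequentially)
  obtain k where k: "\<And>n. k n > 0" "\<And>n. measure (M n) {x. \<bar>x\<bar> \<ge> k n} < \<epsilon>"
    using one by metis
  define K where "K = Max (insert K0 (k ` {..<N}))"
  have K: "K \<ge> K0" "\<And>n. n < N \<Longrightarrow> K \<ge> k n" by (auto simp: K_def)
  have "1 - \<epsilon> < measure (M n) {-K<..K}" for n
  proof -
    obtain K' where K': "K' \<le> K" "measure (M n) {x. \<bar>x\<bar> \<ge> K'} < \<epsilon>"
      using K0 k K by (metis not_less)
    have "measure (M n) (UNIV - {-K<..K}) \<le> measure (M n) {x. \<bar>x\<bar> \<ge> K'}"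
      using K' by (intro finite_measure_mono) auto
    moreover have "measure (M n) (UNIV - {-K<..K}) = 1 - measure (M n) {-K<..K}"
      using prob_compl[of "{-K<..K}" n] by simp
    ultimately show ?thesis using K' by simp
  qed
  then show "\<exists>a b. a < b \<and> (\<forall>n. 1 - \<epsilon> < measure (M n) {a<..b})"
    using K K0(1) by (intro exI[of _ "-K"] exI[of _ K]) auto
qed

text \<open>Dominated convergence is used twice. As \<phi> is continuous at 0 with \<phi> 0 = 1, a
  large scale makes the Gaussian average of 1 - Re \<phi> small; at this fixed scale the averages
  for \<open>char (M n)\<close> converge to it, which bounds the tails for all but finitely many
  n.\<close>

lemma tight_if_char_tendsto:
  fixes M :: "nat \<Rightarrow> real measure"
  assumes M: "\<And>n. real_distribution (M n)"
    and conv: "\<And>t. (\<lambda>n. char (M n) t) \<longlonglongrightarrow> \<phi> t"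
    and cont: "isCont \<phi> 0"
  shows "tight M"
proof (rule tight_if_eventually_tight[OF M])
  interpret real_distribution "M n" for n by (rule M)
  interpret N: real_distribution std_normal_distribution by (rule real_dist_normal_dist)
  fix \<epsilon> :: real assume \<epsilon>: "\<epsilon> > 0"
  have [measurable]: "char (M n) \<in> borel_measurable borel" for n by simp
  have [measurable]: "\<phi> \<in> borel_measurable borel"
    by (rule borel_measurable_LIMSEQ_metric[where f="\<lambda>n. char (M n)"]) (auto intro: conv)
  have \<phi>0: "\<phi> 0 = 1" using conv[of 0] LIMSEQ_unique[OF conv[of 0], of 1] by (simp add: char_zero)
  have \<phi>1: "cmod (\<phi> t) \<le> 1" for t
    by (rule Lim_bounded[OF tendsto_norm[OF conv[of t]], of 0]) (auto intro: cmod_char_le_1)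
  have b: "\<bar>1 - Re z\<bar> \<le> 2" if "cmod z \<le> 1" for z
    using abs_Re_le_cmod[of z] that by auto
  have "(\<lambda>k. \<integral>s. 1 - Re (\<phi> (s / real (Suc k))) \<partial>std_normal_distribution)
      \<longlonglongrightarrow> (\<integral>s. 0 \<partial>std_normal_distribution)"
  proof (rule integral_dominated_convergence[where w="\<lambda>_. 2"])
    show "AE s in std_normal_distribution. (\<lambda>k. 1 - Re (\<phi> (s / real (Suc k)))) \<longlonglongrightarrow> 0"
    proof (intro AE_I2)
      fix s :: real
      have "(\<lambda>k. s * inverse (real (Suc k))) \<longlonglongrightarrow> s * 0"
        by (intro tendsto_intros LIMSEQ_inverse_real_of_nat)
      then have "(\<lambda>k. \<phi> (s / real (Suc k))) \<longlonglongrightarrow> \<phi> 0"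
        by (intro isCont_tendsto_compose[OF cont]) (simp add: divide_inverse)
      from tendsto_diff[OF tendsto_const tendsto_Re[OF this], of 1]
      show "(\<lambda>k. 1 - Re (\<phi> (s / real (Suc k)))) \<longlonglongrightarrow> 0" by (simp add: \<phi>0)
    qed
  qed (use b \<phi>1 in auto)
  then have "(\<lambda>k. \<integral>s. 1 - Re (\<phi> (s / real (Suc k))) \<partial>std_normal_distribution) \<longlonglongrightarrow> 0" by simp
  from order_tendstoD(2)[OF this, of "\<epsilon> / 3"] \<epsilon> obtain k
    where k: "(\<integral>s. 1 - Re (\<phi> (s / real (Suc k))) \<partial>std_normal_distribution) < \<epsilon> / 3"
    by (auto simp: eventually_sequentially)
  have "(\<lambda>n. \<integral>s. 1 - Re (char (M n) (s / real (Suc k))) \<partial>std_normal_distribution)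
      \<longlonglongrightarrow> (\<integral>s. 1 - Re (\<phi> (s / real (Suc k))) \<partial>std_normal_distribution)"
    by (rule integral_dominated_convergence[where w="\<lambda>_. 2"])
       (use b \<phi>1 cmod_char_le_1 in \<open>auto intro!: tendsto_intros conv\<close>)
  from order_tendstoD(2)[OF this k]
  have "\<forall>\<^sub>F n in sequentially. measure (M n) {x. \<bar>x\<bar> \<ge> real (Suc k)} < \<epsilon>"
  proof eventually_elim
    case (elim n)
    then show ?case using prob_abs_ge_le_char[of "real (Suc k)" n] by linarith
  qed
  then show "\<exists>K>0. \<forall>\<^sub>F n in sequentially. measure (M n) {x. \<bar>x\<bar> \<ge> K} < \<epsilon>"
    by (intro exI[of _ "real (Suc k)"]) simp
qed

text \<open>In \<open>levy_continuity\<close> the limit law is given. Here it comes from a weakly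
  convergent subsequence of the tight sequence, and its characteristic function is identified along
  that subsequence.\<close>

theorem levy_continuity_existence:
  fixes M :: "nat \<Rightarrow> real measure"
  assumes M: "\<And>n. real_distribution (M n)"
    and conv: "\<And>t. (\<lambda>n. char (M n) t) \<longlonglongrightarrow> \<phi> t"
    and cont: "isCont \<phi> 0"
  shows "\<exists>G. real_distribution G \<and> char G = \<phi>"
proof -
  obtain r G where r: "strict_mono (r :: nat \<Rightarrow> nat)" and G: "real_distribution G"
    and w: "weak_conv_m (M \<circ> r) G"
    using tight_imp_convergent_subsubsequence[OF tight_if_char_tendsto[OF assms], of id]
    by (auto simp: strict_mono_def)
  have "char G t = \<phi> t" for t
  proof (rule LIMSEQ_unique)
    show "(\<lambda>n. char ((M \<circ> r) n) t) \<longlonglongrightarrow> char G t"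
      by (rule levy_continuity1[OF _ G w]) (simp add: M)
    show "(\<lambda>n. char ((M \<circ> r) n) t) \<longlonglongrightarrow> \<phi> t"
      using LIMSEQ_subseq_LIMSEQ[OF conv r] by (simp add: o_def)
  qed
  then show ?thesis using G by blast
qed


section \<open>Moments of laws with power tails\<close>

lemma power_tail_bound:
  fixes f :: "real \<Rightarrow> real"
  assumes lim: "((\<lambda>t. f t * t powr \<gamma>) \<longlongrightarrow> b) at_top" and f: "\<And>t. f t \<le> 1" and \<gamma>: "\<gamma> > 0"
  shows "\<exists>C>0. \<forall>t>0. f t \<le> C * t powr (- \<gamma>)"
proof -
  from order_tendstoD(2)[OF lim, of "\<bar>b\<bar> + 1"]
  have "\<forall>\<^sub>F t in at_top. f t * t powr \<gamma> < \<bar>b\<bar> + 1" by linarith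
  with eventually_gt_at_top[of "0::real"]
  have "\<forall>\<^sub>F t in at_top. 0 < t \<and> f t * t powr \<gamma> < \<bar>b\<bar> + 1" by eventually_elim auto
  then obtain T where T: "\<And>t. t \<ge> T \<Longrightarrow> f t * t powr \<gamma> < \<bar>b\<bar> + 1" "T > 0"
    by (auto simp: eventually_at_top_linorder)
  \<comment> \<open>The limit controls only t \<ge> T; for smaller t the bound f t \<le> 1 costs the
    summand T^\<gamma>.\<close>
  define C where "C = \<bar>b\<bar> + 1 + T powr \<gamma>"
  have "f t \<le> C * t powr (- \<gamma>)" if t: "t > 0" for t
  proof -
    have "f t * t powr \<gamma> \<le> C"
    proof (cases "t \<ge> T")
      case True then show ?thesis using T(1)[of t] by (simp add: C_def add_increasing2)
    next
      case False
      have "f t * t powr \<gamma> \<le> 1 * t powr \<gamma>" by (intro mult_right_mono f) simp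
      also have "\<dots> \<le> T powr \<gamma>" using False t \<gamma> by (auto intro!: powr_mono2)
      finally show ?thesis by (simp add: C_def)
    qed
    then show ?thesis using t by (simp add: powr_minus field_simps)
  qed
  moreover have "C > 0" by (auto simp: C_def intro: add_pos_nonneg)
  ultimately show ?thesis by blast
qed

text \<open>By summation over the dyadic shells \<open>2\<^sup>j y < Z \<le> 2\<^bsup>j+1\<^esup> y\<close>.\<close>

lemma (in finite_measure) nn_integral_powr_tail_le:
  fixes Z :: "'a \<Rightarrow> real"
  assumes [measurable]: "Z \<in> borel_measurable M"
    and tail: "\<And>t. t > 0 \<Longrightarrow> measure M {x \<in> space M. Z x > t} \<le> C * t powr (- \<gamma>)"
    and \<kappa>: "0 \<le> \<kappa>" "\<kappa> < \<gamma>" and y: "y > 0" and C: "C \<ge> 0"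
  shows "(\<integral>\<^sup>+x. ennreal (Z x powr \<kappa> * indicator {y<..} (Z x)) \<partial>M)
           \<le> ennreal (C * 2 powr \<kappa> / (1 - 2 powr (\<kappa> - \<gamma>)) * y powr (\<kappa> - \<gamma>))"
proof -
  let ?u = "\<lambda>j x. ennreal ((2 ^ Suc j * y) powr \<kappa>) * indicator {x \<in> space M. Z x > 2 ^ j * y} x"
  have "(\<integral>\<^sup>+x. ennreal (Z x powr \<kappa> * indicator {y<..} (Z x)) \<partial>M) \<le> (\<integral>\<^sup>+x. (\<Sum>j. ?u j x) \<partial>M)"
  proof (rule nn_integral_mono)
    fix x assume x: "x \<in> space M"
    show "ennreal (Z x powr \<kappa> * indicator {y<..} (Z x)) \<le> (\<Sum>j. ?u j x)"
    proof (cases "Z x > y")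
      case True
      have "\<exists>j. Z x \<le> 2 ^ j * y"
      proof -
        obtain j where "Z x / y < 2 ^ j" using real_arch_pow[of 2 "Z x / y"] by auto
        then show ?thesis using y by (intro exI[of _ j]) (simp add: field_simps)
      qed
      then have ex: "\<exists>j. Z x \<le> 2 ^ j * y" .
      \<comment> \<open>The least j with Z x \<le> 2^j y is positive, and Z x lies in the shell
        number j - 1.\<close>
      define j where "j = (LEAST j. Z x \<le> 2 ^ j * y)"
      have j: "Z x \<le> 2 ^ j * y" unfolding j_def by (rule LeastI_ex[OF ex])
      then have "j \<noteq> 0" using True by (intro notI) simp
      then obtain i where i: "j = Suc i" by (cases j) auto
      have i': "Z x > 2 ^ i * y"
        using not_less_Least[of i "\<lambda>j. Z x \<le> 2 ^ j * y"] unfolding j_def[symmetric] i by auto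
      have "ennreal (Z x powr \<kappa> * indicator {y<..} (Z x)) \<le> ?u i x"
        using True i' x j y \<kappa> by (auto simp: i intro!: ennreal_leI powr_mono2)
      also have "\<dots> = (\<Sum>j\<in>{i}. ?u j x)"
        by (simp only: sum.insert[OF finite.emptyI] sum.empty empty_iff not_False_eq_True add_0_right)
      also have "\<dots> \<le> (\<Sum>j. ?u j x)" by (rule sum_le_suminf) auto
      finally show ?thesis .
    qed simp
  qed
  also have "\<dots> = (\<Sum>j. \<integral>\<^sup>+x. ?u j x \<partial>M)"
    by (rule nn_integral_suminf) measurable
  also have "\<dots> = (\<Sum>j. ennreal ((2 ^ Suc j * y) powr \<kappa> * measure M {x \<in> space M. Z x > 2 ^ j * y}))"
    by (subst nn_integral_cmult_indicator) (auto simp: emeasure_eq_measure ennreal_mult')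
  also have "\<dots> \<le> (\<Sum>j. ennreal (C * 2 powr \<kappa> * y powr (\<kappa> - \<gamma>) * (2 powr (\<kappa> - \<gamma>)) ^ j))"
  proof (intro suminf_le ennreal_leI)
    fix j
    have "(2 ^ Suc j * y) powr \<kappa> * measure M {x \<in> space M. Z x > 2 ^ j * y}
        \<le> (2 ^ Suc j * y) powr \<kappa> * (C * (2 ^ j * y) powr (- \<gamma>))"
      using y by (intro mult_left_mono tail) auto
    also have "\<dots> = C * 2 powr \<kappa> * (2 ^ j * y) powr (\<kappa> - \<gamma>)"
      using y by (simp add: powr_diff powr_minus powr_mult mult.assoc) (simp add: field_simps)
    also have "(2 ^ j * y) powr (\<kappa> - \<gamma>) = y powr (\<kappa> - \<gamma>) * (2 powr (\<kappa> - \<gamma>)) ^ j"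
      using y by (simp add: powr_mult powr_powr mult.commute flip: powr_realpow)
    finally show "(2 ^ Suc j * y) powr \<kappa> * measure M {x \<in> space M. Z x > 2 ^ j * y}
        \<le> C * 2 powr \<kappa> * y powr (\<kappa> - \<gamma>) * (2 powr (\<kappa> - \<gamma>)) ^ j" by (simp add: mult_ac)
  qed auto
  also have "\<dots> = ennreal (\<Sum>j. C * 2 powr \<kappa> * y powr (\<kappa> - \<gamma>) * (2 powr (\<kappa> - \<gamma>)) ^ j)"
    using \<kappa> C powr_less_mono[of "\<kappa> - \<gamma>" 0 2] by (intro suminf_ennreal2 summable_mult summable_geometric) auto
  also have "(\<Sum>j. C * 2 powr \<kappa> * y powr (\<kappa> - \<gamma>) * (2 powr (\<kappa> - \<gamma>)) ^ j)
      = C * 2 powr \<kappa> / (1 - 2 powr (\<kappa> - \<gamma>)) * y powr (\<kappa> - \<gamma>)"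
    using \<kappa> powr_less_mono[of "\<kappa> - \<gamma>" 0 2]
    by (subst suminf_mult) (auto intro!: summable_geometric simp: suminf_geometric)
  finally show ?thesis .
qed

lemma (in finite_measure) integrable_powr_if_tail:
  fixes Z :: "'a \<Rightarrow> real"
  assumes [measurable]: "Z \<in> borel_measurable M"
    and tail: "\<And>t. t > 0 \<Longrightarrow> measure M {x \<in> space M. Z x > t} \<le> C * t powr (- \<gamma>)"
    and \<kappa>: "0 \<le> \<kappa>" "\<kappa> < \<gamma>" and C: "C \<ge> 0" and Z: "AE x in M. 0 \<le> Z x"
  shows "integrable M (\<lambda>x. Z x powr \<kappa>)"
proof -
  have "(\<integral>\<^sup>+x. ennreal (Z x powr \<kappa>) \<partial>M)
      \<le> (\<integral>\<^sup>+x. 1 + ennreal (Z x powr \<kappa> * indicator {1<..} (Z x)) \<partial>M)"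
  proof (rule nn_integral_mono_AE)
    show "AE x in M. ennreal (Z x powr \<kappa>) \<le> 1 + ennreal (Z x powr \<kappa> * indicator {1<..} (Z x))"
      using Z
    proof eventually_elim
      case (elim x)
      show ?case
      proof (cases "Z x > 1")
        case False
        then have "Z x powr \<kappa> \<le> 1" using elim \<kappa> by (intro powr_le1) auto
        then show ?thesis using False ennreal_leI[of _ 1] by simp
      qed simp
    qed
  qed
  also have "\<dots> = emeasure M (space M) + (\<integral>\<^sup>+x. ennreal (Z x powr \<kappa> * indicator {1<..} (Z x)) \<partial>M)"
    by (subst nn_integral_add) auto
  also have "\<dots> < \<infinity>"
    using nn_integral_powr_tail_le[OF assms(1) tail \<kappa> _ C, of 1]
    by (auto simp: emeasure_eq_measure less_top[symmetric] top_unique)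
  finally show ?thesis by (intro integrableI_bounded) auto
qed

lemma (in finite_measure) integral_powr_tail_le:
  fixes Z :: "'a \<Rightarrow> real"
  assumes "Z \<in> borel_measurable M"
    and tail: "\<And>t. t > 0 \<Longrightarrow> measure M {x \<in> space M. Z x > t} \<le> C * t powr (- \<gamma>)"
    and \<kappa>: "0 \<le> \<kappa>" "\<kappa> < \<gamma>" and C: "C \<ge> 0" and y: "y > 0"
  shows "(\<integral>x. Z x powr \<kappa> * indicator {y<..} (Z x) \<partial>M)
           \<le> C * 2 powr \<kappa> / (1 - 2 powr (\<kappa> - \<gamma>)) * y powr (\<kappa> - \<gamma>)"
proof -
  have p: "2 powr (\<kappa> - \<gamma>) < 1" using \<kappa> powr_less_mono[of "\<kappa> - \<gamma>" 0 2] by simp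
  have "(\<integral>x. Z x powr \<kappa> * indicator {y<..} (Z x) \<partial>M)
      = enn2real (\<integral>\<^sup>+x. ennreal (Z x powr \<kappa> * indicator {y<..} (Z x)) \<partial>M)"
    using assms(1) by (intro integral_eq_nn_integral) auto
  also have "\<dots> \<le> enn2real (ennreal (C * 2 powr \<kappa> / (1 - 2 powr (\<kappa> - \<gamma>)) * y powr (\<kappa> - \<gamma>)))"
    by (intro enn2real_mono nn_integral_powr_tail_le[OF assms(1) tail \<kappa> y C]) auto
  also have "\<dots> = C * 2 powr \<kappa> / (1 - 2 powr (\<kappa> - \<gamma>)) * y powr (\<kappa> - \<gamma>)"
    using p C by (intro enn2real_ennreal mult_nonneg_nonneg divide_nonneg_nonneg) auto
  finally show ?thesis .
qed


section \<open>The exponent of the stable law\<close>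

text \<open>The compensator has to be x near 0 when \<alpha> \<ge> 1, where x itself is not
  integrable at 0 against the Levy measure, and bounded when \<alpha> \<le> 1, where Z may have no
  mean. At \<alpha> = 1 both are needed. The cutoff \<open>min x 1\<close> is continuous, unlike a
  truncation to 0, so that the compensated exponential is the integral of its derivative.\<close>

definition compensator :: "real \<Rightarrow> real \<Rightarrow> real" where
  "compensator \<alpha> x = (if \<alpha> > 1 then x else if \<alpha> = 1 then min x 1 else 0)"

definition compensated_iexp :: "real \<Rightarrow> real \<Rightarrow> real \<Rightarrow> complex" where
  "compensated_iexp \<alpha> t x = iexp (t * x) - 1 - \<i> * complex_of_real (t * compensator \<alpha> x)"

definition compensated_iexp_deriv :: "real \<Rightarrow> real \<Rightarrow> real \<Rightarrow> complex" where
  "compensated_iexp_deriv \<alpha> t s = \<i> * complex_of_real t *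
     (iexp (t * s) - complex_of_real (if \<alpha> > 1 \<or> \<alpha> = 1 \<and> s < 1 then 1 else 0))"

lemma measurable_compensated_iexp_deriv [measurable]:
  "compensated_iexp_deriv \<alpha> t \<in> borel_measurable borel"
  unfolding compensated_iexp_deriv_def by measurable

lemma measurable_compensated_iexp [measurable]:
  "compensated_iexp \<alpha> t \<in> borel_measurable borel"
  unfolding compensated_iexp_def compensator_def by measurable

text \<open>For \<alpha> \<ge> 1 the compensation makes the derivative O(s) at 0; for \<alpha> < 1
  it is merely bounded. In both cases its product with s^(-\<alpha>) has order s^(p - \<alpha>) with
  p - \<alpha> > -1, which is integrable at 0 because \<alpha> < 2.\<close>

lemma norm_compensated_iexp_deriv_le:
  assumes "s > 0"
  shows "cmod (compensated_iexp_deriv \<alpha> t s) \<le> (2 * \<bar>t\<bar> + t\<^sup>2) * s powr (if \<alpha> \<ge> 1 then 1 else 0)"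
proof -
  have 2: "cmod (compensated_iexp_deriv \<alpha> t s) \<le> 2 * \<bar>t\<bar>"
    using norm_triangle_ineq4[of "iexp (t * s)" 1]
    by (auto simp: compensated_iexp_deriv_def norm_mult mult.commute[of 2] intro!: mult_left_mono)
  show ?thesis
  proof (cases "\<alpha> < 1")
    case True
    then show ?thesis using 2 assms by (auto intro: order_trans)
  next
    case a: False
    show ?thesis
    proof (cases "s < 1")
      case True
      then have "cmod (compensated_iexp_deriv \<alpha> t s) = \<bar>t\<bar> * cmod (iexp (t * s) - iexp 0)"
        using a by (auto simp: compensated_iexp_deriv_def norm_mult)
      also have "\<dots> \<le> \<bar>t\<bar> * \<bar>t * s - 0\<bar>"
        by (intro mult_left_mono norm_iexp_diff_le) auto
      also have "\<dots> = t\<^sup>2 * s" using assms by (simp add: abs_mult power2_eq_square)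
      also have "\<dots> \<le> (2 * \<bar>t\<bar> + t\<^sup>2) * s" using assms by (intro mult_right_mono) auto
      finally show ?thesis using a assms by simp
    next
      case False
      then have "2 * \<bar>t\<bar> * 1 \<le> (2 * \<bar>t\<bar> + t\<^sup>2) * s" by (intro mult_mono) auto
      then show ?thesis using 2 a assms by simp
    qed
  qed
qed

lemma emeasure_lborel_Ioo_finite: "emeasure lborel {x<..<y::real} < \<infinity>"
  by (cases "x \<le> y") auto

lemma set_integrable_compensated_iexp_deriv:
  "set_integrable lborel {0<..<x} (compensated_iexp_deriv \<alpha> t)"
  unfolding set_integrable_def
proof (rule integrableI_bounded_set_indicator[where B="2 * \<bar>t\<bar>"])
  have "cmod (compensated_iexp_deriv \<alpha> t s) \<le> 2 * \<bar>t\<bar>" for s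
    using norm_triangle_ineq4[of "iexp (t * s)" 1]
    by (auto simp: compensated_iexp_deriv_def norm_mult mult.commute[of 2] intro!: mult_left_mono)
  then show "AE s in lborel. s \<in> {0<..<x} \<longrightarrow> norm (compensated_iexp_deriv \<alpha> t s) \<le> 2 * \<bar>t\<bar>" by auto
qed (use emeasure_lborel_Ioo_finite in auto)

lemma compensated_iexp_has_derivative:
  assumes "s \<noteq> 1"
  shows "(compensated_iexp \<alpha> t has_vector_derivative compensated_iexp_deriv \<alpha> t s) (at s)"
proof -
  let ?c = "if \<alpha> > 1 \<or> \<alpha> = 1 \<and> s < 1 then 1 else 0 :: real"
  have c: "(compensator \<alpha> has_field_derivative ?c) (at s)"
  proof (cases "\<alpha> = 1")
    case True
    show ?thesis
    proof (cases "s < 1")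
      case s: True
      have "((\<lambda>x. x) has_field_derivative 1) (at s)" by simp
      then have "(compensator \<alpha> has_field_derivative 1) (at s)"
        by (rule has_field_derivative_transform_within_open[of _ _ _ "{..<1}"])
           (use s True in \<open>auto simp: compensator_def\<close>)
      then show ?thesis using s True by simp
    next
      case s: False
      have "((\<lambda>x. 1) has_field_derivative 0) (at s)" by simp
      then have "(compensator \<alpha> has_field_derivative 0) (at s)"
        by (rule has_field_derivative_transform_within_open[of _ _ _ "{1<..}"])
           (use s True assms in \<open>auto simp: compensator_def\<close>)
      then show ?thesis using s True by simp
    qed
  qed (auto simp: compensator_def[abs_def] intro!: derivative_eq_intros)
  have c2: "((\<lambda>x. complex_of_real (t * compensator \<alpha> x)) has_vector_derivative complex_of_real (t * ?c)) (at s)"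
    using DERIV_cmult[OF c, of t] has_real_derivative_iff_has_vector_derivative has_vector_derivative_of_real by blast
  have "((\<lambda>x. t * x) has_vector_derivative t) (at s)"
    by (auto intro!: derivative_eq_intros)
  from vector_diff_chain_at[OF this has_vector_derivative_iexp]
  have e2: "((\<lambda>x. iexp (t * x)) has_vector_derivative \<i> * complex_of_real t * iexp (t * s)) (at s)"
    by (simp only: o_def scaleR_conv_of_real) (simp only: mult_ac)
  show ?thesis
    using has_vector_derivative_diff[OF has_vector_derivative_diff[OF e2 has_vector_derivative_const[of 1]]
        has_vector_derivative_mult_right[OF c2, of \<i>]]
    unfolding compensated_iexp_def[abs_def] compensated_iexp_deriv_def
    by (simp only: of_real_mult right_diff_distrib mult.assoc diff_zero)
qed

lemma integral_compensated_iexp_deriv: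
  assumes "x \<ge> 0"
  shows "(LINT s:{0<..<x}|lborel. compensated_iexp_deriv \<alpha> t s) = compensated_iexp \<alpha> t x"
proof -
  have "continuous_on {0..x} (compensated_iexp \<alpha> t)"
    unfolding compensated_iexp_def[abs_def] compensator_def[abs_def]
    by (cases "\<alpha> > 1"; cases "\<alpha> = 1") (auto intro!: continuous_intros)
  then have "(compensated_iexp_deriv \<alpha> t has_integral compensated_iexp \<alpha> t x - compensated_iexp \<alpha> t 0) {0..x}"
    by (intro fundamental_theorem_of_calculus_interior_strong[of "{1}"] compensated_iexp_has_derivative assms) auto
  moreover have "compensated_iexp \<alpha> t 0 = 0"
    by (simp add: compensated_iexp_def compensator_def)
  ultimately have "(compensated_iexp_deriv \<alpha> t has_integral compensated_iexp \<alpha> t x) {0<..<x}"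
    by (simp add: has_integral_Icc_iff_Ioo)
  then show ?thesis
    using set_borel_integral_eq_integral(2)[OF set_integrable_compensated_iexp_deriv[of x \<alpha> t]]
    by (simp add: integral_unique)
qed

text \<open>Integration by parts: the function is the integral of its derivative over 0 < s < Z/T,
  and exchanging the integrals turns the event Z > s T into a tail probability. The cutoff K
  confines s to a set of finite measure, which makes the bounded derivative integrable for Fubini's
  theorem.\<close>

lemma (in real_distribution) expectation_truncated_compensated_iexp:
  assumes nonneg: "AE z in M. 0 \<le> z" and T: "T > 0" and K: "K \<ge> 0"
  shows "(\<integral>z. compensated_iexp \<alpha> t (min (z / T) K) \<partial>M)
    = (\<integral>s. indicator {0<..<K} s *\<^sub>R (measure M {s * T<..} *\<^sub>R compensated_iexp_deriv \<alpha> t s) \<partial>lborel)"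
proof -
  interpret P: pair_sigma_finite M lborel ..
  let ?f = "\<lambda>z s. indicator {0<..<K} s *\<^sub>R (indicator {s * T<..} z *\<^sub>R compensated_iexp_deriv \<alpha> t s)"
  have [measurable_cong]: "sets M = sets borel" by simp
  \<comment> \<open>Rewritten as a bounded function on a set of finite product measure, the form in
    which measurability and integrability are shown.\<close>
  have f_eq: "?f z s = indicator (UNIV \<times> {0<..<K}) (z, s) *\<^sub>R
      (indicator {x. snd x * T < fst x} (z, s) *\<^sub>R compensated_iexp_deriv \<alpha> t (snd (z, s)))" for z s
    by (auto simp: indicator_def)
  have [measurable]: "(\<lambda>(z, s). ?f z s) \<in> borel_measurable (M \<Otimes>\<^sub>M lborel)"
    unfolding f_eq case_prod_eta by measurable
  have "(\<integral>z. compensated_iexp \<alpha> t (min (z / T) K) \<partial>M) = (\<integral>z. (\<integral>s. ?f z s \<partial>lborel) \<partial>M)"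
  proof (rule integral_cong_AE)
    show "AE z in M. compensated_iexp \<alpha> t (min (z / T) K) = (\<integral>s. ?f z s \<partial>lborel)"
      using nonneg
    proof eventually_elim
      case (elim z)
      have "(\<integral>s. ?f z s \<partial>lborel) = (LINT s:{0<..<min (z / T) K}|lborel. compensated_iexp_deriv \<alpha> t s)"
        unfolding set_lebesgue_integral_def
        using T by (intro Bochner_Integration.integral_cong) (auto simp: indicator_def field_simps)
      then show ?case using elim T K by (simp add: integral_compensated_iexp_deriv)
    qed
  qed measurable
  also have "\<dots> = (\<integral>s. (\<integral>z. ?f z s \<partial>M) \<partial>lborel)"
  proof (rule P.Fubini_integral[symmetric])
    have "integrable (M \<Otimes>\<^sub>M lborel) (\<lambda>x. indicator (UNIV \<times> {0<..<K}) x *\<^sub>R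
        (indicator {x. snd x * T < fst x} x *\<^sub>R compensated_iexp_deriv \<alpha> t (snd x)))"
    proof (rule integrableI_bounded_set_indicator[where B="2 * \<bar>t\<bar>"])
      have "cmod (compensated_iexp_deriv \<alpha> t s) \<le> 2 * \<bar>t\<bar>" for s
        using norm_triangle_ineq4[of "iexp (t * s)" 1]
        by (auto simp: compensated_iexp_deriv_def norm_mult mult.commute[of 2] intro!: mult_left_mono)
      then show "AE x in M \<Otimes>\<^sub>M lborel. x \<in> UNIV \<times> {0<..<K} \<longrightarrow>
          norm (indicator {x. snd x * T < fst x} x *\<^sub>R compensated_iexp_deriv \<alpha> t (snd x)) \<le> 2 * \<bar>t\<bar>"
        by (auto simp: indicator_def)
      show "emeasure (M \<Otimes>\<^sub>M lborel) (UNIV \<times> {0<..<K}) < \<infinity>"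
        by (subst lborel.emeasure_pair_measure_Times)
           (use emeasure_lborel_Ioo_finite[of 0 K] in \<open>auto simp: ennreal_mult_less_top emeasure_eq_measure\<close>)
    qed measurable
    then show "integrable (M \<Otimes>\<^sub>M lborel) (case_prod ?f)"
      unfolding f_eq case_prod_beta prod.collapse .
  qed
  also have "\<dots> = (\<integral>s. indicator {0<..<K} s *\<^sub>R (measure M {s * T<..} *\<^sub>R compensated_iexp_deriv \<alpha> t s) \<partial>lborel)"
  proof (intro Bochner_Integration.integral_cong refl)
    fix s
    have "(\<integral>z. indicator {s * T<..} z *\<^sub>R compensated_iexp_deriv \<alpha> t s \<partial>M)
        = measure M {s * T<..} *\<^sub>R compensated_iexp_deriv \<alpha> t s"
      by (subst integral_scaleR_left) (auto simp: emeasure_eq_measure)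
    then show "(\<integral>z. ?f z s \<partial>M) = indicator {0<..<K} s *\<^sub>R (measure M {s * T<..} *\<^sub>R compensated_iexp_deriv \<alpha> t s)"
      by (simp only: integral_scaleR_right)
  qed
  finally show ?thesis .
qed

text \<open>Above K the compensator contributes a linear term only for \<alpha> > 1. For \<alpha>
  \<le> 1 the condition K \<ge> 1 makes the compensators of x and K equal, and a difference of two
  numbers of modulus 1 is left.\<close>

lemma compensated_iexp_truncation_le:
  assumes "x \<ge> 0" "K \<ge> 1"
  shows "cmod (compensated_iexp \<alpha> t x - compensated_iexp \<alpha> t (min x K))
    \<le> 2 * (1 + \<bar>t\<bar>) * (x powr (if \<alpha> > 1 then 1 else 0) * indicator {K<..} x)"
proof (cases "x > K")
  case True
  show ?thesis
  proof (cases "\<alpha> > 1")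
    case a: True
    have "compensated_iexp \<alpha> t x - compensated_iexp \<alpha> t (min x K)
        = (iexp (t * x) - iexp (t * K)) - \<i> * complex_of_real (t * (x - K))"
      using a True by (simp add: compensated_iexp_def compensator_def algebra_simps)
    also have "cmod \<dots> \<le> \<bar>t * x - t * K\<bar> + \<bar>t * (x - K)\<bar>"
      by (rule order_trans[OF norm_triangle_ineq4 add_mono[OF norm_iexp_diff_le]])
         (simp only: norm_mult norm_ii norm_of_real mult_1 order_refl)
    also have "\<dots> = 2 * \<bar>t\<bar> * (x - K)"
      using True by (simp add: abs_mult flip: right_diff_distrib)
    also have "\<dots> \<le> 2 * (1 + \<bar>t\<bar>) * x"
      using True assms by (intro mult_mono) auto
    finally show ?thesis using a True assms by simp
  next
    case a: False
    have "compensated_iexp \<alpha> t x - compensated_iexp \<alpha> t (min x K) = iexp (t * x) - iexp (t * K)"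
      using a True assms by (simp add: compensated_iexp_def compensator_def)
    also have "cmod \<dots> \<le> 2" by (rule norm_iexp_diff_le_2)
    finally show ?thesis using a True assms by simp
  qed
qed (use assms in \<open>simp add: min_def\<close>)

text \<open>The integral of \<open>compensated_iexp \<alpha> t (min x K)\<close> against the Levy
  measure on the positive half-line with tail a s^(-\<alpha>), after integration by parts.\<close>

definition truncated_stable_exponent :: "real \<Rightarrow> real \<Rightarrow> real \<Rightarrow> real \<Rightarrow> complex" where
  "truncated_stable_exponent \<alpha> a t K =
     (\<integral>s. indicator {0<..<K} s *\<^sub>R ((a * s powr (- \<alpha>)) *\<^sub>R compensated_iexp_deriv \<alpha> t s) \<partial>lborel)"

text \<open>A limit rather than an integral over the half-line: for \<alpha> \<le> 1 the integrand
  has size s^(-\<alpha>) at infinity, and the integral converges only through the oscillation of the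
  exponential.\<close>

definition stable_exponent :: "real \<Rightarrow> real \<Rightarrow> real \<Rightarrow> complex" where
  "stable_exponent \<alpha> a t = lim (\<lambda>k. truncated_stable_exponent \<alpha> a t (real k))"

lemma integrable_powr_Ioo:
  assumes "p > -1"
  shows "integrable lborel (\<lambda>s. indicator {0<..<K} s * s powr p :: real)"
proof (cases "K \<ge> 0")
  case True
  have "(\<lambda>s. s powr p) absolutely_integrable_on {0..K}"
    using assms True by (intro nonnegative_absolutely_integrable_1 integrable_on_powr_from_0) auto
  then have "(\<lambda>s. s powr p) absolutely_integrable_on {0<..<K}"
    by (rule set_integrable_subset) auto
  then have "integrable lebesgue (\<lambda>s. indicator {0<..<K} s *\<^sub>R (s powr p) :: real)"
    unfolding set_integrable_def .
  then show ?thesis by (subst (asm) integrable_completion) auto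
qed simp

context
  fixes \<mu> :: "real measure" and \<alpha> a :: real
  assumes law: "power_tail_law \<alpha> a \<mu>" and \<alpha>: "0 < \<alpha>" "\<alpha> < 2"
begin

interpretation real_distribution \<mu>
  using law by (simp add: power_tail_law_def)

lemma power_tail_law_nonneg: "AE z in \<mu>. 0 \<le> z"
  using law by (simp add: power_tail_law_def)

lemma power_tail_law_bound: "\<exists>C>0. \<forall>t>0. prob {t<..} \<le> C * t powr (- \<alpha>)"
  using law \<alpha> by (intro power_tail_bound[where b=a]) (auto simp: power_tail_law_def)

lemma power_tail_law_scaled:
  assumes "s > 0"
  shows "((\<lambda>T. T powr \<alpha> * prob {s * T<..}) \<longlongrightarrow> a * s powr (- \<alpha>)) at_top"
proof -
  have l: "((\<lambda>t. prob {t<..} * t powr \<alpha>) \<longlongrightarrow> a) at_top"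
    using law by (simp add: power_tail_law_def)
  have "filterlim (\<lambda>T. s * T) at_top at_top"
    using assms by (intro filterlim_tendsto_pos_mult_at_top[OF tendsto_const]) (auto simp: filterlim_ident)
  from filterlim_compose[OF l this]
  have "((\<lambda>T. prob {s * T<..} * (s * T) powr \<alpha> * s powr (- \<alpha>)) \<longlongrightarrow> a * s powr (- \<alpha>)) at_top"
    by (intro tendsto_mult_right)
  then show ?thesis
  proof (rule Lim_transform_eventually)
    show "\<forall>\<^sub>F T in at_top. prob {s * T<..} * (s * T) powr \<alpha> * s powr (- \<alpha>) = T powr \<alpha> * prob {s * T<..}"
      using eventually_gt_at_top[of 0]
      by eventually_elim (use assms in \<open>simp add: powr_mult powr_minus field_simps\<close>)
  qed
qed

text \<open>The bound \<open>T\<^sup>\<alpha> P(Z > s T) \<le> C s\<^bsup>-\<alpha>\<^esup>\<close> dominates the integrand uniformly in \<open>T\<close>.\<close>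

lemma truncated_stable_exponent_tendsto:
  assumes K: "K \<ge> 0"
  shows "((\<lambda>T. T powr \<alpha> *\<^sub>R (\<integral>z. compensated_iexp \<alpha> t (min (z / T) K) \<partial>\<mu>))
    \<longlongrightarrow> truncated_stable_exponent \<alpha> a t K) at_top"
proof -
  obtain C where C: "C > 0" "\<And>t. t > 0 \<Longrightarrow> prob {t<..} \<le> C * t powr (- \<alpha>)"
    using power_tail_law_bound by blast
  let ?p = "if \<alpha> \<ge> 1 then 1 else 0 :: real"
  let ?w = "\<lambda>s. C * (2 * \<bar>t\<bar> + t\<^sup>2) * (indicator {0<..<K} s * s powr (?p - \<alpha>))"
  let ?s = "\<lambda>T s. indicator {0<..<K} s *\<^sub>R ((T powr \<alpha> * prob {s * T<..}) *\<^sub>R compensated_iexp_deriv \<alpha> t s)"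
  have [measurable]: "(\<lambda>s. prob {s * T<..}) \<in> borel_measurable borel" for T
  proof -
    have [measurable]: "cdf \<mu> \<in> borel_measurable borel"
      by (intro borel_measurable_mono monoI cdf_nondecreasing)
    have "prob {y<..} = 1 - cdf \<mu> y" for y
      using prob_compl[of "{..y}"] by (simp add: cdf_def Compl_eq_Diff_UNIV[symmetric])
    then show ?thesis by simp
  qed
  have "((\<lambda>T. \<integral>s. ?s T s \<partial>lborel) \<longlongrightarrow> truncated_stable_exponent \<alpha> a t K) at_top"
    unfolding truncated_stable_exponent_def
  proof (rule integral_dominated_convergence_at_top[where w="?w"])
    show "AE s in lborel. ((\<lambda>T. ?s T s) \<longlongrightarrow> indicator {0<..<K} s *\<^sub>R ((a * s powr (- \<alpha>)) *\<^sub>R compensated_iexp_deriv \<alpha> t s)) at_top"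
      by (intro AE_I2) (auto simp: indicator_def intro!: tendsto_intros power_tail_law_scaled)
    show "\<forall>\<^sub>F T in at_top. AE s in lborel. norm (?s T s) \<le> ?w s"
      using eventually_gt_at_top[of 0]
    proof eventually_elim
      case (elim T)
      have "norm (?s T s) \<le> ?w s" for s
      proof (cases "s \<in> {0<..<K}")
        case True
        then have s: "s > 0" by simp
        have "norm (?s T s) = T powr \<alpha> * prob {s * T<..} * cmod (compensated_iexp_deriv \<alpha> t s)"
          using True by simp
        also have "\<dots> \<le> T powr \<alpha> * (C * (s * T) powr (- \<alpha>)) * ((2 * \<bar>t\<bar> + t\<^sup>2) * s powr ?p)"
          using s elim C by (intro mult_mono norm_compensated_iexp_deriv_le) auto
        also have "\<dots> = C * (2 * \<bar>t\<bar> + t\<^sup>2) * s powr (?p - \<alpha>)"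
          using s elim by (simp add: powr_mult powr_minus powr_diff field_simps)
        finally show ?thesis using True by simp
      qed simp
      then show ?case by simp
    qed
    show "integrable lborel ?w" using \<alpha> by (intro integrable_mult_right integrable_powr_Ioo) auto
    show "(\<lambda>s. indicator {0<..<K} s *\<^sub>R ((a * s powr (- \<alpha>)) *\<^sub>R compensated_iexp_deriv \<alpha> t s)) \<in> borel_measurable lborel"
      by measurable
    show "\<And>T. ?s T \<in> borel_measurable lborel" by measurable
  qed
  then show ?thesis
  proof (rule Lim_transform_eventually)
    show "\<forall>\<^sub>F T in at_top. (\<integral>s. ?s T s \<partial>lborel) = T powr \<alpha> *\<^sub>R (\<integral>z. compensated_iexp \<alpha> t (min (z / T) K) \<partial>\<mu>)"
      using eventually_gt_at_top[of 0]
    proof eventually_elim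
      case (elim T)
      show ?case
        unfolding expectation_truncated_compensated_iexp[OF power_tail_law_nonneg elim K] integral_scaleR_right[symmetric]
        by (intro Bochner_Integration.integral_cong refl) (simp add: mult.commute)
    qed
  qed
qed


lemma integrable_compensator_power_tail:
  assumes "T > 0"
  shows "integrable \<mu> (\<lambda>z. compensator \<alpha> (z / T))"
proof (cases "\<alpha> > 1")
  case True
  obtain C where C: "C > 0" "\<And>t. t > 0 \<Longrightarrow> prob {t<..} \<le> C * t powr (- \<alpha>)"
    using power_tail_law_bound by blast
  have "integrable \<mu> (\<lambda>z. z powr 1)"
    by (rule integrable_powr_if_tail[where C=C and \<gamma>=\<alpha>])
       (use C True power_tail_law_nonneg in \<open>auto simp: greaterThan_def\<close>)
  then have "integrable \<mu> (\<lambda>z. z)"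
    by (rule integrable_cong_AE[THEN iffD1, rotated 3]) (use power_tail_law_nonneg in \<open>auto elim: AE_mp\<close>)
  then show ?thesis using True by (simp add: compensator_def)
next
  case False
  have [measurable]: "compensator \<alpha> \<in> borel_measurable borel"
    unfolding compensator_def[abs_def] by measurable
  show ?thesis
  proof (rule integrable_const_bound[where B=1])
    show "AE z in \<mu>. norm (compensator \<alpha> (z / T)) \<le> 1"
      using power_tail_law_nonneg
      by eventually_elim (use False assms in \<open>auto simp: compensator_def min_def\<close>)
  qed measurable
qed

lemma integrable_compensated_iexp:
  assumes "T > 0"
  shows "integrable \<mu> (\<lambda>z. compensated_iexp \<alpha> t (z / T))"
  unfolding compensated_iexp_def
  by (intro Bochner_Integration.integrable_diff integrable_mult_right integrable_of_real
      integrable_compensator_power_tail assms integrable_const_bound[where B=1]) auto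

text \<open>The expectation of Z^\<kappa> over Z > K T is O((K T)^(\<kappa> - \<alpha>)); the factor
  T^(-\<kappa>) from the scaling and the prefactor T^\<alpha> cancel every power of T. The
  interchange of limits relies on this uniformity in T, the continuity at t = 0 on the explicit
  dependence on t.\<close>

lemma compensated_iexp_remainder:
  "\<exists>D>0. \<forall>t. \<forall>T>0. \<forall>K\<ge>1.
     cmod (T powr \<alpha> *\<^sub>R (\<integral>z. compensated_iexp \<alpha> t (z / T) \<partial>\<mu>)
         - T powr \<alpha> *\<^sub>R (\<integral>z. compensated_iexp \<alpha> t (min (z / T) K) \<partial>\<mu>))
      \<le> D * (1 + \<bar>t\<bar>) * K powr (- (if \<alpha> > 1 then \<alpha> - 1 else \<alpha>))"
proof -
  obtain C where C: "C > 0" "\<And>t. t > 0 \<Longrightarrow> prob {t<..} \<le> C * t powr (- \<alpha>)"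
    using power_tail_law_bound by blast
  define \<kappa> where "\<kappa> = (if \<alpha> > 1 then 1 else 0 :: real)"
  have \<kappa>: "0 \<le> \<kappa>" "\<kappa> < \<alpha>" using \<alpha> by (auto simp: \<kappa>_def)
  define D where "D = C * 2 powr \<kappa> / (1 - 2 powr (\<kappa> - \<alpha>))"
  have p: "2 powr (\<kappa> - \<alpha>) < 1" using \<kappa> powr_less_mono[of "\<kappa> - \<alpha>" 0 2] by simp
  have D: "D > 0" using C p by (simp add: D_def)
  have "cmod (T powr \<alpha> *\<^sub>R (\<integral>z. compensated_iexp \<alpha> t (z / T) \<partial>\<mu>)
         - T powr \<alpha> *\<^sub>R (\<integral>z. compensated_iexp \<alpha> t (min (z / T) K) \<partial>\<mu>))
      \<le> 2 * D * (1 + \<bar>t\<bar>) * K powr (\<kappa> - \<alpha>)" if T: "T > 0" and K: "K \<ge> 1" for t T K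
  proof -
    note i = integrable_compensated_iexp[OF T, of t]
    have ip: "integrable \<mu> (\<lambda>z. z powr \<kappa>)"
      by (rule integrable_powr_if_tail[where C=C and \<gamma>=\<alpha>])
         (use C \<kappa> power_tail_law_nonneg in \<open>auto simp: greaterThan_def\<close>)
    have ii: "integrable \<mu> (\<lambda>z. z powr \<kappa> * indicator {K * T<..} z)"
      using ip by (rule Bochner_Integration.integrable_bound) (auto simp: indicator_def)
    let ?d = "\<lambda>z. compensated_iexp \<alpha> t (z / T) - compensated_iexp \<alpha> t (min (z / T) K)"
    let ?b = "\<lambda>z. 2 * (1 + \<bar>t\<bar>) * T powr (- \<kappa>) * (z powr \<kappa> * indicator {K * T<..} z)"
    have b: "AE z in \<mu>. norm (?d z) \<le> ?b z"
      using power_tail_law_nonneg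
    proof eventually_elim
      case (elim z)
      have "norm (?d z) \<le> 2 * (1 + \<bar>t\<bar>) * ((z / T) powr \<kappa> * indicator {K<..} (z / T))"
        using compensated_iexp_truncation_le[of "z / T" K \<alpha> t] elim T K by (simp add: \<kappa>_def)
      also have "(z / T) powr \<kappa> * indicator {K<..} (z / T) = T powr (- \<kappa>) * (z powr \<kappa> * indicator {K * T<..} z)"
        using elim T by (simp add: powr_divide powr_minus indicator_def field_simps)
      finally show ?case by (simp only: mult.assoc)
    qed
    have id: "integrable \<mu> ?d"
      by (rule Bochner_Integration.integrable_bound[OF integrable_mult_right[OF ii, of "2 * (1 + \<bar>t\<bar>) * T powr (- \<kappa>)"]])
         (use b in \<open>auto elim: AE_mp\<close>)
    have "(\<integral>z. compensated_iexp \<alpha> t (z / T) \<partial>\<mu>) - (\<integral>z. compensated_iexp \<alpha> t (min (z / T) K) \<partial>\<mu>) = (\<integral>z. ?d z \<partial>\<mu>)"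
      using Bochner_Integration.integrable_diff[OF i id] i
      by (intro Bochner_Integration.integral_diff[symmetric]) auto
    also have "cmod \<dots> \<le> 2 * (1 + \<bar>t\<bar>) * T powr (- \<kappa>) * (\<integral>z. z powr \<kappa> * indicator {K * T<..} z \<partial>\<mu>)"
      unfolding integral_mult_right_zero[symmetric]
      by (rule order_trans[OF integral_norm_bound integral_mono_AE[OF integrable_norm[OF id] integrable_mult_right[OF ii] b]])
    also have "\<dots> \<le> 2 * (1 + \<bar>t\<bar>) * T powr (- \<kappa>) * (D * (K * T) powr (\<kappa> - \<alpha>))"
      unfolding D_def using T K C \<kappa>
      by (intro mult_left_mono integral_powr_tail_le) (auto simp: greaterThan_def)
    also have "\<dots> = 2 * D * (1 + \<bar>t\<bar>) * K powr (\<kappa> - \<alpha>) * T powr (- \<alpha>)"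
      using T K by (simp add: powr_mult powr_diff powr_minus field_simps)
    finally have "T powr \<alpha> * cmod ((\<integral>z. compensated_iexp \<alpha> t (z / T) \<partial>\<mu>) - (\<integral>z. compensated_iexp \<alpha> t (min (z / T) K) \<partial>\<mu>))
        \<le> T powr \<alpha> * (2 * D * (1 + \<bar>t\<bar>) * K powr (\<kappa> - \<alpha>) * T powr (- \<alpha>))"
      by (rule mult_left_mono) simp
    also have "\<dots> = 2 * D * (1 + \<bar>t\<bar>) * K powr (\<kappa> - \<alpha>)" using T by (simp add: powr_minus)
    finally show ?thesis by (simp flip: scaleR_diff_right)
  qed
  moreover have "- (if \<alpha> > 1 then \<alpha> - 1 else \<alpha>) = \<kappa> - \<alpha>" by (simp add: \<kappa>_def)
  ultimately show ?thesis using D by (intro exI[of _ "2 * D"]) auto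
qed


text \<open>The limits in T and K may be interchanged because the cutoff error is uniform in T. At
  each T two cutoffs are compared through the expectation without cutoff; hence the truncated
  exponents form a Cauchy sequence in K, and its limit is also the limit in T.\<close>

theorem stable_exponent_tendsto:
  "((\<lambda>T. T powr \<alpha> *\<^sub>R (\<integral>z. compensated_iexp \<alpha> t (z / T) \<partial>\<mu>)) \<longlongrightarrow> stable_exponent \<alpha> a t) at_top"
    and truncated_stable_exponent_near:
  "\<exists>D>0. \<forall>t. \<forall>K\<ge>1. cmod (stable_exponent \<alpha> a t - truncated_stable_exponent \<alpha> a t K)
     \<le> D * (1 + \<bar>t\<bar>) * K powr (- (if \<alpha> > 1 then \<alpha> - 1 else \<alpha>))"
proof -
  let ?\<delta> = "if \<alpha> > 1 then \<alpha> - 1 else \<alpha>"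
  let ?\<Phi> = "\<lambda>t T. T powr \<alpha> *\<^sub>R (\<integral>z. compensated_iexp \<alpha> t (z / T) \<partial>\<mu>)"
  let ?\<Phi>K = "\<lambda>t K T. T powr \<alpha> *\<^sub>R (\<integral>z. compensated_iexp \<alpha> t (min (z / T) K) \<partial>\<mu>)"
  let ?I = "truncated_stable_exponent \<alpha> a"
  obtain D where D: "D > 0" "\<And>t T K. T > 0 \<Longrightarrow> K \<ge> 1 \<Longrightarrow> cmod (?\<Phi> t T - ?\<Phi>K t K T) \<le> D * (1 + \<bar>t\<bar>) * K powr (- ?\<delta>)"
    using compensated_iexp_remainder by blast
  define \<eta> where "\<eta> t K = D * (1 + \<bar>t\<bar>) * K powr (- ?\<delta>)" for t K :: real
  have \<eta>0: "((\<lambda>K. \<eta> t K) \<longlongrightarrow> 0) at_top" for t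
    unfolding \<eta>_def using \<alpha> by (intro tendsto_mult_right_zero tendsto_neg_powr filterlim_ident) auto
  have II: "cmod (?I t K - ?I t L) \<le> \<eta> t K + \<eta> t L" if "K \<ge> 1" "L \<ge> 1" for t K L
  proof (rule tendsto_upperbound)
    show "((\<lambda>T. cmod (?\<Phi>K t K T - ?\<Phi>K t L T)) \<longlongrightarrow> cmod (?I t K - ?I t L)) at_top"
      using that by (intro tendsto_intros truncated_stable_exponent_tendsto) auto
    show "\<forall>\<^sub>F T in at_top. cmod (?\<Phi>K t K T - ?\<Phi>K t L T) \<le> \<eta> t K + \<eta> t L"
      using eventually_gt_at_top[of 0]
    proof eventually_elim
      case (elim T)
      have "cmod (?\<Phi>K t K T - ?\<Phi>K t L T) = cmod ((?\<Phi> t T - ?\<Phi>K t L T) - (?\<Phi> t T - ?\<Phi>K t K T))" by simp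
      also have "\<dots> \<le> \<eta> t L + \<eta> t K"
        unfolding \<eta>_def by (rule order_trans[OF norm_triangle_ineq4 add_mono[OF D(2) D(2)]]) (use elim that in auto)
      finally show ?case by simp
    qed
  qed simp
  have conv: "(\<lambda>k. ?I t (real k)) \<longlonglongrightarrow> stable_exponent \<alpha> a t" for t
  proof -
    have "Cauchy (\<lambda>k. ?I t (real k))"
    proof (rule CauchyI)
      fix e :: real assume e: "e > 0"
      from order_tendstoD(2)[OF \<eta>0, of "e/2" t] e
      have "\<forall>\<^sub>F K in at_top. \<eta> t K < e / 2" by simp
      then obtain K0 where K0: "\<And>K. K \<ge> K0 \<Longrightarrow> \<eta> t K < e / 2" by (auto simp: eventually_at_top_linorder)
      obtain M :: nat where M: "real M \<ge> max K0 1" using real_arch_simple by blast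
      have "cmod (?I t (real k) - ?I t (real l)) < e" if "k \<ge> M" "l \<ge> M" for k l
        using II[of "real k" "real l" t] K0[of "real k"] K0[of "real l"] that M by force
      then show "\<exists>M. \<forall>m\<ge>M. \<forall>n\<ge>M. norm (?I t (real m) - ?I t (real n)) < e" by blast
    qed
    then show ?thesis unfolding stable_exponent_def by (simp add: Cauchy_convergent_iff convergent_LIMSEQ_iff)
  qed
  have near: "cmod (stable_exponent \<alpha> a t - ?I t K) \<le> \<eta> t K" if "K \<ge> 1" for t K
  proof (rule tendsto_le)
    show "(\<lambda>k. cmod (?I t (real k) - ?I t K)) \<longlonglongrightarrow> cmod (stable_exponent \<alpha> a t - ?I t K)"
      by (intro tendsto_intros conv)
    show "(\<lambda>k. \<eta> t (real k) + \<eta> t K) \<longlonglongrightarrow> \<eta> t K"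
      using tendsto_add[OF filterlim_compose[OF \<eta>0 filterlim_real_sequentially] tendsto_const] by simp
    show "\<forall>\<^sub>F k in sequentially. cmod (?I t (real k) - ?I t K) \<le> \<eta> t (real k) + \<eta> t K"
      using eventually_ge_at_top[of 1] by eventually_elim (use II that in auto)
  qed simp
  show "\<exists>D>0. \<forall>t. \<forall>K\<ge>1. cmod (stable_exponent \<alpha> a t - ?I t K) \<le> D * (1 + \<bar>t\<bar>) * K powr (- ?\<delta>)"
    using near D(1) unfolding \<eta>_def by blast
  show "(?\<Phi> t \<longlongrightarrow> stable_exponent \<alpha> a t) at_top"
  proof (rule tendstoI)
    fix e :: real assume e: "e > 0"
    have "\<forall>\<^sub>F K in at_top. \<eta> t K < e / 3"
      using order_tendstoD(2)[OF \<eta>0, of "e/3" t] e by simp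
    then have "\<forall>\<^sub>F K in at_top. 1 \<le> K \<and> \<eta> t K < e / 3"
      using eventually_ge_at_top[of 1] by eventually_elim auto
    then obtain K where K: "1 \<le> K" "\<eta> t K < e / 3" by (auto simp: eventually_at_top_linorder)
    have "\<forall>\<^sub>F T in at_top. dist (?\<Phi>K t K T) (?I t K) < e / 3"
      using K e by (intro tendstoD[OF truncated_stable_exponent_tendsto]) auto
    then show "\<forall>\<^sub>F T in at_top. dist (?\<Phi> t T) (stable_exponent \<alpha> a t) < e"
      using eventually_gt_at_top[of 0]
    proof eventually_elim
      case (elim T)
      have 1: "dist (?\<Phi> t T) (?\<Phi>K t K T) \<le> \<eta> t K" using D(2) elim K by (simp add: dist_norm \<eta>_def)
      have 2: "dist (?I t K) (stable_exponent \<alpha> a t) \<le> \<eta> t K"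
        using near[of K t] K by (simp add: dist_norm norm_minus_commute)
      show ?case
        using dist_triangle[of "?\<Phi> t T" "stable_exponent \<alpha> a t" "?\<Phi>K t K T"]
          dist_triangle[of "?\<Phi>K t K T" "stable_exponent \<alpha> a t" "?I t K"] 1 2 elim K by linarith
    qed
  qed
qed

text \<open>On |t| < 1 the cutoff error is small uniformly in t once K is large, and at that fixed K
  the truncated exponent is at most a constant times 2 |t| + t^2.\<close>

lemma isCont_stable_exponent_0: "isCont (stable_exponent \<alpha> a) 0"
proof -
  let ?\<delta> = "if \<alpha> > 1 then \<alpha> - 1 else \<alpha>"
  let ?p = "if \<alpha> \<ge> 1 then 1 else 0 :: real"
  obtain D where D: "D > 0" "\<And>t K. K \<ge> 1 \<Longrightarrow> cmod (stable_exponent \<alpha> a t - truncated_stable_exponent \<alpha> a t K)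
     \<le> D * (1 + \<bar>t\<bar>) * K powr (- ?\<delta>)"
    using truncated_stable_exponent_near by blast
  define J where "J K = (\<integral>s. indicator {0<..<K} s * s powr (?p - \<alpha>) \<partial>lborel)" for K :: real
  have I: "cmod (truncated_stable_exponent \<alpha> a t K) \<le> \<bar>a\<bar> * (2 * \<bar>t\<bar> + t\<^sup>2) * J K" for t K
  proof -
    let ?f = "\<lambda>s. indicator {0<..<K} s *\<^sub>R ((a * s powr (- \<alpha>)) *\<^sub>R compensated_iexp_deriv \<alpha> t s)"
    let ?w = "\<lambda>s. \<bar>a\<bar> * (2 * \<bar>t\<bar> + t\<^sup>2) * (indicator {0<..<K} s * s powr (?p - \<alpha>))"
    have w: "integrable lborel ?w" using \<alpha> by (intro integrable_mult_right integrable_powr_Ioo) auto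
    have fw: "norm (?f s) \<le> ?w s" for s
    proof (cases "s \<in> {0<..<K}")
      case True
      then have s: "s > 0" by simp
      have "norm (?f s) = \<bar>a\<bar> * s powr (- \<alpha>) * cmod (compensated_iexp_deriv \<alpha> t s)"
        using True by (simp add: abs_mult)
      also have "\<dots> \<le> \<bar>a\<bar> * s powr (- \<alpha>) * ((2 * \<bar>t\<bar> + t\<^sup>2) * s powr ?p)"
        using s by (intro mult_left_mono norm_compensated_iexp_deriv_le) auto
      also have "\<dots> = \<bar>a\<bar> * (2 * \<bar>t\<bar> + t\<^sup>2) * s powr (?p - \<alpha>)"
        by (simp add: powr_diff powr_minus field_simps)
      finally show ?thesis using True by simp
    qed simp
    have "cmod (truncated_stable_exponent \<alpha> a t K) \<le> (\<integral>s. ?w s \<partial>lborel)"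
      unfolding truncated_stable_exponent_def
    proof (rule order_trans[OF integral_norm_bound integral_mono[OF _ w fw]])
      show "integrable lborel (\<lambda>s. norm (?f s))"
        by (rule integrable_norm, rule Bochner_Integration.integrable_bound[OF w]) (use fw in \<open>auto intro: order_trans[OF _ abs_ge_self]\<close>)
    qed
    then show ?thesis unfolding J_def by simp
  qed
  have zero: "stable_exponent \<alpha> a 0 = 0"
    by (rule tendsto_unique[OF _ stable_exponent_tendsto]) (auto simp: compensated_iexp_def)
  show ?thesis unfolding isCont_def zero
  proof (rule tendstoI)
    fix e :: real assume e: "e > 0"
    \<comment> \<open>The factor \<open>1 + 1\<close> bounds 1 + |t| on the neighbourhood |t| < 1
      used below.\<close>
    have "((\<lambda>K. D * (1 + 1) * K powr (- ?\<delta>)) \<longlongrightarrow> 0) at_top"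
      using \<alpha> by (intro tendsto_mult_right_zero tendsto_neg_powr filterlim_ident) auto
    from order_tendstoD(2)[OF this, of "e/2"] e
    have "\<forall>\<^sub>F K in at_top. D * (1 + 1) * K powr (- ?\<delta>) < e / 2" by simp
    with eventually_ge_at_top[of 1]
    have "\<forall>\<^sub>F K in at_top. 1 \<le> K \<and> D * (1 + 1) * K powr (- ?\<delta>) < e / 2" by eventually_elim auto
    then obtain K where K: "1 \<le> K" "D * (1 + 1) * K powr (- ?\<delta>) < e / 2" by (auto simp: eventually_at_top_linorder)
    have "((\<lambda>t. \<bar>a\<bar> * (2 * \<bar>t\<bar> + t\<^sup>2) * J K) \<longlongrightarrow> \<bar>a\<bar> * (2 * \<bar>0\<bar> + 0\<^sup>2) * J K) (at 0)"
      by (intro tendsto_intros)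
    then have "\<forall>\<^sub>F t in at 0. \<bar>a\<bar> * (2 * \<bar>t\<bar> + t\<^sup>2) * J K < e / 2"
      using e by (intro order_tendstoD(2)) auto
    moreover have "\<forall>\<^sub>F t in at (0::real). \<bar>t\<bar> < 1"
      unfolding eventually_at by (intro exI[of _ 1]) auto
    ultimately show "\<forall>\<^sub>F t in at 0. dist (stable_exponent \<alpha> a t) 0 < e"
    proof eventually_elim
      case (elim t)
      have "cmod (stable_exponent \<alpha> a t - truncated_stable_exponent \<alpha> a t K) \<le> D * (1 + \<bar>t\<bar>) * K powr (- ?\<delta>)"
        by (rule D(2)[OF K(1)])
      also have "\<dots> \<le> D * (1 + 1) * K powr (- ?\<delta>)"
        using elim D(1) by (intro mult_right_mono mult_left_mono) auto
      finally have "cmod (stable_exponent \<alpha> a t - truncated_stable_exponent \<alpha> a t K) < e / 2" using K by linarith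
      moreover have "cmod (truncated_stable_exponent \<alpha> a t K) < e / 2" using I[of t K] elim by linarith
      ultimately show ?case
        using norm_triangle_sub[of "stable_exponent \<alpha> a t" "truncated_stable_exponent \<alpha> a t K"] by simp
    qed
  qed
qed

end


section \<open>The generalized central limit theorem\<close>

lemma filterlim_powr_at_top:
  assumes "p > 0"
  shows "filterlim (\<lambda>x::real. x powr p) at_top at_top"
proof -
  have "filterlim (\<lambda>x. exp (p * ln x)) at_top at_top"
    using assms by (intro filterlim_compose[OF exp_at_top] filterlim_tendsto_pos_mult_at_top[OF tendsto_const] ln_at_top)
  then show ?thesis
    by (rule filterlim_mono_eventually[OF _ order_refl order_refl])
       (auto simp: powr_def intro!: eventually_mono[OF eventually_gt_at_top[of 0]])
qed

lemma real_distribution_normalized_sum: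
  assumes "real_distribution \<mu>"
  shows "real_distribution (normalized_sum \<alpha> B \<mu> m)"
proof -
  interpret real_distribution \<mu> by fact
  interpret P: prob_space "PiM {1..m} (\<lambda>_. \<mu>)" by (intro prob_space_PiM prob_space_axioms)
  have [measurable_cong]: "sets \<mu> = sets borel" by simp
  have "(\<lambda>z. real m powr (- 1 / \<alpha>) * ((\<Sum>i=1..m. z i) - B m)) \<in> borel_measurable (PiM {1..m} (\<lambda>_. \<mu>))"
    by measurable
  then show ?thesis unfolding normalized_sum_def by (rule P.real_distribution_distr)
qed

lemma char_normalized_sum:
  assumes "real_distribution \<mu>"
  shows "char (normalized_sum \<alpha> B \<mu> m) t
    = iexp (- (t * real m powr (- 1 / \<alpha>) * B m)) * char \<mu> (t * real m powr (- 1 / \<alpha>)) ^ m"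
proof -
  interpret real_distribution \<mu> by fact
  interpret product_sigma_finite "\<lambda>_. \<mu>" by standard
  have [measurable_cong]: "sets \<mu> = sets borel" by simp
  let ?h = "real m powr (- 1 / \<alpha>)"
  have "char (normalized_sum \<alpha> B \<mu> m) t
      = (\<integral>z. iexp (t * (?h * ((\<Sum>i=1..m. z i) - B m))) \<partial>PiM {1..m} (\<lambda>_. \<mu>))"
    unfolding char_def normalized_sum_def by (subst integral_distr) auto
  also have "\<dots> = (\<integral>z. iexp (- (t * ?h * B m)) * (\<Prod>i=1..m. iexp (t * ?h * z i)) \<partial>PiM {1..m} (\<lambda>_. \<mu>))"
    by (intro Bochner_Integration.integral_cong refl)
       (simp add: algebra_simps sum_distrib_left flip: exp_add exp_sum)
  also have "\<dots> = iexp (- (t * ?h * B m)) * (\<Prod>i=1..m. char \<mu> (t * ?h))"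
    unfolding char_def integral_mult_right_zero
    by (subst product_integral_prod) (auto intro!: integrable_const_bound[where B=1])
  finally show ?thesis by simp
qed

text \<open>No complex logarithm is taken. With u = exp(c / m), both w and u lie in the closed unit
  disc, since Re c \<le> 0. So w^m and u^m = exp c differ by at most m |w - u|, which vanishes
  because m (w - 1) and m (u - 1) have the same limit c.\<close>

lemma power_tendsto_exp:
  fixes w :: "nat \<Rightarrow> complex"
  assumes w: "\<And>m. cmod (w m) \<le> 1" and lim: "(\<lambda>m. of_nat m * (w m - 1)) \<longlonglongrightarrow> c"
  shows "(\<lambda>m. w m ^ m) \<longlonglongrightarrow> exp c"
proof -
  have Re_c: "Re c \<le> 0"
  proof (rule tendsto_upperbound[OF tendsto_Re[OF lim]])
    have "Re (of_nat m * (w m - 1)) \<le> 0" for m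
    proof -
      have "Re (w m) \<le> 1" using abs_Re_le_cmod[of "w m"] w[of m] by linarith
      then show ?thesis by (simp add: mult_nonneg_nonpos)
    qed
    then show "\<forall>\<^sub>F m in sequentially. Re (of_nat m * (w m - 1)) \<le> 0" by simp
  qed simp
  define u where "u m = exp (c / of_nat m)" for m :: nat
  have u1: "cmod (u m) \<le> 1" for m
    using Re_c by (simp add: u_def divide_nonpos_nonneg)
  have "(\<lambda>m. of_nat m * (u m - 1)) \<longlonglongrightarrow> c"
  proof (cases "c = 0")
    case False
    have "((\<lambda>z. (exp z - exp 0) / (z - 0)) \<longlongrightarrow> exp 0) (at (0::complex))"
      using DERIV_exp[of 0] unfolding has_field_derivative_iff by simp
    moreover have "filterlim (\<lambda>m. c / of_nat m) (at 0) sequentially"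
      unfolding filterlim_at using False eventually_gt_at_top[of 0]
      by (auto intro!: tendsto_divide_0[OF tendsto_const] tendsto_of_nat elim: eventually_mono)
    ultimately have "(\<lambda>m. (exp (c / of_nat m) - exp 0) / (c / of_nat m - 0)) \<longlonglongrightarrow> exp 0"
      by (rule filterlim_compose)
    from tendsto_mult[OF tendsto_const[of c] this]
    have "(\<lambda>m. c * ((exp (c / of_nat m) - exp 0) / (c / of_nat m - 0))) \<longlonglongrightarrow> c" by simp
    then show ?thesis
      by (rule Lim_transform_eventually)
         (use False in \<open>auto simp: u_def intro!: eventually_mono[OF eventually_gt_at_top[of 0]]\<close>)
  qed (simp add: u_def)
  from tendsto_diff[OF lim this] have "(\<lambda>m. of_nat m * (w m - u m)) \<longlonglongrightarrow> 0" by (simp add: algebra_simps)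
  then have "(\<lambda>m. cmod (of_nat m * (w m - u m))) \<longlonglongrightarrow> 0" by (rule tendsto_norm_zero)
  then have "(\<lambda>m. w m ^ m - u m ^ m) \<longlonglongrightarrow> 0"
    by (rule Lim_null_comparison[rotated])
       (use norm_power_diff[OF w u1] in \<open>auto simp: norm_mult intro!: always_eventually\<close>)
  moreover have "(\<lambda>m. u m ^ m) \<longlonglongrightarrow> exp c"
  proof (rule Lim_transform_eventually[OF tendsto_const])
    show "\<forall>\<^sub>F m in sequentially. exp c = u m ^ m"
      using eventually_gt_at_top[of 0]
      by eventually_elim (simp add: u_def flip: exp_of_nat_mult)
  qed
  ultimately show ?thesis using tendsto_add by fastforce
qed

text \<open>For \<open>\<alpha> = 1\<close> the centering truncates \<open>Z\<close> to \<open>0\<close> above \<open>m\<close>, whereas the compensator truncates it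
  to \<open>m\<close>; after normalization the difference is \<open>m P(Z > m) \<longlonglongrightarrow> a\<close>.\<close>

definition stable_log_char :: "real \<Rightarrow> real \<Rightarrow> real \<Rightarrow> complex" where
  "stable_log_char \<alpha> a t = stable_exponent \<alpha> a t + (if \<alpha> = 1 then \<i> * complex_of_real (t * a) else 0)"

context
  fixes \<mu> :: "real measure" and \<alpha> a :: real
  assumes law: "power_tail_law \<alpha> a \<mu>" and \<alpha>: "0 < \<alpha>" "\<alpha> < 2"
begin

interpretation real_distribution \<mu>
  using law by (simp add: power_tail_law_def)

text \<open>With b the normalized centering of a single summand, replacing 1 + i b by exp(i b) in
  all m factors costs O(m b^2). For \<alpha> > 1 this is O(m^(1 - 2/\<alpha>)); for \<alpha> < 1
  there is no centering.\<close>

lemma centering_growth: "(\<lambda>m. real m * (real m powr (- 1 / \<alpha>) * (centering \<alpha> \<mu> m / real m))\<^sup>2) \<longlonglongrightarrow> 0"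
proof -
  obtain C where C: "C > 0" "\<And>t. t > 0 \<Longrightarrow> prob {t<..} \<le> C * t powr (- \<alpha>)"
    using power_tail_law_bound[OF law \<alpha>] by blast
  note nonneg = power_tail_law_nonneg[OF law \<alpha>]
  \<comment> \<open>At \<alpha> = 1 the truncated mean is at most m^(1/4) times the moment of Z of
    order 3/4, and 1 - 2 + 2/4 < 0 suffices.\<close>
  define q where "q = (if \<alpha> = 1 then 1 / 4 else 0 :: real)"
  obtain B where B: "\<And>m. m > 0 \<Longrightarrow> \<bar>centering \<alpha> \<mu> m / real m\<bar> \<le> B * real m powr q"
  proof -
    consider "\<alpha> > 1" | "\<alpha> = 1" | "\<alpha> < 1" by linarith
    then show ?thesis
    proof cases
      case 1 then show ?thesis by (intro that[of "\<bar>\<integral>z. z \<partial>\<mu>\<bar>"]) (auto simp: centering_def q_def)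
    next
      case 3 then show ?thesis by (intro that[of 0]) (auto simp: centering_def q_def)
    next
      case 2
      have i: "integrable \<mu> (\<lambda>z. z powr (3/4))"
        by (rule integrable_powr_if_tail[where C=C and \<gamma>=\<alpha>])
           (use C 2 nonneg in \<open>auto simp: greaterThan_def\<close>)
      show ?thesis
      proof (rule that[of "\<integral>z. z powr (3/4) \<partial>\<mu>"])
        fix m :: nat assume m: "m > 0"
        have "\<bar>\<integral>z. z * indicator {..real m} z \<partial>\<mu>\<bar> \<le> (\<integral>z. \<bar>z * indicator {..real m} z\<bar> \<partial>\<mu>)"
          by (rule integral_abs_bound)
        also have "\<dots> \<le> (\<integral>z. z powr (3/4) * real m powr (1/4) \<partial>\<mu>)"
        proof (rule integral_mono_AE')
          show "AE z in \<mu>. \<bar>z * indicator {..real m} z\<bar> \<le> z powr (3/4) * real m powr (1/4)"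
            using nonneg
          proof eventually_elim
            case (elim z)
            show ?case
            proof (cases "z \<le> real m \<and> z > 0")
              case True
              then have "z = z powr (3/4) * z powr (1/4)" by (simp flip: powr_add)
              also have "\<dots> \<le> z powr (3/4) * real m powr (1/4)"
                using True by (intro mult_left_mono powr_mono2) auto
              finally show ?thesis using True by simp
            qed (use elim in \<open>auto simp: indicator_def\<close>)
          qed
        qed (use i in auto)
        also have "\<dots> = (\<integral>z. z powr (3/4) \<partial>\<mu>) * real m powr (1/4)" by simp
        finally show "\<bar>centering \<alpha> \<mu> m / real m\<bar> \<le> (\<integral>z. z powr (3/4) \<partial>\<mu>) * real m powr q"
          using 2 m by (simp add: centering_def q_def)
      qed
    qed
  qed
  have q: "1 - 2 / \<alpha> + 2 * q < 0" using \<alpha> by (auto simp: q_def field_simps)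
  have "(\<lambda>m. B\<^sup>2 * real m powr (1 - 2 / \<alpha> + 2 * q)) \<longlonglongrightarrow> 0"
    using q by (intro tendsto_mult_right_zero tendsto_neg_powr filterlim_real_sequentially)
  then show ?thesis
  proof (rule Lim_null_comparison[rotated])
    show "\<forall>\<^sub>F m in sequentially. norm (real m * (real m powr (- 1 / \<alpha>) * (centering \<alpha> \<mu> m / real m))\<^sup>2)
        \<le> B\<^sup>2 * real m powr (1 - 2 / \<alpha> + 2 * q)"
      using eventually_gt_at_top[of 0]
    proof eventually_elim
      case (elim m)
      have "(centering \<alpha> \<mu> m / real m)\<^sup>2 \<le> (B * real m powr q)\<^sup>2"
        using B[OF elim] by (rule power2_le_iff_abs_le[THEN iffD2, rotated]) (use order_trans[OF abs_ge_zero B[OF elim]] in auto)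
      then have "real m * (real m powr (- 1 / \<alpha>))\<^sup>2 * (centering \<alpha> \<mu> m / real m)\<^sup>2
          \<le> real m * (real m powr (- 1 / \<alpha>))\<^sup>2 * (B * real m powr q)\<^sup>2"
        by (intro mult_left_mono) auto
      also have "\<dots> = B\<^sup>2 * real m powr (1 - 2 / \<alpha> + 2 * q)"
      proof -
        have "real m * (real m powr (- 1 / \<alpha>))\<^sup>2 * (B * real m powr q)\<^sup>2
            = B\<^sup>2 * (real m powr 1 * real m powr (- 1 / \<alpha>) * real m powr (- 1 / \<alpha>) * real m powr q * real m powr q)"
          by (simp add: power2_eq_square)
        also have "\<dots> = B\<^sup>2 * real m powr (1 + - 1 / \<alpha> + - 1 / \<alpha> + q + q)"
          by (simp only: powr_add)
        also have "1 + - 1 / \<alpha> + - 1 / \<alpha> + q + q = 1 - 2 / \<alpha> + 2 * q" by simp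
        finally show ?thesis .
      qed
      finally show ?case by (simp add: power_mult_distrib mult.assoc del: times_divide_eq_right)
    qed
  qed
qed

text \<open>The factor \<open>w m\<close> is the characteristic function of one normalized and
  centered summand. It equals exp(-i b) (1 + i b + g), where m g converges by
  \<open>stable_exponent_tendsto\<close> and m b^2 vanishes; this gives the limit of m (w - 1) that
  \<open>power_tendsto_exp\<close> requires.\<close>

theorem char_normalized_sum_tendsto:
  "(\<lambda>m. char (normalized_sum \<alpha> (centering \<alpha> \<mu>) \<mu> m) t) \<longlonglongrightarrow> exp (stable_log_char \<alpha> a t)"
proof -
  note nonneg = power_tail_law_nonneg[OF law \<alpha>]
  define h where "h m = real m powr (- 1 / \<alpha>)" for m :: nat
  define b where "b m = t * h m * (centering \<alpha> \<mu> m / real m)" for m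
  define g where "g m = char \<mu> (t * h m) - 1 - \<i> * complex_of_real (b m)" for m
  define w where "w m = iexp (- b m) * char \<mu> (t * h m)" for m
  have mb: "(\<lambda>m. real m * (b m)\<^sup>2) \<longlonglongrightarrow> 0"
  proof -
    have eq: "real m * (b m)\<^sup>2 = t\<^sup>2 * (real m * (real m powr (- 1 / \<alpha>) * (centering \<alpha> \<mu> m / real m))\<^sup>2)" for m
      by (simp add: b_def h_def power2_eq_square)
    show ?thesis unfolding eq by (intro tendsto_mult_right_zero centering_growth)
  qed
  have b0: "b \<longlonglongrightarrow> 0"
  proof -
    have "(\<lambda>m. (b m)\<^sup>2) \<longlonglongrightarrow> 0"
    proof (rule Lim_null_comparison[OF _ mb])
      show "\<forall>\<^sub>F m in sequentially. norm ((b m)\<^sup>2) \<le> real m * (b m)\<^sup>2"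
        using eventually_ge_at_top[of 1] by eventually_elim (simp add: mult_le_cancel_right1)
    qed
    then show ?thesis by simp
  qed
  have mg: "(\<lambda>m. of_nat m * g m) \<longlonglongrightarrow> stable_log_char \<alpha> a t"
  proof -
    define T where "T m = real m powr (1 / \<alpha>)" for m :: nat
    have T: "filterlim T at_top sequentially"
      unfolding T_def using \<alpha> by (intro filterlim_compose[OF filterlim_powr_at_top filterlim_real_sequentially]) auto
    have 1: "(\<lambda>m. T m powr \<alpha> *\<^sub>R (\<integral>z. compensated_iexp \<alpha> t (z / T m) \<partial>\<mu>)) \<longlonglongrightarrow> stable_exponent \<alpha> a t"
      by (rule filterlim_compose[OF stable_exponent_tendsto[OF law \<alpha>] T])
    have 2: "(\<lambda>m. \<i> * complex_of_real (t * (real m * prob {real m<..}))) \<longlonglongrightarrow> \<i> * complex_of_real (t * a)" if "\<alpha> = 1"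
    proof -
      have "((\<lambda>t. prob {t<..} * t powr 1) \<longlongrightarrow> a) at_top"
        using law that by (simp add: power_tail_law_def)
      from filterlim_compose[OF this filterlim_real_sequentially]
      have "(\<lambda>m. real m * prob {real m<..}) \<longlonglongrightarrow> a" by (simp add: mult.commute)
      then show ?thesis by (intro tendsto_intros)
    qed
    have "(\<lambda>m. T m powr \<alpha> *\<^sub>R (\<integral>z. compensated_iexp \<alpha> t (z / T m) \<partial>\<mu>)
        + (if \<alpha> = 1 then \<i> * complex_of_real (t * (real m * prob {real m<..})) else 0)) \<longlonglongrightarrow> stable_log_char \<alpha> a t"
      unfolding stable_log_char_def using 2 by (intro tendsto_add 1) auto
    then show ?thesis
    proof (rule Lim_transform_eventually)
      show "\<forall>\<^sub>F m in sequentially. T m powr \<alpha> *\<^sub>R (\<integral>z. compensated_iexp \<alpha> t (z / T m) \<partial>\<mu>)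
        + (if \<alpha> = 1 then \<i> * complex_of_real (t * (real m * prob {real m<..})) else 0) = of_nat m * g m"
        using eventually_gt_at_top[of 0]
      proof eventually_elim
        case (elim m)
        have Tm: "T m > 0" "T m powr \<alpha> = real m" using elim \<alpha> by (auto simp: T_def powr_powr)
        have hT: "z / T m = h m * z" for z
          using elim by (simp add: T_def h_def powr_minus field_simps)
        have ic: "integrable \<mu> (\<lambda>z. compensator \<alpha> (z / T m))"
          by (rule integrable_compensator_power_tail[OF law \<alpha> Tm(1)])
        have ii: "integrable \<mu> (\<lambda>z. iexp (t * (z / T m)))"
          by (rule integrable_const_bound[where B=1]) auto
        have "(\<integral>z. compensated_iexp \<alpha> t (z / T m) \<partial>\<mu>)
            = (\<integral>z. iexp (t * (z / T m)) \<partial>\<mu>) - 1 - \<i> * complex_of_real (t * (\<integral>z. compensator \<alpha> (z / T m) \<partial>\<mu>))"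
          unfolding compensated_iexp_def using ic ii
          by (subst Bochner_Integration.integral_diff, (auto intro!: Bochner_Integration.integrable_diff)[2])+
             (simp add: prob_space[unfolded space_eq_univ])
        also have "(\<integral>z. iexp (t * (z / T m)) \<partial>\<mu>) = char \<mu> (t * h m)"
          unfolding char_def hT by (simp add: mult_ac)
        also have "t * (\<integral>z. compensator \<alpha> (z / T m) \<partial>\<mu>) = b m + (if \<alpha> = 1 then t * prob {real m<..} else 0)"
        proof -
          consider "\<alpha> > 1" | "\<alpha> = 1" | "\<alpha> < 1" by linarith
          then show ?thesis
          proof cases
            case 1 then show ?thesis using elim by (simp add: hT compensator_def b_def centering_def)
          next
            case 3 then show ?thesis by (simp add: compensator_def b_def centering_def)
          next
            case 2
            have Tm': "T m = real m" using 2 by (simp add: T_def)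
            have b: "integrable \<mu> (\<lambda>z. z * indicator {..real m} z)"
              by (rule integrable_const_bound[where B="real m"])
                 (use nonneg in \<open>auto simp: indicator_def elim!: AE_mp\<close>)
            have "(\<integral>z. compensator \<alpha> (z / T m) \<partial>\<mu>)
                = (\<integral>z. h m * (z * indicator {..real m} z) + indicator {real m<..} z \<partial>\<mu>)"
              by (intro Bochner_Integration.integral_cong refl)
                 (use 2 elim in \<open>auto simp: compensator_def hT h_def indicator_def powr_minus min_def field_simps\<close>)
            also have "\<dots> = h m * (\<integral>z. z * indicator {..real m} z \<partial>\<mu>) + prob {real m<..}"
              using b by (subst Bochner_Integration.integral_add) (auto simp: emeasure_eq_measure)
            finally show ?thesis using 2 elim by (simp add: b_def centering_def algebra_simps)
          qed
        qed
        finally have e: "(\<integral>z. compensated_iexp \<alpha> t (z / T m) \<partial>\<mu>) = char \<mu> (t * h m) - 1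
            - \<i> * complex_of_real (b m + (if \<alpha> = 1 then t * prob {real m<..} else 0))" .
        show ?case
          unfolding e g_def Tm(2) scaleR_conv_of_real by (cases "\<alpha> = 1") (simp_all add: algebra_simps)
      qed
    qed
  qed
  have "(\<lambda>m. of_nat m * (w m - 1)) \<longlonglongrightarrow> stable_log_char \<alpha> a t"
  proof -
    have eq: "of_nat m * (w m - 1)
        = of_nat m * (iexp (- b m) * (1 + \<i> * complex_of_real (b m) - iexp (b m))) + iexp (- b m) * (of_nat m * g m)" for m
    proof -
      have "iexp (- b m) * iexp (b m) = 1" by (simp flip: exp_add)
      moreover have "w m = iexp (- b m) * (1 + \<i> * complex_of_real (b m) + g m)" by (simp add: w_def g_def)
      ultimately show ?thesis by (simp add: algebra_simps)
    qed
    have "(\<lambda>m. of_nat m * (iexp (- b m) * (1 + \<i> * complex_of_real (b m) - iexp (b m)))) \<longlonglongrightarrow> 0"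
    proof (rule Lim_null_comparison[OF _ mb])
      have "cmod (1 + \<i> * complex_of_real x - iexp x) \<le> x\<^sup>2" for x
        using iexp_approx1[of x 1] by (simp add: norm_minus_commute numeral_2_eq_2) (smt (verit) zero_le_power2 power2_eq_square)
      then show "\<forall>\<^sub>F m in sequentially.
          norm (of_nat m * (iexp (- b m) * (1 + \<i> * complex_of_real (b m) - iexp (b m)))) \<le> real m * (b m)\<^sup>2"
        by (intro always_eventually allI) (simp add: norm_mult mult_left_mono)
    qed
    moreover have "(\<lambda>m. iexp (- b m)) \<longlonglongrightarrow> iexp (- 0)"
      using b0 by (intro tendsto_intros)
    ultimately show ?thesis
      unfolding eq using tendsto_add[OF _ tendsto_mult[OF _ mg]] by fastforce
  qed
  moreover have "cmod (w m) \<le> 1" for m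
    using cmod_char_le_1 by (simp add: w_def norm_mult)
  ultimately have "(\<lambda>m. w m ^ m) \<longlonglongrightarrow> exp (stable_log_char \<alpha> a t)" by (intro power_tendsto_exp)
  then show ?thesis
  proof (rule Lim_transform_eventually)
    show "\<forall>\<^sub>F m in sequentially. w m ^ m = char (normalized_sum \<alpha> (centering \<alpha> \<mu>) \<mu> m) t"
      using eventually_gt_at_top[of 0]
    proof eventually_elim
      case (elim m)
      have "iexp (- b m) ^ m = iexp (- (t * h m * centering \<alpha> \<mu> m))"
        using elim by (simp add: b_def flip: exp_of_nat_mult)
      then show ?case
        by (simp add: char_normalized_sum[OF real_distribution_axioms] w_def power_mult_distrib h_def)
    qed
  qed
qed


lemma isCont_stable_log_char_0: "isCont (stable_log_char \<alpha> a) 0"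
  unfolding stable_log_char_def[abs_def]
  using isCont_stable_exponent_0[OF law \<alpha>]
  by (cases "\<alpha> = 1") (auto intro!: continuous_intros)

text \<open>The exponents at \<open>s y\<close> and at \<open>y\<close> are limits of the same expectation with normalizations \<open>T\<close> and
  \<open>T / s\<close>, up to a shift that is linear in \<open>y\<close>.\<close>

lemma stable_log_char_scale:
  assumes s: "s > 0"
  shows "\<exists>d. \<forall>y. stable_log_char \<alpha> a (s * y) = s powr \<alpha> * stable_log_char \<alpha> a y + \<i> * complex_of_real (y * d)"
proof -
  \<comment> \<open>The compensator is homogeneous unless \<alpha> = 1; \<Delta> measures the defect
    and does not depend on y.\<close>
  define \<Delta> where "\<Delta> T = T powr \<alpha> * (\<integral>z. compensator \<alpha> (s * z / T) - s * compensator \<alpha> (z / T) \<partial>\<mu>)" for T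
  have lim: "((\<lambda>T. \<i> * complex_of_real (y * \<Delta> T)) \<longlongrightarrow> stable_exponent \<alpha> a (s * y) - s powr \<alpha> * stable_exponent \<alpha> a y) at_top" for y
  proof -
    have "filterlim (\<lambda>T. inverse s * T) at_top at_top"
      using s by (intro filterlim_tendsto_pos_mult_at_top[OF tendsto_const]) (auto simp: filterlim_ident)
    from filterlim_compose[OF stable_exponent_tendsto[OF law \<alpha>] this]
    have "((\<lambda>T. s powr \<alpha> * ((inverse s * T) powr \<alpha> *\<^sub>R (\<integral>z. compensated_iexp \<alpha> y (z / (inverse s * T)) \<partial>\<mu>)))
        \<longlongrightarrow> s powr \<alpha> * stable_exponent \<alpha> a y) at_top" by (intro tendsto_mult_left)
    from tendsto_diff[OF stable_exponent_tendsto[OF law \<alpha>, of "s * y"] this]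
    show ?thesis
    proof (rule Lim_transform_eventually)
      show "\<forall>\<^sub>F T in at_top. T powr \<alpha> *\<^sub>R (\<integral>z. compensated_iexp \<alpha> (s * y) (z / T) \<partial>\<mu>)
          - s powr \<alpha> * ((inverse s * T) powr \<alpha> *\<^sub>R (\<integral>z. compensated_iexp \<alpha> y (z / (inverse s * T)) \<partial>\<mu>))
          = \<i> * complex_of_real (y * \<Delta> T)"
        using eventually_gt_at_top[of 0]
      proof eventually_elim
        case (elim T)
        note i = integrable_compensated_iexp[OF law \<alpha>]
        have sT: "z / (inverse s * T) = s * z / T" "s powr \<alpha> * (inverse s * T) powr \<alpha> = T powr \<alpha>" for z
          using s elim by (auto simp: field_simps powr_mult powr_divide)
        have "(\<integral>z. compensated_iexp \<alpha> (s * y) (z / T) \<partial>\<mu>) - (\<integral>z. compensated_iexp \<alpha> y (z / (inverse s * T)) \<partial>\<mu>)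
            = (\<integral>z. compensated_iexp \<alpha> (s * y) (z / T) - compensated_iexp \<alpha> y (z / (inverse s * T)) \<partial>\<mu>)"
          using s elim by (intro Bochner_Integration.integral_diff[symmetric] i) auto
        also have "\<dots> = (\<integral>z. \<i> * complex_of_real (y * (compensator \<alpha> (s * z / T) - s * compensator \<alpha> (z / T))) \<partial>\<mu>)"
          unfolding sT by (intro Bochner_Integration.integral_cong refl) (simp add: compensated_iexp_def algebra_simps)
        also have "\<dots> = \<i> * complex_of_real (y * (\<integral>z. compensator \<alpha> (s * z / T) - s * compensator \<alpha> (z / T) \<partial>\<mu>))"
          unfolding integral_mult_right_zero integral_complex_of_real ..
        finally have e: "(\<integral>z. compensated_iexp \<alpha> (s * y) (z / T) \<partial>\<mu>) - (\<integral>z. compensated_iexp \<alpha> y (z / (inverse s * T)) \<partial>\<mu>)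
            = \<i> * complex_of_real (y * (\<integral>z. compensator \<alpha> (s * z / T) - s * compensator \<alpha> (z / T) \<partial>\<mu>))" .
        have "s powr \<alpha> * ((inverse s * T) powr \<alpha> *\<^sub>R (\<integral>z. compensated_iexp \<alpha> y (z / (inverse s * T)) \<partial>\<mu>))
            = T powr \<alpha> *\<^sub>R (\<integral>z. compensated_iexp \<alpha> y (z / (inverse s * T)) \<partial>\<mu>)"
          by (simp add: scaleR_conv_of_real flip: sT(2))
        then show ?case
          unfolding \<Delta>_def by (simp only: scaleR_diff_right[symmetric] e) (simp add: scaleR_conv_of_real mult_ac)
      qed
    qed
  qed
  \<comment> \<open>The case y = 1 shows that \<Delta> converges; its limit then yields the shift
    for every y.\<close>
  define d where "d = Im (stable_exponent \<alpha> a (s * 1) - s powr \<alpha> * stable_exponent \<alpha> a 1)"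
  from tendsto_Im[OF lim[of 1]] have "(\<Delta> \<longlongrightarrow> d) at_top" by (simp add: d_def)
  then have lim': "((\<lambda>T. \<i> * complex_of_real (y * \<Delta> T)) \<longlongrightarrow> \<i> * complex_of_real (y * d)) at_top" for y
    by (intro tendsto_intros)
  have "\<i> * complex_of_real (y * d) = stable_exponent \<alpha> a (s * y) - s powr \<alpha> * stable_exponent \<alpha> a y" for y
    by (rule tendsto_unique[OF _ lim' lim]) simp
  then have e: "stable_exponent \<alpha> a (s * y) = s powr \<alpha> * stable_exponent \<alpha> a y + \<i> * complex_of_real (y * d)" for y
    by simp
  show ?thesis
  proof (cases "\<alpha> = 1")
    case True
    then show ?thesis unfolding stable_log_char_def e using s by (intro exI[of _ d]) (simp add: algebra_simps)
  next
    case False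
    then show ?thesis by (intro exI[of _ d]) (simp add: stable_log_char_def e)
  qed
qed

text \<open>The integrand cos(Z/T) - 1 is nonpositive, and on T < Z \<le> 2 T, an event of
  probability about (a - a 2^(-\<alpha>)) T^(-\<alpha>), it is at most cos 1 - 1. The strict sign
  excludes that the limit law is a point mass, whose characteristic function has modulus 1.\<close>

lemma Re_stable_log_char_neg:
  assumes a: "a > 0"
  shows "Re (stable_log_char \<alpha> a 1) < 0"
proof -
  note nonneg = power_tail_law_nonneg[OF law \<alpha>]
  define c where "c = 1 - cos (1::real)"
  have c: "c > 0" using cos_monotone_0_pi[of 0 1] pi_gt3 by (simp add: c_def)
  have "Re (stable_exponent \<alpha> a 1) \<le> - (c * (a - a * 2 powr (- \<alpha>)))"
  proof (rule tendsto_le)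
    show "((\<lambda>T. Re (T powr \<alpha> *\<^sub>R (\<integral>z. compensated_iexp \<alpha> 1 (z / T) \<partial>\<mu>))) \<longlongrightarrow> Re (stable_exponent \<alpha> a 1)) at_top"
      by (intro tendsto_Re stable_exponent_tendsto[OF law \<alpha>])
    have "((\<lambda>T. T powr \<alpha> * prob {1 * T<..} - T powr \<alpha> * prob {2 * T<..}) \<longlongrightarrow> a * 1 powr (- \<alpha>) - a * 2 powr (- \<alpha>)) at_top"
      by (intro tendsto_diff power_tail_law_scaled[OF law \<alpha>]) auto
    then show "((\<lambda>T. - (c * (T powr \<alpha> * prob {1 * T<..} - T powr \<alpha> * prob {2 * T<..}))) \<longlongrightarrow> - (c * (a - a * 2 powr (- \<alpha>)))) at_top"
      by (intro tendsto_minus tendsto_mult_left) simp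
    show "\<forall>\<^sub>F T in at_top. Re (T powr \<alpha> *\<^sub>R (\<integral>z. compensated_iexp \<alpha> 1 (z / T) \<partial>\<mu>))
        \<le> - (c * (T powr \<alpha> * prob {1 * T<..} - T powr \<alpha> * prob {2 * T<..}))"
      using eventually_gt_at_top[of 0]
    proof eventually_elim
      case (elim T)
      note i = integrable_compensated_iexp[OF law \<alpha> elim, of 1]
      have "Re (\<integral>z. compensated_iexp \<alpha> 1 (z / T) \<partial>\<mu>) = (\<integral>z. Re (compensated_iexp \<alpha> 1 (z / T)) \<partial>\<mu>)"
        by (rule integral_Re[OF i, symmetric])
      also have "\<dots> \<le> (\<integral>z. - c * indicator {T<..2*T} z \<partial>\<mu>)"
      proof (rule integral_mono[OF integrable_Re[OF i]])
        fix z
        have "Re (compensated_iexp \<alpha> 1 (z / T)) = cos (z / T) - 1"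
          by (simp add: compensated_iexp_def Re_exp)
        also have "\<dots> \<le> - c * indicator {T<..2*T} z"
        proof (cases "z \<in> {T<..2*T}")
          case True
          then have "1 \<le> z / T" "z / T \<le> 2" using elim by (auto simp: field_simps)
          then have "cos (z / T) \<le> cos 1"
            using pi_gt3 by (intro cos_monotone_0_pi_le) auto
          then show ?thesis using True by (simp add: c_def)
        qed simp
        finally show "Re (compensated_iexp \<alpha> 1 (z / T)) \<le> - c * indicator {T<..2*T} z" .
      qed (intro integrable_mult_right integrable_real_indicator, auto simp: emeasure_eq_measure)
      also have "\<dots> = - c * prob {T<..2*T}" by simp
      also have "prob {T<..2*T} = prob {T<..} - prob {2*T<..}"
      proof -
        have "{T<..2*T} = {T<..} - {2*T<..}" by auto
        then show ?thesis using elim by (simp add: finite_measure_Diff subset_eq)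
      qed
      finally have "Re (\<integral>z. compensated_iexp \<alpha> 1 (z / T) \<partial>\<mu>) \<le> - c * (prob {T<..} - prob {2*T<..})" .
      then have "T powr \<alpha> * Re (\<integral>z. compensated_iexp \<alpha> 1 (z / T) \<partial>\<mu>) \<le> T powr \<alpha> * (- c * (prob {T<..} - prob {2*T<..}))"
        by (rule mult_left_mono) simp
      then show ?case by (simp add: algebra_simps)
    qed
  qed simp
  moreover have "2 powr (- \<alpha>) < (1::real)" using powr_less_mono[of "- \<alpha>" 0 2] \<alpha> by simp
  then have "c * (a - a * 2 powr (- \<alpha>)) > 0" using a c by (simp add: algebra_simps)
  ultimately show ?thesis by (cases "\<alpha> = 1") (auto simp: stable_log_char_def)
qed

text \<open>By \<open>stable_log_char_scale\<close> the exponent is homogeneous of degree \<alpha>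
  up to linear terms. Hence u has to solve u^\<alpha> = s^\<alpha> + t^\<alpha>, and the linear
  terms belonging to s, t and u combine to the shift d.\<close>

lemma stable_distribution_if_char:
  assumes a: "a > 0" and G: "real_distribution G" and char: "char G = (\<lambda>t. exp (stable_log_char \<alpha> a t))"
  shows "stable_distribution G"
  unfolding stable_distribution_def
proof (intro conjI allI impI notI)
  interpret G: real_distribution G by (rule G)
  interpret GG: pair_prob_space G G ..
  have [measurable_cong]: "sets G = sets borel" by simp
  show "real_distribution G" by (rule G)
  show False if "\<exists>c. AE x in G. x = c"
  proof -
    from that obtain c where c: "AE x in G. x = c" by blast
    have "char G 1 = (\<integral>x. iexp c \<partial>G)"
      unfolding char_def by (intro integral_cong_AE) (use c in \<open>auto elim: AE_mp\<close>)
    then have "cmod (char G 1) = 1" by (simp add: G.prob_space[unfolded G.space_eq_univ])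
    then show False using Re_stable_log_char_neg[OF a] by (simp add: char)
  qed
  fix s t :: real assume s: "s > 0" and t: "t > 0"
  define u where "u = (s powr \<alpha> + t powr \<alpha>) powr (1 / \<alpha>)"
  have st: "s powr \<alpha> + t powr \<alpha> > 0" using s t by (simp add: add_pos_pos)
  have u: "u > 0" "u powr \<alpha> = s powr \<alpha> + t powr \<alpha>"
    using st \<alpha> by (auto simp: u_def powr_powr)
  obtain ds where ds: "\<And>y. stable_log_char \<alpha> a (s * y) = s powr \<alpha> * stable_log_char \<alpha> a y + \<i> * complex_of_real (y * ds)"
    using stable_log_char_scale[OF s] by blast
  obtain dt where dt: "\<And>y. stable_log_char \<alpha> a (t * y) = t powr \<alpha> * stable_log_char \<alpha> a y + \<i> * complex_of_real (y * dt)"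
    using stable_log_char_scale[OF t] by blast
  obtain du where du: "\<And>y. stable_log_char \<alpha> a (u * y) = u powr \<alpha> * stable_log_char \<alpha> a y + \<i> * complex_of_real (y * du)"
    using stable_log_char_scale[OF u(1)] by blast
  let ?d = "ds + dt - du"
  show "\<exists>u>0. \<exists>d. distr (G \<Otimes>\<^sub>M G) borel (\<lambda>(x, y). s * x + t * y) = distr G borel (\<lambda>x. u * x + d)"
  proof (intro exI conjI Levy_uniqueness)
    show "u > 0" by (rule u)
    show "real_distribution (distr (G \<Otimes>\<^sub>M G) borel (\<lambda>(x, y). s * x + t * y))"
      by (rule GG.P.real_distribution_distr) measurable
    show "real_distribution (distr G borel (\<lambda>x. u * x + ?d))"
      by (rule G.real_distribution_distr) measurable
    show "char (distr (G \<Otimes>\<^sub>M G) borel (\<lambda>(x, y). s * x + t * y)) = char (distr G borel (\<lambda>x. u * x + ?d))"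
    proof
      fix y
      have "char (distr (G \<Otimes>\<^sub>M G) borel (\<lambda>(x, y). s * x + t * y)) y
          = (\<integral>p. iexp (y * (s * fst p + t * snd p)) \<partial>(G \<Otimes>\<^sub>M G))"
        unfolding char_def by (subst integral_distr) (auto simp: case_prod_beta)
      also have "\<dots> = (\<integral>x. (\<integral>z. iexp (y * (s * x + t * z)) \<partial>G) \<partial>G)"
        by (subst GG.integral_fst'[symmetric]) (auto intro!: GG.P.integrable_const_bound[where B=1])
      also have "\<dots> = (\<integral>x. iexp (s * y * x) * (\<integral>z. iexp (t * y * z) \<partial>G) \<partial>G)"
        unfolding integral_mult_right_zero[symmetric]
        by (intro Bochner_Integration.integral_cong refl) (simp add: algebra_simps flip: exp_add)
      also have "\<dots> = char G (s * y) * char G (t * y)"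
        unfolding char_def by (rule integral_mult_left_zero)
      also have "\<dots> = exp (u powr \<alpha> * stable_log_char \<alpha> a y + \<i> * complex_of_real (y * ds + y * dt))"
        unfolding char ds dt u(2) by (simp add: algebra_simps flip: exp_add)
      also have "\<dots> = iexp (y * ?d) * char G (u * y)"
        unfolding char du by (simp add: algebra_simps flip: exp_add)
      also have "\<dots> = (\<integral>x. iexp (y * (u * x + ?d)) \<partial>G)"
        unfolding char_def integral_mult_right_zero[symmetric]
        by (intro Bochner_Integration.integral_cong refl) (simp add: algebra_simps flip: exp_add)
      also have "\<dots> = char (distr G borel (\<lambda>x. u * x + ?d)) y"
        unfolding char_def by (subst integral_distr) auto
      finally show "char (distr (G \<Otimes>\<^sub>M G) borel (\<lambda>(x, y). s * x + t * y)) y = char (distr G borel (\<lambda>x. u * x + ?d)) y" .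
    qed
  qed
qed

end

text \<open>The description in \<open>stable_limit\<close> has a unique solution because
  \<open>law\<close> provides at least one law to which the required convergence applies: along it,
  any two solutions have the same characteristic function.\<close>

theorem generalized_central_limit:
  assumes law: "power_tail_law \<alpha> a \<mu>" and \<alpha>: "0 < \<alpha>" "\<alpha> < 2" and a: "a > 0"
  shows "real_distribution (stable_limit \<alpha> a)"
    and "weak_conv_m (normalized_sum \<alpha> (centering \<alpha> \<mu>) \<mu>) (stable_limit \<alpha> a)"
proof -
  let ?P = "\<lambda>G. stable_distribution G \<and>
     (\<forall>\<mu>. power_tail_law \<alpha> a \<mu> \<longrightarrow> weak_conv_m (normalized_sum \<alpha> (centering \<alpha> \<mu>) \<mu>) G)"
  have rd: "real_distribution (normalized_sum \<alpha> (centering \<alpha> \<rho>) \<rho> m)" if "power_tail_law \<alpha> a \<rho>" for \<rho> m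
    using that by (intro real_distribution_normalized_sum) (simp add: power_tail_law_def)
  obtain G where G: "real_distribution G" "char G = (\<lambda>t. exp (stable_log_char \<alpha> a t))"
    using levy_continuity_existence[OF rd[OF law] char_normalized_sum_tendsto[OF law \<alpha>]]
      isCont_stable_log_char_0[OF law \<alpha>] by (auto intro: continuous_intros)
  have "?P G"
  proof (intro conjI allI impI)
    show "stable_distribution G" by (rule stable_distribution_if_char[OF law \<alpha> a G])
    show "weak_conv_m (normalized_sum \<alpha> (centering \<alpha> \<rho>) \<rho>) G" if "power_tail_law \<alpha> a \<rho>" for \<rho>
      using char_normalized_sum_tendsto[OF that \<alpha>] by (intro levy_continuity rd that G(1)) (simp add: G(2))
  qed
  moreover have "G' = G" if "?P G'" for G'
  proof (rule Levy_uniqueness)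
    show G': "real_distribution G'" using that by (simp add: stable_distribution_def)
    show "char G' = char G"
    proof
      fix t
      have "(\<lambda>m. char (normalized_sum \<alpha> (centering \<alpha> \<mu>) \<mu> m) t) \<longlonglongrightarrow> char G' t"
        using that law by (intro levy_continuity1 rd G') auto
      then show "char G' t = char G t"
        using LIMSEQ_unique char_normalized_sum_tendsto[OF law \<alpha>] unfolding G(2) by blast
    qed
  qed (rule G)
  ultimately have "stable_limit \<alpha> a = G" unfolding stable_limit_def by (intro the_equality)
  with \<open>?P G\<close> show "real_distribution (stable_limit \<alpha> a)"
    "weak_conv_m (normalized_sum \<alpha> (centering \<alpha> \<mu>) \<mu>) (stable_limit \<alpha> a)"
    using G law by auto
qed


section \<open>Edge colorings of 2-connected graphs\<close>

text \<open>A maximal subfamily satisfying the inequality covers the whole union, because otherwise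
  connectedness provides a further set that meets its union.\<close>

lemma connected_hypergraph_card_le:
  fixes V :: "'c \<Rightarrow> 'a set"
  assumes J: "finite J" "J \<noteq> {}" and V: "\<And>j. j \<in> J \<Longrightarrow> finite (V j)" "\<And>j. j \<in> J \<Longrightarrow> V j \<noteq> {}"
    and conn: "\<And>x y. x \<in> (\<Union>j\<in>J. V j) \<Longrightarrow> y \<in> (\<Union>j\<in>J. V j) \<Longrightarrow>
        (x, y) \<in> {(x, y). \<exists>j\<in>J. x \<in> V j \<and> y \<in> V j}\<^sup>*"
  shows "card (\<Union>j\<in>J. V j) + card J \<le> (\<Sum>j\<in>J. card (V j)) + 1"
proof -
  let ?U = "\<lambda>S. \<Union>j\<in>S. V j"
  let ?P = "\<lambda>S. S \<subseteq> J \<and> S \<noteq> {} \<and> card (?U S) + card S \<le> (\<Sum>j\<in>S. card (V j)) + 1"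
  obtain j0 where "j0 \<in> J" using J by blast
  then have "?P {j0}" by auto
  moreover have "finite {S. ?P S}" by (rule finite_subset[of _ "Pow J"]) (use J in auto)
  ultimately obtain S where S: "?P S" and max: "\<And>S'. ?P S' \<Longrightarrow> card S' \<le> card S"
    using arg_max_nat_lemma[of ?P "{j0}" card "Suc (card J)"] J by (metis (no_types, lifting) card_mono le_imp_less_Suc)
  have finS: "finite S" using S J by (auto intro: finite_subset)
  have U: "?U S = ?U J"
  proof (rule ccontr)
    assume "?U S \<noteq> ?U J"
    then obtain y where y: "y \<in> ?U J" "y \<notin> ?U S" using S by blast
    obtain x where x: "x \<in> ?U S" using S V by blast
    then have "(x, y) \<in> {(x, y). \<exists>j\<in>J. x \<in> V j \<and> y \<in> V j}\<^sup>*" using S y by (intro conn) auto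
    \<comment> \<open>The chain from x to y leaves the union of S in some step, and the set of J
      that contains both ends of this step is not in S.\<close>
    then have "\<exists>j\<in>J. V j \<inter> ?U S \<noteq> {} \<and> j \<notin> S"
      using x y(2)
    proof (induction rule: converse_rtrancl_induct)
      case (step a b)
      then show ?case by (cases "b \<in> ?U S") blast+
    qed simp
    then obtain j where j: "j \<in> J" "V j \<inter> ?U S \<noteq> {}" "j \<notin> S" by blast
    have fU: "finite (?U S)" using finS S V by auto
    have "card (?U S) + card (V j) = card (?U S \<union> V j) + card (?U S \<inter> V j)"
      by (rule card_Un_Int) (use fU V j in auto)
    moreover have "card (?U S \<inter> V j) \<ge> 1"
      using j fU by (simp add: Suc_le_eq card_gt_0_iff Int_commute)
    ultimately have "card (?U (insert j S)) + 1 \<le> card (?U S) + card (V j)"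
      by (simp add: Un_commute)
    then have "?P (insert j S)" using S j finS by auto
    from max[OF this] show False using j finS by simp
  qed
  \<comment> \<open>The sets outside S are nonempty, so each adds at least 1 to the sum and thereby
    pays for its own contribution to \<open>card J\<close>.\<close>
  have "(\<Sum>j\<in>S. card (V j)) + card (J - S) \<le> (\<Sum>j\<in>J. card (V j))"
  proof -
    have "card (J - S) \<le> (\<Sum>j\<in>J - S. card (V j))"
      using sum_mono[of "J - S" "\<lambda>_. 1" "\<lambda>j. card (V j)"] V by (simp add: Suc_le_eq card_gt_0_iff)
    moreover have "(\<Sum>j\<in>J. card (V j)) = (\<Sum>j\<in>J - S. card (V j)) + (\<Sum>j\<in>S. card (V j))"
      using S J by (intro sum.subset_diff) auto
    ultimately show ?thesis by simp
  qed
  moreover have "card (J - S) + card S = card J"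
    using S J finS by (simp add: card_Diff_subset card_mono)
  moreover have "card (?U S) + card S \<le> (\<Sum>j\<in>S. card (V j)) + 1" using S by blast
  ultimately have "card (?U S) + card J \<le> (\<Sum>j\<in>J. card (V j)) + 1" by linarith
  then show ?thesis unfolding U .
qed

lemma two_connected_Union_edges:
  assumes F: "simple_graph F" "two_connected F" "num_verts F \<ge> 3"
  shows "\<Union>(edges F) = verts F"
proof (intro equalityI subsetI)
  fix x assume x: "x \<in> verts F"
  have "card (verts F - {x}) > 0" using F(3) x by (simp add: card_Diff_singleton)
  then obtain y where y: "y \<in> verts F" "y \<noteq> x" by (auto simp: card_gt_0_iff)
  then have "(x, y) \<in> {(x, y). {x, y} \<in> edges F}\<^sup>*"
    using F x by (auto simp: two_connected_def connected_graph_def)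
  then obtain z where "{x, z} \<in> edges F" using y by (auto elim: converse_rtranclE)
  then show "x \<in> \<Union>(edges F)" by blast
qed (use F in \<open>auto simp: simple_graph_def all_pairs_def\<close>)

text \<open>Some vertex \<open>w\<close> lies in two color classes. As \<open>F - w\<close> is connected, the classes without \<open>w\<close> form
  a connected hypergraph on \<open>v - 1\<close> vertices, and deleting \<open>w\<close> lowers their total size by at least 2.\<close>

lemma two_connected_coloring:
  fixes F :: "'a graph" and c :: "'a set \<Rightarrow> 'c"
  assumes F: "simple_graph F" "two_connected F" "num_verts F \<ge> 3"
    and c: "\<not> c constant_on edges F"
  defines "J \<equiv> c ` edges F" and "V \<equiv> (\<lambda>j. \<Union>{e \<in> edges F. c e = j})"
  shows "num_verts F + card J \<le> (\<Sum>j\<in>J. card (V j))"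
proof -
  let ?R = "\<lambda>E. {(x, y). {x, y} \<in> E}"
  have fV: "finite (verts F)" and E: "\<And>e. e \<in> edges F \<Longrightarrow> e \<subseteq> verts F \<and> card e = 2"
    using F by (auto simp: simple_graph_def all_pairs_def)
  have fE: "finite (edges F)"
    using F finite_all_pairs by (auto simp: simple_graph_def intro: finite_subset)
  have fJ: "finite J" using fE by (simp add: J_def)
  have fVj: "finite (V j)" for j
    using E fV by (auto simp: V_def intro: finite_subset[OF _ fV])
  have eV: "e \<subseteq> V (c e)" "c e \<in> J" if "e \<in> edges F" for e using that by (auto simp: V_def J_def)
  have Vc: "card (V j) \<ge> 2" if "j \<in> J" for j
  proof -
    obtain e where e: "e \<in> edges F" "c e = j" using \<open>j \<in> J\<close> by (auto simp: J_def)
    show ?thesis using card_mono[OF fVj eV(1)[OF e(1)]] E[OF e(1)] e by simp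
  qed
  have VF: "V j \<subseteq> verts F" for j using E by (auto simp: V_def)
  have conn: "connected_graph F" using F by (simp add: two_connected_def)
  \<comment> \<open>On a walk between edges of two different colors there is a vertex where the
    color changes.\<close>
  obtain w j1 j2 where w: "j1 \<in> J" "j2 \<in> J" "j1 \<noteq> j2" "w \<in> V j1" "w \<in> V j2"
  proof -
    obtain e1 e2 where e: "e1 \<in> edges F" "e2 \<in> edges F" "c e1 \<noteq> c e2"
      using c by (metis constant_on_def)
    obtain x y where xy: "x \<in> e1" "y \<in> e2" using E[OF e(1)] E[OF e(2)] by fastforce
    have "(x, y) \<in> (?R (edges F))\<^sup>*"
      using conn xy E[OF e(1)] E[OF e(2)] unfolding connected_graph_def by blast
    moreover have "x \<in> V (c e1)" using eV(1)[OF e(1)] xy by auto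
    moreover have "y \<in> V (c e2)" using eV(1)[OF e(2)] xy by auto
    ultimately have "\<exists>w j. j \<in> J \<and> j \<noteq> c e1 \<and> w \<in> V (c e1) \<and> w \<in> V j"
    proof (induction rule: converse_rtrancl_induct)
      case base then show ?case using e eV by metis
    next
      case (step a b)
      then have ab: "{a, b} \<in> edges F" by simp
      then have "a \<in> V (c {a, b})" "b \<in> V (c {a, b})" "c {a, b} \<in> J" using eV[OF ab] by auto
      then show ?case using step by metis
    qed
    then show ?thesis using that eV(2)[OF e(1)] by blast
  qed
  have wV: "w \<in> verts F" using w VF by blast
  let ?W = "\<lambda>j. V j - {w}"
  have U: "(\<Union>j\<in>J. ?W j) = verts F - {w}"
  proof (intro equalityI subsetI)
    fix x assume x: "x \<in> verts F - {w}"
    then obtain d where d: "d \<in> edges F" "x \<in> d" using two_connected_Union_edges[OF F] by blast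
    from eV[OF d(1)] d(2) x show "x \<in> (\<Union>j\<in>J. ?W j)" by auto
  qed (use VF in auto)
  have "card (\<Union>j\<in>J. ?W j) + card J \<le> (\<Sum>j\<in>J. card (?W j)) + 1"
  proof (rule connected_hypergraph_card_le)
    show "?W j \<noteq> {}" if "j \<in> J" for j
    proof
      assume "?W j = {}"
      then have "card (V j) \<le> card {w}" by (intro card_mono) auto
      then show False using Vc[OF that] by simp
    qed
    fix x y assume xy: "x \<in> (\<Union>j\<in>J. ?W j)" "y \<in> (\<Union>j\<in>J. ?W j)"
    then have "(x, y) \<in> (?R (edges (remove_vertex w F)))\<^sup>*"
      using F(2) wV unfolding U two_connected_def connected_graph_def
      by (auto simp: remove_vertex_def)
    moreover have "?R (edges (remove_vertex w F)) \<subseteq> {(x, y). \<exists>j\<in>J. x \<in> ?W j \<and> y \<in> ?W j}"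
    proof clarify
      fix x y assume "{x, y} \<in> edges (remove_vertex w F)"
      then have "{x, y} \<in> edges F" "x \<noteq> w" "y \<noteq> w" by (auto simp: remove_vertex_def)
      then show "\<exists>j\<in>J. x \<in> ?W j \<and> y \<in> ?W j" using eV[of "{x, y}"] by auto
    qed
    ultimately show "(x, y) \<in> {(x, y). \<exists>j\<in>J. x \<in> ?W j \<and> y \<in> ?W j}\<^sup>*"
      using rtrancl_mono by blast
  qed (use fJ w fVj in auto)
  moreover have "card (\<Union>j\<in>J. ?W j) + 1 = num_verts F"
    unfolding U using wV fV F(3) by (simp add: card_Diff_singleton)
  moreover have "(\<Sum>j\<in>J. card (?W j)) + 2 \<le> (\<Sum>j\<in>J. card (V j))"
  proof -
    have "(\<Sum>j\<in>J. card (V j)) = (\<Sum>j\<in>J. card (?W j) + (if w \<in> V j then 1 else 0))"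
    proof (intro sum.cong refl)
      fix j
      show "card (V j) = card (?W j) + (if w \<in> V j then 1 else 0)"
        using card_Suc_Diff1[OF fVj, of w j] by simp
    qed
    also have "\<dots> = (\<Sum>j\<in>J. card (?W j)) + card {j \<in> J. w \<in> V j}"
      using fJ by (simp add: sum.distrib sum.If_cases Int_def)
    also have "card {j \<in> J. w \<in> V j} \<ge> card {j1, j2}"
      by (rule card_mono) (use fJ w in auto)
    ultimately show ?thesis using w(3) by simp
  qed
  ultimately show ?thesis by linarith
qed

text \<open>If every edge has its own color, each class spans 2 vertices, and
  \<open>two_connected_coloring\<close> reads v + e \<le> 2 e.\<close>

lemma two_connected_num_edges_ge:
  assumes F: "simple_graph F" "two_connected F" "num_verts F \<ge> 3"
  shows "num_edges F \<ge> num_verts F"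
proof -
  have E: "\<And>e. e \<in> edges F \<Longrightarrow> e \<subseteq> verts F \<and> card e = 2"
    using F by (auto simp: simple_graph_def all_pairs_def)
  have "\<not> id constant_on edges F"
  proof
    assume "id constant_on edges F"
    then obtain e0 where e0: "\<And>e. e \<in> edges F \<Longrightarrow> e = e0" by (auto simp: constant_on_def)
    have V: "\<Union>(edges F) = verts F" by (rule two_connected_Union_edges[OF F])
    moreover have "verts F \<noteq> {}" using F(3) by auto
    ultimately obtain d where "d \<in> edges F" by blast
    with e0 have "edges F = {e0}" by blast
    with V E[of e0] F(3) show False by simp
  qed
  from two_connected_coloring[OF F this]
  have "num_verts F + num_edges F \<le> (\<Sum>j\<in>edges F. card (\<Union>{e \<in> edges F. e = j}))" by simp
  also have "\<dots> = (\<Sum>j\<in>edges F. 2)"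
  proof (intro sum.cong refl)
    fix j assume j: "j \<in> edges F"
    then have "{e \<in> edges F. e = j} = {j}" by auto
    then show "card (\<Union>{e \<in> edges F. e = j}) = 2" using E[OF j] by simp
  qed
  finally show ?thesis by simp
qed


section \<open>Expectations under finitely supported kernels and under mixtures\<close>

lemma norm_expectation_pmf_le:
  fixes f :: "'a \<Rightarrow> 'b::{banach, second_countable_topology}"
  assumes "\<And>x. norm (f x) \<le> B"
  shows "norm (measure_pmf.expectation p f) \<le> B"
proof -
  have B: "0 \<le> B" using order_trans[OF norm_ge_zero assms] .
  have "norm (measure_pmf.expectation p f) \<le> measure_pmf.expectation p (\<lambda>x. norm (f x))"
    by (rule integral_norm_bound)
  also have "\<dots> \<le> measure_pmf.expectation p (\<lambda>_. B)"
    by (intro integral_mono measure_pmf.integrable_const_bound[where B=B]) (use assms B in auto)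
  finally show ?thesis by simp
qed

lemma measurable_expectation_finite_pmf:
  fixes f :: "'a \<Rightarrow> 'b::{banach, second_countable_topology}"
  assumes S: "finite S" "\<And>w. w \<in> space N \<Longrightarrow> set_pmf (p w) \<subseteq> S"
    and p: "\<And>s. (\<lambda>w. pmf (p w) s) \<in> borel_measurable N"
  shows "(\<lambda>w. measure_pmf.expectation (p w) f) \<in> borel_measurable N"
proof (subst measurable_cong)
  show "measure_pmf.expectation (p w) f = (\<Sum>s\<in>S. pmf (p w) s *\<^sub>R f s)" if "w \<in> space N" for w
    using S that by (intro integral_measure_pmf) auto
  show "(\<lambda>w. \<Sum>s\<in>S. pmf (p w) s *\<^sub>R f s) \<in> borel_measurable N"
    using p by (intro borel_measurable_sum borel_measurable_scaleR) auto
qed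

text \<open>Real and imaginary parts are treated separately by \<open>integral_bind\<close>; the
  uniform bound B makes all integrals involved finite.\<close>

lemma integral_bind_complex:
  fixes f :: "_ \<Rightarrow> complex"
  assumes f [measurable]: "f \<in> borel_measurable K" and B: "\<And>x. x \<in> space K \<Longrightarrow> cmod (f x) \<le> B"
    and N [measurable]: "N \<in> measurable M (subprob_algebra K)" and M: "prob_space M"
    and N1: "\<And>w. w \<in> space M \<Longrightarrow> prob_space (N w)"
  shows "integral\<^sup>L (bind M N) f = (\<integral>w. integral\<^sup>L (N w) f \<partial>M)"
proof -
  interpret prob_space M by fact
  have K: "sets (N w) = sets K" "space (N w) = space K" if "w \<in> space M" for w
    using subprob_measurableD[OF N that] by auto
  have fN: "integrable (N w) f" if w: "w \<in> space M" for w
  proof -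
    interpret N: prob_space "N w" by (rule N1[OF w])
    have "f \<in> borel_measurable (N w)"
      using f unfolding measurable_cong_sets[OF K(1)[OF w] refl] .
    then show ?thesis
      by (intro N.integrable_const_bound[where B=B]) (use B K[OF w] in auto)
  qed
  have prob: "prob_space (bind M N)"
    by (rule prob_space_bind[OF _ N]) (use N1 in auto)
  interpret MN: prob_space "bind M N" by (rule prob)
  have sets: "sets (bind M N) = sets K" by (rule sets_bind[OF _ not_empty]) (use K in auto)
  then have sp: "space (bind M N) = space K" by (rule sets_eq_imp_space_eq)
  have "f \<in> borel_measurable (bind M N)"
    using f unfolding measurable_cong_sets[OF sets refl] .
  then have fMN: "integrable (bind M N) f"
    by (intro MN.integrable_const_bound[where B=B]) (use B sp in auto)
  have real: "integral\<^sup>L (bind M N) h = (\<integral>w. integral\<^sup>L (N w) h \<partial>M)"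
    if h: "h \<in> borel_measurable K" and le: "\<And>x. \<bar>h x\<bar> \<le> cmod (f x)" for h :: "_ \<Rightarrow> real"
    by (rule integral_bind[OF h _ N finite_measure_axioms, of B 1])
       (use B le N1 in \<open>auto intro!: order_trans[OF le] AE_I2 simp: prob_space.emeasure_space_1\<close>)
  have Re: "Re (integral\<^sup>L (bind M N) f) = (\<integral>w. Re (integral\<^sup>L (N w) f) \<partial>M)"
    unfolding integral_Re[OF fMN, symmetric]
    by (subst real) (auto simp: abs_Re_le_cmod fN intro!: Bochner_Integration.integral_cong)
  have Im: "Im (integral\<^sup>L (bind M N) f) = (\<integral>w. Im (integral\<^sup>L (N w) f) \<partial>M)"
    unfolding integral_Im[OF fMN, symmetric]
    by (subst real) (auto simp: abs_Im_le_cmod fN intro!: Bochner_Integration.integral_cong)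
  have meas: "(\<lambda>w. integral\<^sup>L (N w) f) \<in> borel_measurable M"
  proof -
    have "(\<lambda>w. Re (integral\<^sup>L (N w) f)) \<in> borel_measurable M" "(\<lambda>w. Im (integral\<^sup>L (N w) f)) \<in> borel_measurable M"
    proof -
      have "(\<lambda>w. integral\<^sup>L (N w) (\<lambda>x. Re (f x))) \<in> borel_measurable M"
        by (rule measurable_compose[OF N integral_measurable_subprob_algebra]) measurable
      then show "(\<lambda>w. Re (integral\<^sup>L (N w) f)) \<in> borel_measurable M"
        by (subst measurable_cong[where g="\<lambda>w. integral\<^sup>L (N w) (\<lambda>x. Re (f x))"]) (auto simp: fN)
      have "(\<lambda>w. integral\<^sup>L (N w) (\<lambda>x. Im (f x))) \<in> borel_measurable M"
        by (rule measurable_compose[OF N integral_measurable_subprob_algebra]) measurable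
      then show "(\<lambda>w. Im (integral\<^sup>L (N w) f)) \<in> borel_measurable M"
        by (subst measurable_cong[where g="\<lambda>w. integral\<^sup>L (N w) (\<lambda>x. Im (f x))"]) (auto simp: fN)
    qed
    then show ?thesis by (simp add: borel_measurable_complex_iff)
  qed
  have "cmod (integral\<^sup>L (N w) f) \<le> B" if w: "w \<in> space M" for w
  proof -
    interpret N: prob_space "N w" by (rule N1[OF w])
    have "cmod (integral\<^sup>L (N w) f) \<le> (\<integral>x. cmod (f x) \<partial>N w)" by (rule integral_norm_bound)
    also have "\<dots> \<le> (\<integral>x. B \<partial>N w)"
      by (intro integral_mono integrable_norm fN w) (use B K[OF w] in auto)
    finally show ?thesis by (simp add: N.prob_space)
  qed
  then have "integrable M (\<lambda>w. integral\<^sup>L (N w) f)"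
    by (intro integrable_const_bound[where B=B] meas) auto
  then show ?thesis
    using Re Im by (simp add: complex_eq_iff)
qed

section \<open>The layers as independent random graphs\<close>

definition layers_pmf :: "nat \<Rightarrow> nat \<Rightarrow> (nat \<Rightarrow> nat \<times> real) \<Rightarrow> (nat \<Rightarrow> nat graph) pmf" where
  "layers_pmf n m w = Pi_pmf {1..m} ({}, {}) (\<lambda>i. layer_graph n (fst (w i)) (snd (w i)))"

text \<open>The layers before their edge sets are united: a common probability space for the copies
  in the union and the copies in the separate layers.\<close>

definition layers_measure :: "(nat \<times> real) measure \<Rightarrow> nat \<Rightarrow> nat \<Rightarrow> (nat \<Rightarrow> nat graph) measure" where
  "layers_measure D n m = bind (PiM {1..m} (\<lambda>_. D)) (\<lambda>w. measure_pmf (layers_pmf n m w))"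

abbreviation layer_expectation ::
    "(nat \<times> real) measure \<Rightarrow> nat \<Rightarrow> (nat graph \<Rightarrow> 'b::{banach, second_countable_topology}) \<Rightarrow> 'b" where
  "layer_expectation D n f \<equiv> \<integral>w. measure_pmf.expectation (layer_graph n (fst w) (snd w)) f \<partial>D"

lemma expectation_prod_layers_pmf:
  fixes f :: "nat \<Rightarrow> nat graph \<Rightarrow> complex"
  assumes f: "\<And>i G. cmod (f i G) \<le> B"
  shows "measure_pmf.expectation (layers_pmf n m w) (\<lambda>g. \<Prod>i=1..m. f i (g i))
      = (\<Prod>i=1..m. measure_pmf.expectation (layer_graph n (fst (w i)) (snd (w i))) (f i))"
proof -
  let ?p = "layers_pmf n m w"
  have "prob_space.indep_vars (measure_pmf ?p) (\<lambda>_. borel) (\<lambda>i g. f i (g i)) {1..m}"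
    unfolding layers_pmf_def
    by (rule prob_space.indep_vars_compose2[OF measure_pmf.prob_space_axioms indep_vars_Pi_pmf]) auto
  then have "measure_pmf.expectation ?p (\<lambda>g. \<Prod>i=1..m. f i (g i))
      = (\<Prod>i=1..m. measure_pmf.expectation ?p (\<lambda>g. f i (g i)))"
    by (intro prob_space.indep_vars_lebesgue_integral[OF measure_pmf.prob_space_axioms] measure_pmf.integrable_const_bound[where B=B])
       (use f in auto)
  also have "\<dots> = (\<Prod>i=1..m. measure_pmf.expectation (map_pmf (\<lambda>g. g i) ?p) (f i))"
    by simp
  also have "\<dots> = (\<Prod>i=1..m. measure_pmf.expectation (layer_graph n (fst (w i)) (snd (w i))) (f i))"
    unfolding layers_pmf_def by (intro prod.cong refl) (subst Pi_pmf_component, auto)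
  finally show ?thesis .
qed

context
  fixes D :: "(nat \<times> real) measure"
  assumes prob_D: "prob_space D" and sets_D: "sets D = sets (count_space UNIV \<Otimes>\<^sub>M borel)"
begin

interpretation D: prob_space D by (rule prob_D)

lemma measurable_layers_kernel:
  "(\<lambda>w. measure_pmf (layers_pmf n m w)) \<in> measurable (PiM {1..m} (\<lambda>_. D)) (subprob_algebra (count_space UNIV))"
proof (rule measurable_kernel_finite_pmf)
  let ?G = "Pow {1..n} \<times> Pow (all_pairs {1..n})"
  let ?T = "PiE_dflt {1..m} ({}, {}) (\<lambda>_. ?G)"
  show "finite ?T" by (rule finite_PiE_dflt) (auto simp: finite_all_pairs)
  show "set_pmf (layers_pmf n m w) \<subseteq> ?T" for w
    using set_Pi_pmf_subset'[of "{1..m}" "({}, {})" "\<lambda>i. layer_graph n (fst (w i)) (snd (w i))"]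
      set_pmf_layer_graph by (fastforce simp: PiE_dflt_def layers_pmf_def)
  show "(\<lambda>w. pmf (layers_pmf n m w) s) \<in> borel_measurable (PiM {1..m} (\<lambda>_. D))" for s
  proof (cases "\<forall>x. x \<notin> {1..m} \<longrightarrow> s x = ({}, {})")
    case True
    have "(\<lambda>w. pmf (layer_graph n (fst (w i)) (snd (w i))) (s i))
        \<in> borel_measurable (PiM {1..m} (\<lambda>_. D))" if "i \<in> {1..m}" for i
    proof -
      have "(\<lambda>w. pmf (layer_graph n (fst w) (snd w)) (s i)) \<in> borel_measurable D"
        using measurable_pmf_layer_graph measurable_cong_sets[OF sets_D refl] by blast
      from measurable_compose[OF measurable_component_singleton[OF that] this] show ?thesis .
    qed
    then have "(\<lambda>w. \<Prod>i\<in>{1..m}. pmf (layer_graph n (fst (w i)) (snd (w i))) (s i))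
        \<in> borel_measurable (PiM {1..m} (\<lambda>_. D))"
      by (intro borel_measurable_prod)
    then show ?thesis using True by (simp add: layers_pmf_def pmf_Pi)
  next
    case False
    then have "(\<lambda>w. pmf (layers_pmf n m w) s) = (\<lambda>_. 0)"
      by (simp only: layers_pmf_def pmf_Pi finite_atLeastAtMost if_False)
    then show ?thesis by simp
  qed
qed

lemma prob_space_layers_measure: "prob_space (layers_measure D n m)"
  and sets_layers_measure: "sets (layers_measure D n m) = UNIV"
proof -
  interpret P: prob_space "PiM {1..m} (\<lambda>_. D)" by (intro prob_space_PiM prob_D)
  show "prob_space (layers_measure D n m)" unfolding layers_measure_def
    by (rule P.prob_space_bind[OF _ measurable_layers_kernel])
       (auto intro!: AE_I2 measure_pmf.prob_space_axioms)
  show "sets (layers_measure D n m) = UNIV" unfolding layers_measure_def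
    by (subst sets_bind[where N="count_space UNIV", OF _ P.not_empty]) simp_all
qed

lemma superposition_graph_eq_distr:
  "superposition_graph D n m
    = distr (layers_measure D n m) (count_space UNIV) (\<lambda>g. ({1..n}, \<Union>i\<in>{1..m}. edges (g i)))"
proof -
  interpret P: prob_space "PiM {1..m} (\<lambda>_. D)" by (intro prob_space_PiM prob_D)
  show ?thesis
    unfolding superposition_graph_def layers_measure_def superposition_given_def
      layers_pmf_def[symmetric] map_pmf_rep_eq
    by (rule distr_bind[OF measurable_layers_kernel P.not_empty, symmetric]) simp
qed

lemma measurable_layer_expectation:
  fixes f :: "nat graph \<Rightarrow> 'b::{banach, second_countable_topology}"
  shows "(\<lambda>w. measure_pmf.expectation (layer_graph n (fst w) (snd w)) f) \<in> borel_measurable D"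
proof (rule measurable_expectation_finite_pmf[OF _ set_pmf_layer_graph])
  show "finite (Pow {1..n} \<times> Pow (all_pairs {1..n}))" by (simp add: finite_all_pairs)
  show "(\<lambda>w. pmf (layer_graph n (fst w) (snd w)) s) \<in> borel_measurable D" for s
    using measurable_pmf_layer_graph measurable_cong_sets[OF sets_D refl] by blast
qed

lemma integrable_layer_expectation:
  fixes f :: "nat graph \<Rightarrow> 'b::{banach, second_countable_topology}"
  assumes "\<And>G. norm (f G) \<le> B"
  shows "integrable D (\<lambda>w. measure_pmf.expectation (layer_graph n (fst w) (snd w)) f)"
  by (rule D.integrable_const_bound[where B=B])
     (use norm_expectation_pmf_le[of f B, OF assms] measurable_layer_expectation in auto)

text \<open>Given the pairs \<open>w i\<close> the layers are independent, and the pairs are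
  themselves independent, so the product formula survives the averaging over w. Later arguments use
  the independence of the layers in this form.\<close>

lemma integral_prod_layers_measure:
  fixes f :: "nat \<Rightarrow> nat graph \<Rightarrow> complex"
  assumes f: "\<And>i G. cmod (f i G) \<le> B"
  shows "(\<integral>g. (\<Prod>i=1..m. f i (g i)) \<partial>layers_measure D n m) = (\<Prod>i=1..m. layer_expectation D n (f i))"
proof -
  interpret P: prob_space "PiM {1..m} (\<lambda>_. D)" by (intro prob_space_PiM prob_D)
  interpret product_sigma_finite "\<lambda>_. D" ..
  have "(\<integral>g. (\<Prod>i=1..m. f i (g i)) \<partial>layers_measure D n m)
      = (\<integral>w. measure_pmf.expectation (layers_pmf n m w) (\<lambda>g. \<Prod>i=1..m. f i (g i)) \<partial>PiM {1..m} (\<lambda>_. D))"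
    unfolding layers_measure_def
  proof (rule integral_bind_complex[OF _ _ measurable_layers_kernel P.prob_space_axioms])
    show "cmod (\<Prod>i=1..m. f i (g i)) \<le> B ^ m" for g
    proof -
      have "(\<Prod>i=1..m. cmod (f i (g i))) \<le> (\<Prod>i=1..m. B)" by (intro prod_mono) (use f in auto)
      then show ?thesis by (simp add: prod_norm)
    qed
  qed (auto intro: measure_pmf.prob_space_axioms)
  also have "\<dots> = (\<integral>w. (\<Prod>i=1..m. measure_pmf.expectation (layer_graph n (fst (w i)) (snd (w i))) (f i)) \<partial>PiM {1..m} (\<lambda>_. D))"
    by (subst expectation_prod_layers_pmf[where B=B]) (use f in auto)
  also have "\<dots> = (\<Prod>i=1..m. layer_expectation D n (f i))"
    by (rule product_integral_prod) (auto intro: integrable_layer_expectation f)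
  finally show ?thesis .
qed

lemma integral_prod_layers_measure_real:
  fixes f :: "nat \<Rightarrow> nat graph \<Rightarrow> real"
  assumes f: "\<And>i G. \<bar>f i G\<bar> \<le> B"
  shows "(\<integral>g. (\<Prod>i=1..m. f i (g i)) \<partial>layers_measure D n m) = (\<Prod>i=1..m. layer_expectation D n (f i))"
proof -
  have "complex_of_real (\<integral>g. (\<Prod>i=1..m. f i (g i)) \<partial>layers_measure D n m)
      = (\<integral>g. (\<Prod>i=1..m. complex_of_real (f i (g i))) \<partial>layers_measure D n m)"
    by (simp flip: integral_complex_of_real)
  also have "\<dots> = (\<Prod>i=1..m. layer_expectation D n (\<lambda>G. complex_of_real (f i G)))"
    by (rule integral_prod_layers_measure[where B=B]) (use f in auto)
  also have "\<dots> = complex_of_real (\<Prod>i=1..m. layer_expectation D n (f i))" by simp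
  finally show ?thesis by (simp only: of_real_eq_iff)
qed

end


section \<open>Copies created by several layers\<close>

lemma graph_iso_Union_edges:
  assumes "graph_iso F H" "\<Union>(edges F) = verts F"
  shows "\<Union>(edges H) = verts H"
proof -
  obtain f where f: "bij_betw f (verts F) (verts H)" "(\<lambda>e. f ` e) ` edges F = edges H"
    using assms(1) by (auto simp: graph_iso_def)
  have "\<Union>(edges H) = f ` \<Union>(edges F)" unfolding f(2)[symmetric] by auto
  then show ?thesis using f(1) by (simp add: assms(2) bij_betw_def)
qed

definition copies_on :: "'a graph \<Rightarrow> nat \<Rightarrow> nat graph set" where
  "copies_on F n = {H. subgraph H (complete_on {1..n}) \<and> graph_iso F H}"

text \<open>Counting by edge sets inside [n] makes the count a function of the edge set alone, so
  that layers on different vertex sets can be compared with their union.\<close>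

definition copies_within :: "'a graph \<Rightarrow> nat \<Rightarrow> nat set set \<Rightarrow> nat" where
  "copies_within F n E = card {H \<in> copies_on F n. edges H \<subseteq> E}"

lemma finite_copies_on: "finite (copies_on F n)"
  unfolding copies_on_def by (rule finite_complete_subgraphs) simp

lemma card_copies_on:
  assumes "simple_graph F"
  shows "card (copies_on F n) = copies_in_complete F * (n choose num_verts F)"
  using num_copies_complete[OF assms, of "{1..n}"] by (simp add: copies_on_def num_copies_def)

lemma copies_onD:
  assumes "H \<in> copies_on F n" "simple_graph F"
  shows "graph_iso F H" "simple_graph H" "finite (edges H)" "edges H \<subseteq> all_pairs {1..n}"
    "card (verts H) = num_verts F" "card (edges H) = num_edges F"
proof -
  show i: "graph_iso F H" and s: "simple_graph H" "edges H \<subseteq> all_pairs {1..n}"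
    using assms by (auto simp: copies_on_def subgraph_def complete_on_def)
  show "finite (edges H)" using s(1) by (auto simp: simple_graph_def intro: finite_subset finite_all_pairs)
  show "card (verts H) = num_verts F" "card (edges H) = num_edges F"
    by (rule graph_iso_card[OF i assms(2)])+
qed

lemma copies_within_eq_sum:
  "real (copies_within F n E) = (\<Sum>H\<in>copies_on F n. indicator {E. edges H \<subseteq> E} E)"
proof -
  have "real (copies_within F n E) = (\<Sum>H\<in>{H \<in> copies_on F n. edges H \<subseteq> E}. 1)"
    by (simp add: copies_within_def)
  also have "\<dots> = (\<Sum>H\<in>copies_on F n. if edges H \<subseteq> E then 1 else 0)"
    by (rule sum.inter_filter[OF finite_copies_on])
  finally show ?thesis by (simp add: indicator_def of_bool_def)
qed

lemma copies_within_le: "copies_within F n E \<le> card (copies_on F n)"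
  unfolding copies_within_def by (rule card_mono[OF finite_copies_on]) auto

text \<open>As F has no isolated vertices, the edges of a copy determine its vertices, which
  therefore lie in \<open>verts G\<close> as soon as the edges lie in
  \<open>edges G\<close>.\<close>

lemma num_copies_eq_copies_within:
  assumes F: "simple_graph F" "\<Union>(edges F) = verts F"
    and G: "verts G \<subseteq> {1..n}" "edges G \<subseteq> all_pairs (verts G)"
  shows "num_copies F G = copies_within F n (edges G)"
proof -
  have "{H. subgraph H G \<and> graph_iso F H} = {H \<in> copies_on F n. edges H \<subseteq> edges G}"
  proof (intro equalityI subsetI)
    fix H assume "H \<in> {H. subgraph H G \<and> graph_iso F H}"
    then show "H \<in> {H \<in> copies_on F n. edges H \<subseteq> edges G}"
      using G by (fastforce simp: copies_on_def subgraph_def complete_on_def all_pairs_def)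
  next
    fix H assume H: "H \<in> {H \<in> copies_on F n. edges H \<subseteq> edges G}"
    then have "verts H = \<Union>(edges H)"
      using graph_iso_Union_edges[OF _ F(2), of H] by (simp add: copies_on_def)
    also have "\<dots> \<subseteq> verts G" using H G(2) by (auto simp: all_pairs_def)
    finally show "H \<in> {H. subgraph H G \<and> graph_iso F H}"
      using H by (auto simp: copies_on_def subgraph_def)
  qed
  then show ?thesis by (simp add: num_copies_def copies_within_def)
qed

text \<open>Extensional functions, so that for finite A and I the set is finite and can be summed
  over.\<close>

definition nonconstant_colorings :: "nat set set \<Rightarrow> nat set \<Rightarrow> (nat set \<Rightarrow> nat) set" where
  "nonconstant_colorings A I = {c \<in> A \<rightarrow>\<^sub>E I. \<not> c constant_on A}"

text \<open>Bounds the error of replacing the union of the edge sets \<open>E i\<close> by their sum for a copy with edge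
  set \<open>A\<close>: it may lie in two of them, or be assembled from several according to a coloring \<open>c\<close>.\<close>

definition overlap_bound :: "nat set \<Rightarrow> (nat \<Rightarrow> nat set set) \<Rightarrow> nat set set \<Rightarrow> real" where
  "overlap_bound I E A =
     (\<Sum>i\<in>I. \<Sum>j\<in>I - {i}. indicator {E. A \<subseteq> E} (E i) * indicator {E. A \<subseteq> E} (E j))
     + (\<Sum>c\<in>nonconstant_colorings A I. \<Prod>i\<in>I. indicator {E. {e \<in> A. c e = i} \<subseteq> E} (E i))"

text \<open>Let k be the number of layers that contain all of A. For k \<ge> 1 the error is k - 1,
  at most the number k (k - 1) of ordered pairs of such layers. For k = 0 there is an error only if
  A is covered by the union; choosing for each edge a layer that contains it then defines a
  coloring, which cannot be constant.\<close>

lemma union_indicator_minus_sum_le: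
  fixes A :: "nat set set" and E :: "nat \<Rightarrow> nat set set"
  assumes A: "finite A" "A \<noteq> {}" and I: "finite I"
  shows "\<bar>indicator {E. A \<subseteq> E} (\<Union>i\<in>I. E i) - (\<Sum>i\<in>I. indicator {E. A \<subseteq> E} (E i))\<bar> \<le> overlap_bound I E A"
proof -
  define K where "K = {i \<in> I. A \<subseteq> E i}"
  have K: "finite K" "K \<subseteq> I" using I by (auto simp: K_def)
  have s: "(\<Sum>i\<in>I'. indicator {E. A \<subseteq> E} (E i)) = real (card (K \<inter> I'))" if "I' \<subseteq> I" for I'
    using that I finite_subset[OF that I] by (auto simp: K_def indicator_def sum.If_cases Int_def intro!: arg_cong[where f=card])
  have pair: "(\<Sum>i\<in>I. \<Sum>j\<in>I - {i}. indicator {E. A \<subseteq> E} (E i) * indicator {E. A \<subseteq> E} (E j))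
      = real (card K) * (real (card K) - 1)"
  proof -
    have "(\<Sum>i\<in>I. \<Sum>j\<in>I - {i}. indicator {E. A \<subseteq> E} (E i) * indicator {E. A \<subseteq> E} (E j) :: real)
        = (\<Sum>i\<in>I. indicator {E. A \<subseteq> E} (E i) * real (card (K \<inter> (I - {i}))))"
      by (simp add: sum_distrib_left[symmetric] s)
    also have "\<dots> = (\<Sum>i\<in>I. indicator {E. A \<subseteq> E} (E i) * (real (card K) - 1))"
    proof (intro sum.cong refl)
      fix i assume i: "i \<in> I"
      show "indicator {E. A \<subseteq> E} (E i) * real (card (K \<inter> (I - {i}))) = indicator {E. A \<subseteq> E} (E i) * (real (card K) - 1)"
      proof (cases "i \<in> K")
        case True
        have "K \<inter> (I - {i}) = K - {i}" using K by auto
        moreover have "card K \<ge> 1" using True K by (auto simp: Suc_le_eq card_gt_0_iff)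
        ultimately show ?thesis using True K by (simp add: card_Diff_singleton of_nat_diff)
      qed (use i in \<open>simp add: K_def\<close>)
    qed
    also have "\<dots> = real (card K) * (real (card K) - 1)"
      using s[OF order_refl] K by (simp add: sum_distrib_right[symmetric] Int_absorb2)
    finally show ?thesis .
  qed
  have nn: "0 \<le> (\<Sum>c\<in>nonconstant_colorings A I. \<Prod>i\<in>I. indicator {E. {e \<in> A. c e = i} \<subseteq> E} (E i) :: real)"
    by (intro sum_nonneg prod_nonneg) auto
  have sI: "(\<Sum>i\<in>I. indicator {E. A \<subseteq> E} (E i)) = real (card K)"
    using s[OF order_refl] K by (simp add: Int_absorb2)
  show ?thesis
  proof (cases "K = {}")
    case False
    then obtain i where "i \<in> K" by blast
    then have "A \<subseteq> (\<Union>i\<in>I. E i)" by (auto simp: K_def)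
    moreover have k: "real (card K) \<ge> 1" using False K by (simp add: Suc_le_eq card_gt_0_iff)
    ultimately have "\<bar>indicator {E. A \<subseteq> E} (\<Union>i\<in>I. E i) - real (card K)\<bar> = 1 * (real (card K) - 1)" by simp
    also have "\<dots> \<le> real (card K) * (real (card K) - 1)" using k by (intro mult_right_mono) auto
    finally show ?thesis using nn unfolding overlap_bound_def pair sI by linarith
  next
    case True
    show ?thesis
    proof (cases "A \<subseteq> (\<Union>i\<in>I. E i)")
      case A': True
      then have "\<forall>e\<in>A. \<exists>i. i \<in> I \<and> e \<in> E i" by blast
      then obtain c0 where c0: "\<And>e. e \<in> A \<Longrightarrow> c0 e \<in> I \<and> e \<in> E (c0 e)" by metis
      define c where "c = restrict c0 A"
      have c: "\<And>e. e \<in> A \<Longrightarrow> c e \<in> I \<and> e \<in> E (c e)" "c \<in> A \<rightarrow>\<^sub>E I"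
        using c0 by (auto simp: c_def)
      have "\<not> c constant_on A"
      proof
        assume "c constant_on A"
        then obtain i where i: "\<And>e. e \<in> A \<Longrightarrow> c e = i" by (auto simp: constant_on_def)
        have "i \<in> K" using c i A(2) by (fastforce simp: K_def)
        then show False using True by simp
      qed
      then have cN: "c \<in> nonconstant_colorings A I" using c by (simp add: nonconstant_colorings_def)
      have fin: "finite (nonconstant_colorings A I)"
        unfolding nonconstant_colorings_def using A I by (simp add: finite_PiE)
      have "(1::real) = (\<Prod>i\<in>I. indicator {E. {e \<in> A. c e = i} \<subseteq> E} (E i))"
        by (rule sym, rule prod.neutral) (use c in \<open>auto simp: indicator_def\<close>)
      also have "\<dots> \<le> (\<Sum>c\<in>nonconstant_colorings A I. \<Prod>i\<in>I. indicator {E. {e \<in> A. c e = i} \<subseteq> E} (E i))"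
        by (rule member_le_sum[OF cN _ fin]) (auto intro!: prod_nonneg)
      finally show ?thesis unfolding overlap_bound_def pair sI using True A' by simp
    next
      case False
      then show ?thesis unfolding overlap_bound_def pair sI using True nn by simp
    qed
  qed
qed

lemma copies_within_union_le:
  assumes F: "simple_graph F" "num_edges F > 0" and I: "finite I"
  shows "\<bar>real (copies_within F n (\<Union>i\<in>I. E i)) - (\<Sum>i\<in>I. real (copies_within F n (E i)))\<bar>
    \<le> (\<Sum>H\<in>copies_on F n. overlap_bound I E (edges H))"
proof -
  have "real (copies_within F n (\<Union>i\<in>I. E i)) - (\<Sum>i\<in>I. real (copies_within F n (E i)))
      = (\<Sum>H\<in>copies_on F n. indicator {E. edges H \<subseteq> E} (\<Union>i\<in>I. E i) - (\<Sum>i\<in>I. indicator {E. edges H \<subseteq> E} (E i)))"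
    unfolding copies_within_eq_sum sum_subtractf by (subst sum.swap) simp
  also have "\<bar>\<dots>\<bar> \<le> (\<Sum>H\<in>copies_on F n. overlap_bound I E (edges H))"
  proof (intro order_trans[OF sum_abs] sum_mono union_indicator_minus_sum_le I)
    fix H assume H: "H \<in> copies_on F n"
    show "finite (edges H)" by (rule copies_onD(3)[OF H F(1)])
    show "edges H \<noteq> {}" using copies_onD(6)[OF H F(1)] F(2) by auto
  qed
  finally show ?thesis .
qed

text \<open>The chance that a random k-subset of [n] contains u given points is a product of ratios
  (k - i) / (n - i), each at most k / n.\<close>

lemma choose_diff_le:
  assumes "u \<le> k" "k \<le> n"
  shows "real ((n - u) choose (k - u)) * real n ^ u \<le> real (n choose k) * real k ^ u"
  using assms(1)
proof (induction u)
  case (Suc u)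
  define N K where "N = n - Suc u" and "K = k - Suc u"
  have N: "n - u = Suc N" "k - u = Suc K" using Suc.prems assms(2) by (auto simp: N_def K_def)
  have "Suc K * (Suc N choose Suc K) = Suc N * (N choose K)" by (rule Suc_times_binomial)
  then have b: "real (Suc K) * real (Suc N choose Suc K) = real (Suc N) * real (N choose K)"
    by (metis of_nat_mult)
  have kn: "real (Suc K) * real n \<le> real k * real (Suc N)"
  proof -
    have e: "real (Suc K) = real k - real u" "real (Suc N) = real n - real u"
      using Suc.prems assms(2) by (auto simp: N_def K_def)
    show ?thesis
      unfolding e using mult_right_mono[of "real k" "real n" "real u"] assms(2) by (simp add: algebra_simps)
  qed
  have "real (Suc N) * (real (N choose K) * real n ^ Suc u)
      = (real (Suc K) * real n) * (real (Suc N choose Suc K) * real n ^ u)"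
    unfolding power_Suc mult.assoc[symmetric] b[symmetric] by (simp only: mult_ac)
  also have "\<dots> \<le> (real k * real (Suc N)) * (real (n choose k) * real k ^ u)"
    by (rule mult_mono[OF kn Suc.IH[OF Suc_leD[OF Suc.prems], unfolded N]]) auto
  also have "\<dots> = real (Suc N) * (real (n choose k) * real k ^ Suc u)" by simp
  finally have "real (N choose K) * real n ^ Suc u \<le> real (n choose k) * real k ^ Suc u"
    by (rule mult_left_le_imp_le) simp
  then show ?case by (simp add: N_def K_def)
qed simp

lemma card_supersets_le:
  assumes "finite V"
  shows "card {W. W \<subseteq> V \<and> card W = k \<and> U \<subseteq> W} \<le> (card V - card U) choose (k - card U)"
proof (cases "U \<subseteq> V")
  case True
  have fU: "finite U" using True assms by (rule finite_subset)
  have "card {W. W \<subseteq> V \<and> card W = k \<and> U \<subseteq> W} \<le> card {W. W \<subseteq> V - U \<and> card W = k - card U}"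
  proof (rule card_inj_on_le[where f="\<lambda>W. W - U"])
    show "inj_on (\<lambda>W. W - U) {W. W \<subseteq> V \<and> card W = k \<and> U \<subseteq> W}"
      by (rule inj_onI) blast
    show "(\<lambda>W. W - U) ` {W. W \<subseteq> V \<and> card W = k \<and> U \<subseteq> W} \<subseteq> {W. W \<subseteq> V - U \<and> card W = k - card U}"
      using fU by (auto simp: card_Diff_subset)
    show "finite {W. W \<subseteq> V - U \<and> card W = k - card U}"
      by (rule finite_subset[of _ "Pow V"]) (use assms in auto)
  qed
  also have "\<dots> = (card V - card U) choose (k - card U)"
    using assms True fU by (subst n_subsets) (auto simp: card_Diff_subset)
  finally show ?thesis .
next
  case False
  then have "{W. W \<subseteq> V \<and> card W = k \<and> U \<subseteq> W} = {}" by blast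
  then show ?thesis by (simp only: card.empty zero_le)
qed

text \<open>The edges of B can only appear if the vertex set of the layer contains all their
  endpoints; the edge probabilities are bounded by 1.\<close>

lemma prob_layer_graph_edges_le:
  "measure_pmf.prob (layer_graph n x q) {G. B \<subseteq> edges G} \<le> (real (min x n) / real n) ^ card (\<Union>B)"
proof -
  let ?k = "min x n" and ?U = "\<Union>B"
  let ?S = "{V. V \<subseteq> {1..n} \<and> card V = ?k}"
  note S = layer_vertex_sets[of n x]
  have "measure_pmf.prob (layer_graph n x q) {G. B \<subseteq> edges G}
      = (\<integral>V. measure_pmf.prob (bernoulli_graph V q) {G. B \<subseteq> edges G} \<partial>pmf_of_set ?S)"
    unfolding layer_graph_def by (simp add: measure_pmf_bind)
      (subst subprob_space.measure_bind[where N="count_space UNIV"], auto simp: measure_pmf_in_subprob_algebra intro!: measure_pmf.subprob_space_axioms)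
  also have "\<dots> \<le> (\<integral>V. indicator {V. ?U \<subseteq> V} V \<partial>pmf_of_set ?S)"
  proof (intro integral_mono measure_pmf.integrable_const_bound[where B=1])
    fix V
    show "measure_pmf.prob (bernoulli_graph V q) {G. B \<subseteq> edges G} \<le> indicator {V. ?U \<subseteq> V} V"
    proof (cases "?U \<subseteq> V")
      case False
      have "measure_pmf.prob (bernoulli_graph V q) {G. B \<subseteq> edges G} = measure_pmf.prob (bernoulli_graph V q) {}"
        using False set_pmf_bernoulli_graph[of V q]
        by (intro measure_prob_cong_0) (fastforce simp: all_pairs_def set_pmf_eq)+
      then show ?thesis by simp
    qed simp
  qed auto
  also have "\<dots> = measure_pmf.prob (pmf_of_set ?S) {V. ?U \<subseteq> V}" by simp
  also have "\<dots> = real (card (?S \<inter> {V. ?U \<subseteq> V})) / real (card ?S)"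
    by (rule measure_pmf_of_set[OF S(2,1)])
  also have "?S \<inter> {V. ?U \<subseteq> V} = {V \<in> ?S. ?U \<subseteq> V}" by blast
  also have "real (card {V \<in> ?S. ?U \<subseteq> V}) / real (card ?S) \<le> (real ?k / real n) ^ card ?U"
  proof (cases "{V \<in> ?S. ?U \<subseteq> V} = {}")
    case False
    then obtain V where V: "V \<subseteq> {1..n}" "card V = ?k" "?U \<subseteq> V" by blast
    have u: "card ?U \<le> ?k" using V card_mono[of V ?U] by (auto intro: finite_subset)
    have "real (card {V \<in> ?S. ?U \<subseteq> V}) \<le> real ((n - card ?U) choose (?k - card ?U))"
      using card_supersets_le[of "{1..n}" ?k ?U] by (simp add: conj_assoc)
    then have "real (card {V \<in> ?S. ?U \<subseteq> V}) * real n ^ card ?U \<le> real (n choose ?k) * real ?k ^ card ?U"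
      using choose_diff_le[OF u, of n] by (meson min.cobounded2 mult_right_mono order_trans of_nat_0_le_iff zero_le_power)
    moreover have "card ?S = n choose ?k" using n_subsets[of "{1..n}" ?k] by simp
    moreover have "n choose ?k > 0" by simp
    \<comment> \<open>For n = 0 the ratio on the right is 0 / 0 = 0, and the exponent 0 keeps the
      bound true.\<close>
    moreover have "n = 0 \<Longrightarrow> ?k = 0 \<and> card ?U = 0" using u by simp
    ultimately show ?thesis
      by (cases "n = 0") (auto simp: power_divide field_simps)
  qed (simp only: card.empty of_nat_0 div_0, simp)
  finally show ?thesis .
qed

text \<open>A new element of \<open>A\<close> takes one of at most \<open>card A\<close> old colors or a new one, at the price \<open>x\<close>.\<close>

lemma sum_power_card_image_le:
  assumes A: "finite A" and I: "finite I" and x: "0 \<le> x" "real (card I) * x \<le> \<kappa>"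
  shows "(\<Sum>c\<in>A \<rightarrow>\<^sub>E I. x ^ card (c ` A)) \<le> (real (card A) + \<kappa>) ^ card A"
  using A
proof (induction A rule: finite_induct)
  case (insert a A)
  have \<kappa>: "\<kappa> \<ge> 0" using x by (meson mult_nonneg_nonneg of_nat_0_le_iff order_trans)
  have "(\<Sum>c\<in>insert a A \<rightarrow>\<^sub>E I. x ^ card (c ` insert a A))
      = (\<Sum>(i, c)\<in>I \<times> (A \<rightarrow>\<^sub>E I). x ^ card (c(a := i) ` insert a A))"
    unfolding PiE_insert_eq using insert.hyps
    by (subst sum.reindex[OF inj_combinator]) (auto simp: case_prod_beta)
  also have "\<dots> = (\<Sum>c\<in>A \<rightarrow>\<^sub>E I. \<Sum>i\<in>I. x ^ card (insert i (c ` A)))"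
  proof -
    have "c(a := i) ` insert a A = insert i (c ` A)" for c :: "'a \<Rightarrow> 'b" and i using insert.hyps by auto
    then show ?thesis by (subst sum.swap) (simp add: sum.cartesian_product)
  qed
  also have "\<dots> \<le> (\<Sum>c\<in>A \<rightarrow>\<^sub>E I. x ^ card (c ` A) * (real (card (insert a A)) + \<kappa>))"
  proof (rule sum_mono)
    fix c assume c: "c \<in> A \<rightarrow>\<^sub>E I"
    then have cI: "c ` A \<subseteq> I" by auto
    have fin: "finite (c ` A)" using insert.hyps by simp
    have "(\<Sum>i\<in>I. x ^ card (insert i (c ` A)))
        = (\<Sum>i\<in>I - c ` A. x ^ card (insert i (c ` A))) + (\<Sum>i\<in>c ` A. x ^ card (insert i (c ` A)))"
      using cI I by (rule sum.subset_diff)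
    also have "(\<Sum>i\<in>I - c ` A. x ^ card (insert i (c ` A))) = (\<Sum>i\<in>I - c ` A. x * x ^ card (c ` A))"
      using fin by (intro sum.cong refl) simp
    also have "(\<Sum>i\<in>c ` A. x ^ card (insert i (c ` A))) = (\<Sum>i\<in>c ` A. x ^ card (c ` A))"
      by (intro sum.cong refl) (simp add: insert_absorb)
    also have "(\<Sum>i\<in>I - c ` A. x * x ^ card (c ` A)) + (\<Sum>i\<in>c ` A. x ^ card (c ` A))
        = x ^ card (c ` A) * (real (card (c ` A)) + real (card (I - c ` A)) * x)"
      by (simp add: algebra_simps)
    also have "\<dots> \<le> x ^ card (c ` A) * (real (card (insert a A)) + \<kappa>)"
    proof (intro mult_left_mono add_mono)
      show "real (card (c ` A)) \<le> real (card (insert a A))"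
        using card_image_le[OF insert.hyps(1), of c] insert.hyps by simp
      have "real (card (I - c ` A)) * x \<le> real (card I) * x"
        using x I by (intro mult_right_mono) (auto intro: card_mono)
      then show "real (card (I - c ` A)) * x \<le> \<kappa>" using x by linarith
    qed (use x in auto)
    finally show "(\<Sum>i\<in>I. x ^ card (insert i (c ` A))) \<le> x ^ card (c ` A) * (real (card (insert a A)) + \<kappa>)" .
  qed
  also have "\<dots> = (\<Sum>c\<in>A \<rightarrow>\<^sub>E I. x ^ card (c ` A)) * (real (card (insert a A)) + \<kappa>)"
    by (simp add: sum_distrib_right)
  also have "\<dots> \<le> (real (card A) + \<kappa>) ^ card A * (real (card (insert a A)) + \<kappa>)"
    using insert.IH \<kappa> by (intro mult_right_mono) auto
  also have "\<dots> \<le> (real (card (insert a A)) + \<kappa>) ^ card A * (real (card (insert a A)) + \<kappa>)"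
    using \<kappa> insert.hyps by (intro mult_right_mono power_mono) auto
  also have "\<dots> = (real (card (insert a A)) + \<kappa>) ^ card (insert a A)"
    using insert.hyps by (simp add: mult.commute)
  finally show ?case .
qed simp


section \<open>The expected number of multi-layer copies\<close>

lemma coloring_copy:
  fixes c :: "'b set \<Rightarrow> 'c"
  assumes F: "simple_graph F" "two_connected F" "num_verts F \<ge> 3" and H: "graph_iso F H"
    and c: "\<not> c constant_on edges H"
  shows "num_verts F + card (c ` edges H) \<le> (\<Sum>j\<in>c ` edges H. card (\<Union>{e \<in> edges H. c e = j}))"
proof -
  obtain f where f: "bij_betw f (verts F) (verts H)" "(\<lambda>e. f ` e) ` edges F = edges H"
    using H by (auto simp: graph_iso_def)
  let ?c = "\<lambda>e. c (f ` e)"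
  have img: "?c ` edges F = c ` edges H" unfolding f(2)[symmetric] by (simp add: image_image)
  have nc: "\<not> ?c constant_on edges F" using c unfolding f(2)[symmetric] by (auto simp: constant_on_def)
  have "card (\<Union>{e \<in> edges H. c e = j}) = card (\<Union>{e \<in> edges F. ?c e = j})" for j
  proof -
    have "\<Union>{e \<in> edges H. c e = j} = f ` \<Union>{e \<in> edges F. ?c e = j}" unfolding f(2)[symmetric] by blast
    moreover have "\<Union>{e \<in> edges F. ?c e = j} \<subseteq> verts F"
      using F(1) by (auto simp: simple_graph_def all_pairs_def)
    ultimately show ?thesis
      using inj_on_subset[OF bij_betw_imp_inj_on[OF f(1)]] by (simp add: card_image)
  qed
  then show ?thesis using two_connected_coloring[OF F nc] unfolding img by simp
qed

text \<open>Here \<theta> is the loss in the exponent of a class that spans all v vertices. One such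
  class is covered by the hypothesis on the sum. If there are s \<ge> 2 of them, they contribute s v
  vertices and the other classes at least 2 each; as v - \<theta> \<ge> 2, every full class beyond
  the first gains 2, and the remaining inequality is 2 \<le> s \<le> \<open>card J\<close>.\<close>

lemma coloring_exponent_le:
  fixes d :: "'c \<Rightarrow> nat" and v :: nat and \<theta> :: real
  assumes J: "finite J" and d: "\<And>j. j \<in> J \<Longrightarrow> 2 \<le> d j" and v: "3 \<le> v"
    and sum: "v + card J \<le> (\<Sum>j\<in>J. d j)" and \<theta>: "0 \<le> \<theta>" "\<theta> \<le> 1"
  shows "(\<Sum>j\<in>J. (if d j = v then \<theta> else 0) - real (d j)) \<le> \<theta> - real v - real (card J)"
proof -
  define S where "S = {j \<in> J. d j = v}"
  define s where "s = card S"
  have fS: "finite S" "S \<subseteq> J" using J by (auto simp: S_def)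
  have sr: "s \<le> card J" unfolding s_def using J fS by (intro card_mono) auto
  have "(\<Sum>j\<in>J. (if d j = v then \<theta> else 0)) = real s * \<theta>"
    using J by (simp add: sum.If_cases S_def s_def Int_def)
  then have eq: "(\<Sum>j\<in>J. (if d j = v then \<theta> else 0) - real (d j)) = real s * \<theta> - real (\<Sum>j\<in>J. d j)"
    by (simp add: sum_subtractf)
  show ?thesis
  proof (cases "s \<le> 1")
    case True
    then have "real s * \<theta> \<le> 1 * \<theta>" using \<theta> by (intro mult_right_mono) auto
    moreover have "real v + real (card J) \<le> real (\<Sum>j\<in>J. d j)" using sum by (simp only: of_nat_add[symmetric] of_nat_le_iff)
    ultimately show ?thesis unfolding eq by linarith
  next
    case False
    have "(\<Sum>j\<in>J. d j) = (\<Sum>j\<in>J - S. d j) + (\<Sum>j\<in>S. d j)"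
      by (rule sum.subset_diff) (use fS J in auto)
    also have "(\<Sum>j\<in>S. d j) = s * v" by (simp add: S_def s_def)
    finally have "(\<Sum>j\<in>J. d j) \<ge> 2 * card (J - S) + s * v"
      using sum_mono[of "J - S" "\<lambda>_. 2" d] d by simp
    moreover have "card (J - S) + s = card J" using fS J by (simp add: s_def card_Diff_subset card_mono)
    ultimately have "(\<Sum>j\<in>J. d j) + 2 * s \<ge> 2 * card J + s * v" by linarith
    then have "real (2 * card J + s * v) \<le> real ((\<Sum>j\<in>J. d j) + 2 * s)" by (rule of_nat_mono)
    then have 1: "real (\<Sum>j\<in>J. d j) + 2 * real s \<ge> 2 * real (card J) + real s * real v"
      by (simp only: of_nat_add of_nat_mult of_nat_numeral)
    have "(real s - 1) * (real v - \<theta>) \<ge> (real s - 1) * 2"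
      using False v \<theta> by (intro mult_left_mono) auto
    moreover have "real s \<ge> 2" "real s \<le> real (card J)" using False sr by auto
    ultimately show ?thesis unfolding eq using 1 by (simp add: algebra_simps)
  qed
qed

definition expected_overlap :: "(nat \<times> real) measure \<Rightarrow> 'a graph \<Rightarrow> nat \<Rightarrow> nat \<Rightarrow> real" where
  "expected_overlap D F n m =
     (\<Sum>H\<in>copies_on F n. \<integral>g. overlap_bound {1..m} (\<lambda>i. edges (g i)) (edges H) \<partial>layers_measure D n m)"

lemma vertex_ratio_bounds: "0 \<le> real (min x n) / real n" "real (min x n) / real n \<le> 1"
  by (auto simp: divide_le_eq_1)

context
  fixes D :: "(nat \<times> real) measure"
  assumes prob_D: "prob_space D" and sets_D: "sets D = sets (count_space UNIV \<Otimes>\<^sub>M borel)"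
begin

interpretation D: prob_space D by (rule prob_D)

lemma measurable_fst_D: "(\<lambda>w. f (fst w)) \<in> borel_measurable D" for f :: "nat \<Rightarrow> real"
proof -
  have "(\<lambda>w. f (fst w)) \<in> borel_measurable (count_space UNIV \<Otimes>\<^sub>M (borel :: real measure))"
    by (rule measurable_compose[OF measurable_fst]) simp
  then show ?thesis using measurable_cong_sets[OF sets_D refl] by blast
qed

lemma measurable_layers_measure: "f \<in> measurable (layers_measure D n m) N \<longleftrightarrow> range f \<subseteq> space N"
proof -
  have "space (layers_measure D n m) = space (count_space UNIV)"
    by (rule sets_eq_imp_space_eq) (simp add: sets_layers_measure[OF prob_D sets_D])
  then show ?thesis by (auto simp: measurable_def sets_layers_measure[OF prob_D sets_D])
qed

text \<open>By \<open>prob_layer_graph_edges_le\<close> an upper bound for the probability that a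
  layer contains a prescribed set of edges with k endpoints.\<close>

definition vertex_moment :: "nat \<Rightarrow> nat \<Rightarrow> real" where
  "vertex_moment n k = (\<integral>w. (real (min (fst w) n) / real n) ^ k \<partial>D)"

lemma integrable_vertex_ratio: "integrable D (\<lambda>w. (real (min (fst w) n) / real n) ^ k)"
  by (rule D.integrable_const_bound[where B=1])
     (use vertex_ratio_bounds in \<open>auto intro!: power_le_one measurable_fst_D\<close>)

lemma vertex_moment_nonneg: "0 \<le> vertex_moment n k"
  unfolding vertex_moment_def by (intro Bochner_Integration.integral_nonneg) auto

lemma vertex_moment_0 [simp]: "vertex_moment n 0 = 1"
  by (simp add: vertex_moment_def D.prob_space)

lemma layer_expectation_edges_le:
  "layer_expectation D n (indicator {G. B \<subseteq> edges G}) \<le> vertex_moment n (card (\<Union>B))"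
  unfolding vertex_moment_def
proof (rule integral_mono)
  show "integrable D (\<lambda>w. measure_pmf.expectation (layer_graph n (fst w) (snd w)) (indicator {G. B \<subseteq> edges G} :: _ \<Rightarrow> real))"
    by (rule integrable_layer_expectation[OF prob_D sets_D, where B=1]) auto
qed (use integrable_vertex_ratio prob_layer_graph_edges_le in auto)

lemma integral_prod_edges_le:
  "(\<integral>g. (\<Prod>i=1..m. indicat_real {E. B i \<subseteq> E} (edges (g i))) \<partial>layers_measure D n m)
     \<le> (\<Prod>i=1..m. vertex_moment n (card (\<Union>(B i))))"
proof -
  have "(\<integral>g. (\<Prod>i=1..m. indicat_real {E. B i \<subseteq> E} (edges (g i))) \<partial>layers_measure D n m)
      = (\<integral>g. (\<Prod>i=1..m. indicat_real {G. B i \<subseteq> edges G} (g i)) \<partial>layers_measure D n m)"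
    by (simp add: indicator_def)
  also have "\<dots> = (\<Prod>i=1..m. layer_expectation D n (indicat_real {G. B i \<subseteq> edges G}))"
    by (rule integral_prod_layers_measure_real[OF prob_D sets_D, where B=1 and f="\<lambda>i. indicat_real {G. B i \<subseteq> edges G}"]) auto
  also have "\<dots> \<le> (\<Prod>i=1..m. vertex_moment n (card (\<Union>(B i))))"
    by (intro prod_mono conjI layer_expectation_edges_le Bochner_Integration.integral_nonneg) auto
  finally show ?thesis .
qed

lemma integrable_layers_measure:
  fixes f :: "_ \<Rightarrow> 'b::{banach, second_countable_topology}"
  assumes "\<And>g. norm (f g) \<le> B"
  shows "integrable (layers_measure D n m) f"
proof -
  interpret J: prob_space "layers_measure D n m" by (rule prob_space_layers_measure[OF prob_D sets_D])
  show ?thesis by (rule J.integrable_const_bound[where B=B]) (use assms in \<open>auto simp: measurable_layers_measure\<close>)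
qed

lemma integral_overlap_bound_le:
  assumes A: "finite A"
  shows "(\<integral>g. overlap_bound {1..m} (\<lambda>i. edges (g i)) A \<partial>layers_measure D n m)
    \<le> (real m * vertex_moment n (card (\<Union>A)))\<^sup>2
       + (\<Sum>c\<in>nonconstant_colorings A {1..m}. \<Prod>j\<in>c ` A. vertex_moment n (card (\<Union>{e \<in> A. c e = j})))"
proof -
  let ?J = "layers_measure D n m"
  let ?I = "{1..m}"
  let ?p = "vertex_moment n"
  let ?ind = "\<lambda>B i g. indicator {E. B \<subseteq> E} (edges (g i)) :: real"
  have i1: "integrable ?J (\<lambda>g. ?ind A i g * ?ind A j g)" for i j
    by (rule integrable_layers_measure[where B=1]) (auto simp: indicator_def)
  have i2: "integrable ?J (\<lambda>g. \<Prod>i\<in>?I. ?ind {e \<in> A. c e = i} i g)" for c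
    by (rule integrable_layers_measure[where B=1]) (auto intro!: prod_le_1 simp: prod_nonneg)
  have "(\<integral>g. overlap_bound ?I (\<lambda>i. edges (g i)) A \<partial>?J)
      = (\<Sum>i\<in>?I. \<Sum>j\<in>?I - {i}. \<integral>g. ?ind A i g * ?ind A j g \<partial>?J)
        + (\<Sum>c\<in>nonconstant_colorings A ?I. \<integral>g. (\<Prod>i\<in>?I. ?ind {e \<in> A. c e = i} i g) \<partial>?J)"
  proof -
    have "(\<integral>g. (\<Sum>i\<in>?I. \<Sum>j\<in>?I - {i}. ?ind A i g * ?ind A j g) \<partial>?J)
        = (\<Sum>i\<in>?I. \<Sum>j\<in>?I - {i}. \<integral>g. ?ind A i g * ?ind A j g \<partial>?J)"
      by (subst Bochner_Integration.integral_sum, intro Bochner_Integration.integrable_sum i1,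
          intro sum.cong refl Bochner_Integration.integral_sum i1)
    moreover have i1': "integrable ?J (\<lambda>g. \<Sum>i\<in>?I. \<Sum>j\<in>?I - {i}. ?ind A i g * ?ind A j g)"
      by (intro Bochner_Integration.integrable_sum i1)
    moreover have i2': "integrable ?J (\<lambda>g. \<Sum>c\<in>nonconstant_colorings A ?I. \<Prod>i\<in>?I. ?ind {e \<in> A. c e = i} i g)"
      by (intro Bochner_Integration.integrable_sum i2)
    ultimately show ?thesis
      unfolding overlap_bound_def Bochner_Integration.integral_add[OF i1' i2'] Bochner_Integration.integral_sum[OF i2]
      by (simp only:)
  qed
  also have "\<dots> \<le> (\<Sum>i\<in>?I. \<Sum>j\<in>?I - {i}. ?p (card (\<Union>A)) * ?p (card (\<Union>A)))
      + (\<Sum>c\<in>nonconstant_colorings A ?I. \<Prod>j\<in>c ` A. ?p (card (\<Union>{e \<in> A. c e = j})))"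
  proof (intro add_mono sum_mono)
    fix i j assume ij: "i \<in> ?I" "j \<in> ?I - {i}"
    \<comment> \<open>A product of two indicators is a product over all layers in which the other
      layers are asked for the empty edge set.\<close>
    let ?B = "\<lambda>k. if k \<in> {i, j} then A else {}"
    have *: "(\<Prod>k\<in>?I. h (?B k) k) = h A i * h A j" if "\<And>k. h {} k = 1" for h :: "nat set set \<Rightarrow> nat \<Rightarrow> real"
    proof -
      have "(\<Prod>k\<in>?I. h (?B k) k) = (\<Prod>k\<in>{i, j}. h (?B k) k)"
        by (rule prod.mono_neutral_right) (use ij that in auto)
      then show ?thesis using ij by simp
    qed
    have "(\<integral>g. ?ind A i g * ?ind A j g \<partial>?J) = (\<integral>g. (\<Prod>k\<in>?I. ?ind (?B k) k g) \<partial>?J)"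
      by (subst *) auto
    also have "\<dots> \<le> (\<Prod>k\<in>?I. ?p (card (\<Union>(?B k))))" by (rule integral_prod_edges_le)
    also have "\<dots> = ?p (card (\<Union>A)) * ?p (card (\<Union>A))" by (subst *) auto
    finally show "(\<integral>g. ?ind A i g * ?ind A j g \<partial>?J) \<le> ?p (card (\<Union>A)) * ?p (card (\<Union>A))" .
  next
    fix c assume c: "c \<in> nonconstant_colorings A ?I"
    have "(\<integral>g. (\<Prod>i\<in>?I. ?ind {e \<in> A. c e = i} i g) \<partial>?J) \<le> (\<Prod>i\<in>?I. ?p (card (\<Union>{e \<in> A. c e = i})))"
      by (rule integral_prod_edges_le)
    also have "\<dots> = (\<Prod>i\<in>c ` A. ?p (card (\<Union>{e \<in> A. c e = i})))"
    proof (rule prod.mono_neutral_right)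
      show "\<forall>i\<in>?I - c ` A. ?p (card (\<Union>{e \<in> A. c e = i})) = 1"
      proof
        fix i assume "i \<in> ?I - c ` A"
        then have "{e \<in> A. c e = i} = {}" by blast
        then show "?p (card (\<Union>{e \<in> A. c e = i})) = 1" by (simp only: Union_empty card.empty vertex_moment_0)
      qed
    qed (use c in \<open>auto simp: nonconstant_colorings_def\<close>)
    finally show "(\<integral>g. (\<Prod>i\<in>?I. ?ind {e \<in> A. c e = i} i g) \<partial>?J) \<le> (\<Prod>i\<in>c ` A. ?p (card (\<Union>{e \<in> A. c e = i})))" .
  qed
  also have "(\<Sum>i\<in>?I. \<Sum>j\<in>?I - {i}. ?p (card (\<Union>A)) * ?p (card (\<Union>A))) \<le> (\<Sum>i\<in>?I. \<Sum>j\<in>?I. ?p (card (\<Union>A)) * ?p (card (\<Union>A)))"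
    by (intro sum_mono sum_mono2) (auto simp: vertex_moment_nonneg)
  also have "\<dots> = (real m * ?p (card (\<Union>A)))\<^sup>2" by (simp add: power2_eq_square)
  finally show ?thesis by simp
qed

text \<open>A coloring with r colors has probability O(n^(\<theta> - v - r)), and by
  \<open>sum_power_card_image_le\<close> the r factors 1/n pay for the m = O(n) choices of each
  color. So a potential copy contributes O(n^(\<theta> - v)) whatever the number of colors, and
  there are O(n^v) of them.\<close>

lemma expected_overlap_le:
  assumes F: "simple_graph F" "two_connected F" "num_verts F \<ge> 3"
    and n: "n > 0" and \<kappa>: "real m \<le> \<kappa> * real n" and \<theta>: "0 \<le> \<theta>" "\<theta> \<le> 1" and C: "C \<ge> 1"
    and low: "\<And>k. k < num_verts F \<Longrightarrow> vertex_moment n k \<le> C * real n powr (- real k)"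
    and top: "vertex_moment n (num_verts F) \<le> C * real n powr (\<theta> - real (num_verts F))"
  shows "expected_overlap D F n m
    \<le> real (copies_in_complete F) * ((\<kappa> * C)\<^sup>2 + C ^ num_edges F * (real (num_edges F) + \<kappa>) ^ num_edges F) * real n powr \<theta>"
proof -
  let ?v = "num_verts F" and ?e = "num_edges F" and ?I = "{1..m}"
  define K where "K = (\<kappa> * C)\<^sup>2 + C ^ ?e * (real ?e + \<kappa>) ^ ?e"
  have \<kappa>0: "\<kappa> \<ge> 0"
  proof (rule ccontr)
    assume "\<not> \<kappa> \<ge> 0"
    then have "\<kappa> * real n < 0" using n by (simp add: mult_neg_pos)
    then show False using \<kappa> by (smt (verit) of_nat_0_le_iff)
  qed
  have n1: "real n \<ge> 1" using n by simp
  have "(\<integral>g. overlap_bound ?I (\<lambda>i. edges (g i)) (edges H) \<partial>layers_measure D n m) \<le> K * real n powr (\<theta> - ?v)"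
    if H: "H \<in> copies_on F n" for H
  proof -
    let ?A = "edges H"
    note HD = copies_onD[OF H F(1)]
    have UA: "\<Union>?A = verts H" by (rule graph_iso_Union_edges[OF HD(1) two_connected_Union_edges[OF F]])
    have fV: "finite (verts H)" using HD(2) by (simp add: simple_graph_def)
    have pair: "(real m * vertex_moment n (card (\<Union>?A)))\<^sup>2 \<le> (\<kappa> * C)\<^sup>2 * real n powr (\<theta> - ?v)"
    proof -
      have "real m * vertex_moment n (card (\<Union>?A)) \<le> (\<kappa> * real n) * (C * real n powr (\<theta> - ?v))"
        unfolding UA HD(5) using \<kappa> top \<kappa>0 by (intro mult_mono) (auto simp: vertex_moment_nonneg)
      then have "(real m * vertex_moment n (card (\<Union>?A)))\<^sup>2 \<le> ((\<kappa> * real n) * (C * real n powr (\<theta> - ?v)))\<^sup>2"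
        by (intro power_mono) (auto simp: vertex_moment_nonneg)
      also have "\<dots> = (\<kappa> * C)\<^sup>2 * (real n powr 1 * real n powr 1 * real n powr (\<theta> - ?v) * real n powr (\<theta> - ?v))"
        using n by (simp add: power2_eq_square)
      also have "\<dots> = (\<kappa> * C)\<^sup>2 * real n powr (1 + 1 + (\<theta> - ?v) + (\<theta> - ?v))"
        by (simp only: powr_add)
      \<comment> \<open>The exponent 2 + 2 (\<theta> - v) does not exceed \<theta> - v, because
        \<theta> - v \<le> -2.\<close>
      also have "\<dots> \<le> (\<kappa> * C)\<^sup>2 * real n powr (\<theta> - ?v)"
        using n1 F(3) \<theta> by (intro mult_left_mono powr_mono) auto
      finally show ?thesis .
    qed
    have col: "(\<Prod>j\<in>c ` ?A. vertex_moment n (card (\<Union>{e \<in> ?A. c e = j})))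
        \<le> C ^ ?e * real n powr (\<theta> - ?v) * (1 / real n) ^ card (c ` ?A)"
      if c: "c \<in> nonconstant_colorings ?A ?I" for c
    proof -
      let ?d = "\<lambda>j. card (\<Union>{e \<in> ?A. c e = j})"
      let ?J = "c ` ?A"
      have fJ: "finite ?J" using HD(3) by simp
      have dv: "?d j \<le> ?v" for j
      proof -
        have "?d j \<le> card (verts H)" unfolding UA[symmetric] by (rule card_mono) (use fV UA in auto)
        then show ?thesis by (simp add: HD(5))
      qed
      have d2: "2 \<le> ?d j" if "j \<in> ?J" for j
      proof -
        from that obtain e where e: "e \<in> ?A" "c e = j" by auto
        then have "e \<subseteq> \<Union>{e \<in> ?A. c e = j}" by blast
        moreover have "finite (\<Union>{e \<in> ?A. c e = j})" by (rule finite_subset[OF _ fV]) (use UA in auto)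
        ultimately have "card e \<le> ?d j" by (rule card_mono[rotated])
        moreover have "card e = 2" using e HD(4) by (auto simp: all_pairs_def)
        ultimately show ?thesis by simp
      qed
      have p: "vertex_moment n (?d j) \<le> C * real n powr ((if ?d j = ?v then \<theta> else 0) - real (?d j))" for j
        using low[of "?d j"] top dv[of j] by (cases "?d j = ?v") auto
      have "(\<Prod>j\<in>?J. vertex_moment n (?d j)) \<le> (\<Prod>j\<in>?J. C * real n powr ((if ?d j = ?v then \<theta> else 0) - real (?d j)))"
        by (intro prod_mono conjI p vertex_moment_nonneg)
      also have "\<dots> = C ^ card ?J * real n powr (\<Sum>j\<in>?J. (if ?d j = ?v then \<theta> else 0) - real (?d j))"
        using n by (simp add: prod.distrib powr_sum)
      also have "\<dots> \<le> C ^ ?e * real n powr (\<theta> - ?v - real (card ?J))"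
      proof (intro mult_mono power_increasing powr_mono)
        show "card ?J \<le> ?e" using card_image_le[OF HD(3), of c] HD(6) by simp
        show "(\<Sum>j\<in>?J. (if ?d j = ?v then \<theta> else 0) - real (?d j)) \<le> \<theta> - ?v - real (card ?J)"
          using c by (intro coloring_exponent_le fJ d2 F(3) \<theta> coloring_copy[OF F HD(1)])
            (auto simp: nonconstant_colorings_def)
      qed (use C n1 in auto)
      also have "real n powr (\<theta> - ?v - real (card ?J)) = real n powr (\<theta> - ?v) * (1 / real n) ^ card ?J"
        using n by (simp add: powr_diff powr_realpow power_divide)
      finally show ?thesis by (simp add: mult.assoc)
    qed
    have "(\<Sum>c\<in>nonconstant_colorings ?A ?I. \<Prod>j\<in>c ` ?A. vertex_moment n (card (\<Union>{e \<in> ?A. c e = j})))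
        \<le> (\<Sum>c\<in>nonconstant_colorings ?A ?I. C ^ ?e * real n powr (\<theta> - ?v) * (1 / real n) ^ card (c ` ?A))"
      by (intro sum_mono col)
    also have "\<dots> \<le> (\<Sum>c\<in>?A \<rightarrow>\<^sub>E ?I. C ^ ?e * real n powr (\<theta> - ?v) * (1 / real n) ^ card (c ` ?A))"
      using HD(3) C by (intro sum_mono2) (auto simp: nonconstant_colorings_def finite_PiE)
    also have "\<dots> = C ^ ?e * real n powr (\<theta> - ?v) * (\<Sum>c\<in>?A \<rightarrow>\<^sub>E ?I. (1 / real n) ^ card (c ` ?A))"
      by (simp only: sum_distrib_left)
    also have "\<dots> \<le> C ^ ?e * real n powr (\<theta> - ?v) * (real (card ?A) + \<kappa>) ^ card ?A"
      using HD(3) C \<kappa> n by (intro mult_left_mono sum_power_card_image_le) (auto simp: field_simps)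
    finally have colsum: "(\<Sum>c\<in>nonconstant_colorings ?A ?I. \<Prod>j\<in>c ` ?A. vertex_moment n (card (\<Union>{e \<in> ?A. c e = j})))
        \<le> C ^ ?e * real n powr (\<theta> - ?v) * (real ?e + \<kappa>) ^ ?e" by (simp only: HD(6))
    show ?thesis
      by (rule order_trans[OF integral_overlap_bound_le[OF HD(3)] order_trans[OF add_mono[OF pair colsum]]])
         (simp add: K_def algebra_simps)
  qed
  then have "(\<Sum>H\<in>copies_on F n. \<integral>g. overlap_bound ?I (\<lambda>i. edges (g i)) (edges H) \<partial>layers_measure D n m)
      \<le> real (card (copies_on F n)) * (K * real n powr (\<theta> - ?v))"
    by (rule sum_bounded_above)
  also have "\<dots> \<le> real (copies_in_complete F) * real n ^ ?v * (K * real n powr (\<theta> - ?v))"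
  proof (intro mult_right_mono)
    have "real (n choose ?v) \<le> real n ^ ?v"
    proof (cases "?v \<le> n")
      case True
      then show ?thesis using binomial_le_pow[OF True] by (metis of_nat_le_iff of_nat_power)
    qed (simp add: binomial_eq_0)
    then show "real (card (copies_on F n)) \<le> real (copies_in_complete F) * real n ^ ?v"
      unfolding card_copies_on[OF F(1)] by (simp add: mult_left_mono)
    show "0 \<le> K * real n powr (\<theta> - ?v)" using C \<kappa>0 by (simp add: K_def)
  qed
  also have "\<dots> = real (copies_in_complete F) * K * real n powr \<theta>"
    using n by (simp add: powr_diff powr_realpow)
  finally show ?thesis by (simp only: K_def expected_overlap_def)
qed

lemma copies_within_union_L1:
  assumes F: "simple_graph F" "num_edges F > 0"
  shows "(\<integral>g. \<bar>real (copies_within F n (\<Union>i\<in>{1..m}. edges (g i))) - (\<Sum>i=1..m. real (copies_within F n (edges (g i))))\<bar> \<partial>layers_measure D n m)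
    \<le> expected_overlap D F n m"
proof -
  have ob: "integrable (layers_measure D n m) (\<lambda>g. overlap_bound {1..m} (\<lambda>i. edges (g i)) (edges H))" for H :: "nat graph"
    unfolding overlap_bound_def
    by (intro Bochner_Integration.integrable_add Bochner_Integration.integrable_sum integrable_layers_measure[where B=1])
       (auto intro!: prod_le_1 simp: indicator_def prod_nonneg)
  let ?N = "real (card (copies_on F n))"
  have "\<bar>real (copies_within F n E)\<bar> \<le> ?N" for E using copies_within_le[of F n E] by simp
  then have "\<bar>real (copies_within F n (\<Union>i\<in>{1..m}. edges (g i))) - (\<Sum>i=1..m. real (copies_within F n (edges (g i))))\<bar> \<le> ?N + real m * ?N" for g :: "nat \<Rightarrow> nat graph"
    using sum_bounded_above[of "{1..m}" "\<lambda>i. real (copies_within F n (edges (g i)))" ?N]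
      sum_nonneg[of "{1..m}" "\<lambda>i. real (copies_within F n (edges (g i)))"] by (smt (verit) card_atLeastAtMost diff_Suc_1 of_nat_0_le_iff)
  then have "integrable (layers_measure D n m) (\<lambda>g. \<bar>real (copies_within F n (\<Union>i\<in>{1..m}. edges (g i))) - (\<Sum>i=1..m. real (copies_within F n (edges (g i))))\<bar>)"
    by (intro integrable_layers_measure[where B="?N + real m * ?N"]) simp
  then have le: "(\<integral>g. \<bar>real (copies_within F n (\<Union>i\<in>{1..m}. edges (g i))) - (\<Sum>i=1..m. real (copies_within F n (edges (g i))))\<bar> \<partial>layers_measure D n m)
      \<le> (\<integral>g. (\<Sum>H\<in>copies_on F n. overlap_bound {1..m} (\<lambda>i. edges (g i)) (edges H)) \<partial>layers_measure D n m)"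
    by (intro integral_mono copies_within_union_le F Bochner_Integration.integrable_sum ob) auto
  show ?thesis by (rule order_trans[OF le]) (simp only: expected_overlap_def Bochner_Integration.integral_sum[OF ob] order_refl)
qed

end


section \<open>Comparison with a sum of independent copy counts\<close>

lemma num_copies_le_embedding:
  assumes F: "simple_graph F" and inj: "inj_on h V" and hV: "h ` V \<subseteq> W" and E: "E \<subseteq> all_pairs V"
    and hE: "(\<lambda>e. h ` e) ` E \<subseteq> E'" and W: "finite W"
  shows "num_copies F (V, E) \<le> num_copies F (W, E')"
proof -
  let ?C = "{H. subgraph H (V, E) \<and> graph_iso F H}" and ?C' = "{H. subgraph H (W, E') \<and> graph_iso F H}"
  define \<phi> where "\<phi> = (\<lambda>H :: 'b graph. (h ` verts H, (\<lambda>e. h ` e) ` edges H))"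
  have "\<phi> H \<in> ?C'" if H: "H \<in> ?C" for H
  proof -
    have s: "simple_graph H" "verts H \<subseteq> V" "edges H \<subseteq> E" and i: "graph_iso F H"
      using H by (auto simp: subgraph_def)
    have p: "h ` e \<in> all_pairs (h ` verts H)" if "e \<in> edges H" for e
    proof -
      have "e \<subseteq> verts H" "card e = 2" using that s(1) by (auto simp: simple_graph_def all_pairs_def)
      moreover have "inj_on h e" using \<open>e \<subseteq> verts H\<close> s(2) inj by (auto intro: inj_on_subset)
      ultimately show ?thesis by (auto simp: all_pairs_def card_image)
    qed
    have "h ` e \<in> E'" if "e \<in> edges H" for e
      using hE s(3) that by (meson image_subset_iff subsetD)
    moreover have "h ` verts H \<subseteq> W" using hV s(2) by (meson image_mono order_trans)
    ultimately have "subgraph (\<phi> H) (W, E')"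
      using s p by (auto simp: subgraph_def simple_graph_def \<phi>_def)
    moreover obtain f where f: "bij_betw f (verts F) (verts H)" "(\<lambda>e. f ` e) ` edges F = edges H"
      using i by (auto simp: graph_iso_def)
    have "bij_betw (h \<circ> f) (verts F) (verts (\<phi> H))"
      by (rule bij_betw_trans[OF f(1)])
         (use s(2) inj in \<open>auto simp: \<phi>_def intro: inj_on_imp_bij_betw inj_on_subset\<close>)
    moreover have "(\<lambda>e. (h \<circ> f) ` e) ` edges F = edges (\<phi> H)"
      unfolding \<phi>_def snd_conv f(2)[symmetric] image_image image_comp[symmetric] ..
    ultimately show ?thesis unfolding graph_iso_def by blast
  qed
  moreover have "inj_on \<phi> ?C"
  proof (rule inj_onI)
    fix H K assume "H \<in> ?C" and "K \<in> ?C" and eq: "\<phi> H = \<phi> K"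
    then have sub: "verts H \<subseteq> V" "verts K \<subseteq> V" "edges H \<subseteq> Pow V" "edges K \<subseteq> Pow V"
      using E by (auto simp: subgraph_def all_pairs_def)
    have "verts H = verts K"
      using eq sub inj_on_image_eq_iff[OF inj] by (auto simp: \<phi>_def)
    moreover have "edges H = edges K"
      using eq sub inj_on_image_eq_iff[OF inj_on_image_Pow[OF inj]] by (auto simp: \<phi>_def)
    ultimately show "H = K" by (rule prod_eqI)
  qed
  moreover have "finite ?C'"
  proof (rule finite_subset)
    show "?C' \<subseteq> Pow W \<times> Pow (all_pairs W)"
      by (fastforce simp: subgraph_def simple_graph_def all_pairs_def)
  qed (auto simp: W finite_all_pairs)
  ultimately show ?thesis unfolding num_copies_def
    by (intro card_inj_on_le[of \<phi>]) auto
qed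

lemma num_copies_eq_if_bij:
  assumes F: "simple_graph F" and h: "bij_betw h V W" and V: "finite V" and E: "E \<subseteq> all_pairs V"
    and E': "E' = (\<lambda>e. h ` e) ` E"
  shows "num_copies F (V, E) = num_copies F (W, E')"
proof (rule antisym)
  note inj = bij_betw_imp_inj_on[OF h]
  have hV: "h ` V = W" using h by (simp add: bij_betw_def)
  have W: "finite W" using V hV by blast
  show "num_copies F (V, E) \<le> num_copies F (W, E')"
    by (rule num_copies_le_embedding[OF F inj _ E _ W]) (auto simp: hV E')
  let ?g = "the_inv_into V h"
  have g: "bij_betw ?g W V" by (rule bij_betw_the_inv_into[OF h])
  have gh: "?g ` h ` e = e" if "e \<subseteq> V" for e
    using that inj by (force simp: image_image the_inv_into_f_f)
  show "num_copies F (W, E') \<le> num_copies F (V, E)"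
  proof (rule num_copies_le_embedding[OF F bij_betw_imp_inj_on[OF g] _ _ _ V])
    show "?g ` W \<subseteq> V" using g by (simp add: bij_betw_def)
    show "E' \<subseteq> all_pairs W"
    proof
      fix e' assume "e' \<in> E'"
      then obtain e where e: "e \<in> E" "e' = h ` e" by (auto simp: E')
      then have "e \<subseteq> V" "card e = 2" using E by (auto simp: all_pairs_def)
      then show "e' \<in> all_pairs W"
        using e(2) hV inj_on_subset[OF inj, of e] by (auto simp: all_pairs_def card_image)
    qed
    show "(\<lambda>e. ?g ` e) ` E' \<subseteq> E" using gh E by (auto simp: E' all_pairs_def)
  qed
qed

lemma map_pmf_num_copies_bernoulli_graph:
  assumes F: "simple_graph F" and V: "finite V" "finite W" "card V = card W"
  shows "map_pmf (num_copies F) (bernoulli_graph V q) = map_pmf (num_copies F) (bernoulli_graph W q)"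
proof -
  obtain h where h: "bij_betw h V W" using finite_same_card_bij[OF V] by blast
  note inj = bij_betw_imp_inj_on[OF h]
  have hV: "h ` V = W" using h by (simp add: bij_betw_def)
  \<comment> \<open>Off the pairs of V the value {} is not a pair of W either, as the change of
    index by \<open>Pi_pmf_bij_betw\<close> requires.\<close>
  define h' where "h' e = (if e \<in> all_pairs V then h ` e else {})" for e
  have b: "bij_betw h' (all_pairs V) (all_pairs W)"
  proof (rule bij_betw_imageI)
    show "inj_on h' (all_pairs V)"
      using inj_on_image_eq_iff[OF inj] by (auto intro!: inj_onI simp: h'_def all_pairs_def)
    have "h ` e \<in> all_pairs W" if "e \<in> all_pairs V" for e
      using that hV inj_on_subset[OF inj, of e] by (auto simp: all_pairs_def card_image)
    moreover have "\<exists>e\<in>all_pairs V. e' = h ` e" if e': "e' \<in> all_pairs W" for e'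
    proof -
      have "e' \<subseteq> h ` V" using e' hV by (auto simp: all_pairs_def)
      then obtain e where e: "e \<subseteq> V" "e' = h ` e" by (auto simp: subset_image_iff)
      then have "card e = 2" using e' card_image[OF inj_on_subset[OF inj e(1)]] by (simp add: all_pairs_def)
      then show ?thesis using e by (auto simp: all_pairs_def)
    qed
    ultimately have "(\<lambda>e. h ` e) ` all_pairs V = all_pairs W" by blast
    moreover have "h' ` all_pairs V = (\<lambda>e. h ` e) ` all_pairs V" by (intro image_cong) (auto simp: h'_def)
    ultimately show "h' ` all_pairs V = all_pairs W" by simp
  qed
  have "map_pmf (num_copies F) (bernoulli_graph V q)
      = map_pmf (\<lambda>f. num_copies F (V, {e \<in> all_pairs V. f e})) (Pi_pmf (all_pairs V) False (\<lambda>_. bernoulli_pmf q))"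
    by (simp add: bernoulli_graph_def pmf.map_comp o_def)
  also have "Pi_pmf (all_pairs V) False (\<lambda>_. bernoulli_pmf q)
      = map_pmf (\<lambda>g. g \<circ> h') (Pi_pmf (all_pairs W) False (\<lambda>_. bernoulli_pmf q))"
    by (rule Pi_pmf_bij_betw[OF finite_all_pairs[OF V(1)] b]) (auto simp: h'_def all_pairs_def)
  also have "map_pmf (\<lambda>f. num_copies F (V, {e \<in> all_pairs V. f e})) \<dots>
      = map_pmf (\<lambda>g. num_copies F (W, {e \<in> all_pairs W. g e})) (Pi_pmf (all_pairs W) False (\<lambda>_. bernoulli_pmf q))"
  proof -
    have "num_copies F (V, {e \<in> all_pairs V. g (h' e)}) = num_copies F (W, {e \<in> all_pairs W. g e})" for g
    proof (rule num_copies_eq_if_bij[OF F h V(1)])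
      show "{e \<in> all_pairs W. g e} = (\<lambda>e. h ` e) ` {e \<in> all_pairs V. g (h' e)}"
      proof -
        have "{e \<in> all_pairs W. g e} = h' ` {e \<in> all_pairs V. g (h' e)}"
          unfolding bij_betw_imp_surj_on[OF b, symmetric] by auto
        also have "\<dots> = (\<lambda>e. h ` e) ` {e \<in> all_pairs V. g (h' e)}"
          by (intro image_cong) (auto simp: h'_def)
        finally show ?thesis .
      qed
    qed auto
    then show ?thesis by (simp add: pmf.map_comp o_def)
  qed
  also have "\<dots> = map_pmf (num_copies F) (bernoulli_graph W q)"
    by (simp add: bernoulli_graph_def pmf.map_comp o_def)
  finally show ?thesis .
qed

lemma num_copies_full_vertex_set: "num_copies F ({1..n}, E) = copies_within F n E"
proof -
  have "{H. subgraph H ({1..n}, E) \<and> graph_iso F H} = {H \<in> copies_on F n. edges H \<subseteq> E}"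
    by (fastforce simp: copies_on_def subgraph_def simple_graph_def complete_on_def all_pairs_def)
  then show ?thesis by (simp add: num_copies_def copies_within_def)
qed

text \<open>The law of the count depends on the vertex set only through its size, so the random
  vertex set may be replaced by an initial segment.\<close>

lemma expectation_layer_graph_copies:
  fixes h :: "nat \<Rightarrow> 'b::{banach, second_countable_topology}"
  assumes F: "simple_graph F" "two_connected F" "num_verts F \<ge> 3"
  shows "measure_pmf.expectation (layer_graph n x q) (\<lambda>G. h (copies_within F n (edges G)))
      = measure_pmf.expectation (bernoulli_graph {1..min x n} q) (\<lambda>G. h (num_copies F G))"
proof -
  let ?S = "{V. V \<subseteq> {1..n} \<and> card V = min x n}"
  note S = layer_vertex_sets[of n x]
  have "map_pmf (\<lambda>G. copies_within F n (edges G)) (layer_graph n x q)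
      = bind_pmf (pmf_of_set ?S) (\<lambda>V. map_pmf (\<lambda>G. copies_within F n (edges G)) (bernoulli_graph V q))"
    unfolding layer_graph_def map_bind_pmf ..
  also have "\<dots> = bind_pmf (pmf_of_set ?S) (\<lambda>V. map_pmf (num_copies F) (bernoulli_graph {1..min x n} q))"
  proof (intro bind_pmf_cong refl)
    fix V assume "V \<in> set_pmf (pmf_of_set ?S)"
    then have V: "V \<subseteq> {1..n}" "card V = min x n" using set_pmf_of_set[OF S(2,1)] by auto
    have "map_pmf (\<lambda>G. copies_within F n (edges G)) (bernoulli_graph V q) = map_pmf (num_copies F) (bernoulli_graph V q)"
    proof (intro map_pmf_cong refl num_copies_eq_copies_within[symmetric] F(1) two_connected_Union_edges[OF F])
      fix G assume "G \<in> set_pmf (bernoulli_graph V q)"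
      then have "G \<in> {V} \<times> Pow (all_pairs V)" using set_pmf_bernoulli_graph by blast
      then show "verts G \<subseteq> {1..n}" "edges G \<subseteq> all_pairs (verts G)" using V(1) by auto
    qed
    also have "\<dots> = map_pmf (num_copies F) (bernoulli_graph {1..min x n} q)"
      using V by (intro map_pmf_num_copies_bernoulli_graph F(1)) (auto intro: finite_subset)
    finally show "map_pmf (\<lambda>G. copies_within F n (edges G)) (bernoulli_graph V q)
        = map_pmf (num_copies F) (bernoulli_graph {1..min x n} q)" .
  qed
  also have "\<dots> = map_pmf (num_copies F) (bernoulli_graph {1..min x n} q)"
    by (rule bind_pmf_const)
  finally have "measure_pmf.expectation (map_pmf (\<lambda>G. copies_within F n (edges G)) (layer_graph n x q)) h
      = measure_pmf.expectation (map_pmf (num_copies F) (bernoulli_graph {1..min x n} q)) h" by (rule arg_cong)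
  then show ?thesis by simp
qed

section \<open>Characteristic functions of the copy counts\<close>

context
  fixes D :: "(nat \<times> real) measure"
  assumes prob_D: "prob_space D" and sets_D: "sets D = sets (count_space UNIV \<Otimes>\<^sub>M borel)"
begin

interpretation D: prob_space D by (rule prob_D)

lemma measurable_bernoulli_kernel_D:
  "(\<lambda>(x, q). measure_pmf (bernoulli_graph {1..x} q)) \<in> measurable D (subprob_algebra (count_space UNIV))"
  using measurable_bernoulli_kernel measurable_cong_sets[OF sets_D refl] by blast

lemma measurable_bernoulli_expectation:
  fixes h :: "nat \<Rightarrow> nat graph \<Rightarrow> 'b::{banach, second_countable_topology}"
  shows "(\<lambda>w. measure_pmf.expectation (bernoulli_graph {1..r (fst w)} (snd w)) (h (fst w))) \<in> borel_measurable D"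
proof -
  have "(\<lambda>w. measure_pmf.expectation (bernoulli_graph {1..r (fst w)} (snd w)) (h (fst w)))
      \<in> borel_measurable (count_space UNIV \<Otimes>\<^sub>M borel)"
  proof (rule measurable_pair_measure_countable1)
    fix x :: nat
    have "(\<lambda>q. measure_pmf.expectation (bernoulli_graph {1..r x} q) (h x)) \<in> borel_measurable borel"
      by (rule measurable_expectation_finite_pmf[OF _ set_pmf_bernoulli_graph])
         (auto simp: finite_all_pairs intro: measurable_pmf_bernoulli_graph)
    then show "(\<lambda>q. measure_pmf.expectation (bernoulli_graph {1..r (fst (x, q))} (snd (x, q))) (h (fst (x, q)))) \<in> borel_measurable borel"
      by simp
  qed simp
  then show ?thesis using measurable_cong_sets[OF sets_D refl] by blast
qed

lemma integrable_bernoulli_expectation: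
  fixes h :: "nat \<Rightarrow> nat graph \<Rightarrow> 'b::{banach, second_countable_topology}"
  assumes "\<And>x G. norm (h x G) \<le> B"
  shows "integrable D (\<lambda>w. measure_pmf.expectation (bernoulli_graph {1..r (fst w)} (snd w)) (h (fst w)))"
  by (rule D.integrable_const_bound[where B=B])
     (use norm_expectation_pmf_le[of "h _" B, OF assms] measurable_bernoulli_expectation in auto)

lemma measurable_mixed_bernoulli_graph: "f \<in> measurable (mixed_bernoulli_graph D) N \<longleftrightarrow> range f \<subseteq> space N"
proof -
  have "space (mixed_bernoulli_graph D) = space (count_space UNIV)"
    by (rule sets_eq_imp_space_eq) (simp add: prob_space_mixed_bernoulli_graph[OF prob_D sets_D])
  then show ?thesis by (auto simp: measurable_def prob_space_mixed_bernoulli_graph[OF prob_D sets_D])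
qed

lemma char_mixed_bernoulli_graph:
  "char (distr (mixed_bernoulli_graph D) borel f) u
    = (\<integral>w. measure_pmf.expectation (bernoulli_graph {1..fst w} (snd w)) (\<lambda>G. iexp (u * f G)) \<partial>D)"
proof -
  have "char (distr (mixed_bernoulli_graph D) borel f) u = (\<integral>G. iexp (u * f G) \<partial>mixed_bernoulli_graph D)"
    unfolding char_def by (rule integral_distr) (auto simp: measurable_mixed_bernoulli_graph)
  also have "\<dots> = (\<integral>w. integral\<^sup>L (case w of (x, q) \<Rightarrow> measure_pmf (bernoulli_graph {1..x} q)) (\<lambda>G. iexp (u * f G)) \<partial>D)"
    unfolding mixed_bernoulli_graph_def
    by (rule integral_bind_complex[OF _ _ measurable_bernoulli_kernel_D prob_D, where B=1])
       (auto intro: measure_pmf.prob_space_axioms)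
  finally show ?thesis by (simp add: case_prod_beta)
qed

text \<open>The count in a layer and the count in G(X, Q) differ in law only through the truncation
  of the size on X > n; there two numbers of modulus at most 1 differ by at most 2.\<close>

lemma layer_char_near:
  assumes F: "simple_graph F" "two_connected F" "num_verts F \<ge> 3"
  shows "cmod (layer_expectation D n (\<lambda>G. iexp (u * real (copies_within F n (edges G))))
       - char (distr (mixed_bernoulli_graph D) borel (\<lambda>G. real (num_copies F G))) u)
     \<le> 2 * D.prob {w \<in> space D. n < fst w}"
proof -
  let ?e = "\<lambda>G. iexp (u * real (num_copies F G))"
  let ?f = "\<lambda>r w. measure_pmf.expectation (bernoulli_graph {1..r (fst w)} (snd w)) ?e"
  have i: "integrable D (?f r)" for r
    by (rule integrable_bernoulli_expectation[where B=1 and h="\<lambda>_. ?e"]) simp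
  have n1: "cmod (?f r w) \<le> 1" for r w by (rule norm_expectation_pmf_le) simp
  have S: "{w \<in> space D. n < fst w} \<in> sets D"
    using borel_measurable_less[OF borel_measurable_const measurable_fst_D[OF prob_D sets_D, of real], of "real n"] by simp
  have "layer_expectation D n (\<lambda>G. iexp (u * real (copies_within F n (edges G)))) = (\<integral>w. ?f (\<lambda>x. min x n) w \<partial>D)"
    using expectation_layer_graph_copies[OF F, where h="\<lambda>N. iexp (u * real N)"] by simp
  then have "layer_expectation D n (\<lambda>G. iexp (u * real (copies_within F n (edges G))))
       - char (distr (mixed_bernoulli_graph D) borel (\<lambda>G. real (num_copies F G))) u
      = (\<integral>w. ?f (\<lambda>x. min x n) w - ?f (\<lambda>x. x) w \<partial>D)"
    unfolding char_mixed_bernoulli_graph by (simp only: Bochner_Integration.integral_diff[OF i[of "\<lambda>x. min x n"] i[of "\<lambda>x. x"]])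
  also have "cmod \<dots> \<le> (\<integral>w. 2 * indicator {w \<in> space D. n < fst w} w \<partial>D)"
  proof (rule order_trans[OF integral_norm_bound integral_mono])
    show "integrable D (\<lambda>w. cmod (?f (\<lambda>x. min x n) w - ?f (\<lambda>x. x) w))"
      by (intro integrable_norm Bochner_Integration.integrable_diff i)
    show "integrable D (\<lambda>w. 2 * indicator {w \<in> space D. n < fst w} w :: real)"
      using S by (intro integrable_mult_right integrable_real_indicator) (auto simp: D.emeasure_eq_measure)
    fix w assume w: "w \<in> space D"
    show "cmod (?f (\<lambda>x. min x n) w - ?f (\<lambda>x. x) w) \<le> 2 * indicator {w \<in> space D. n < fst w} w"
    proof (cases "n < fst w")
      case True
      then show ?thesis
        using w norm_triangle_ineq4[of "?f (\<lambda>x. min x n) w" "?f (\<lambda>x. x) w"] n1[of "\<lambda>x. min x n" w] n1[of "\<lambda>x. x" w] by simp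
    qed simp
  qed
  also have "\<dots> = 2 * D.prob {w \<in> space D. n < fst w}" using S by simp
  finally show ?thesis .
qed

text \<open>Two errors add up. The count in the union and the sum over the layers are close in mean,
  and exp(i x) is Lipschitz in x; then the m-th powers of two numbers in the unit disc differ by at
  most m times their distance. The centering c is arbitrary, so that the estimate serves both
  parts.\<close>

theorem char_superposition_near:
  fixes t c s :: real and n m :: nat and F :: "'a graph"
  assumes F: "simple_graph F" "two_connected F" "num_verts F \<ge> 3" and s: "s > 0"
  defines "NF \<equiv> (\<lambda>G :: nat graph. real (num_copies F G))"
  shows "cmod (char (distr (superposition_graph D n m) borel (\<lambda>G. (NF G - c) / s)) t
        - iexp (- (t * c / s)) * char (distr (mixed_bernoulli_graph D) borel NF) (t / s) ^ m)
      \<le> \<bar>t\<bar> / s * expected_overlap D F n m + real m * (2 * D.prob {w \<in> space D. n < fst w})"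
proof -
  interpret J: prob_space "layers_measure D n m" by (rule prob_space_layers_measure[OF prob_D sets_D])
  let ?J = "layers_measure D n m"
  let ?N = "\<lambda>E. real (copies_within F n E)"
  let ?U = "\<lambda>g :: nat \<Rightarrow> nat graph. ?N (\<Union>i\<in>{1..m}. edges (g i))"
  let ?S = "\<lambda>g :: nat \<Rightarrow> nat graph. \<Sum>i=1..m. ?N (edges (g i))"
  have e0: "num_edges F > 0" using two_connected_num_edges_ge[OF F] F(3) by linarith
  let ?K = "real (card (copies_on F n))"
  have NK: "\<bar>?N E\<bar> \<le> ?K" for E using copies_within_le[of F n E] by simp
  have iU: "integrable ?J ?U" by (rule integrable_layers_measure[OF prob_D sets_D, where B="?K"]) (use NK in simp)
  have iS: "integrable ?J ?S"
    by (intro Bochner_Integration.integrable_sum integrable_layers_measure[OF prob_D sets_D, where B="?K"]) (use NK in simp)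
  have ie: "integrable ?J (\<lambda>g. iexp (f g))" for f :: "(nat \<Rightarrow> nat graph) \<Rightarrow> real"
    by (rule integrable_layers_measure[OF prob_D sets_D, where B=1]) simp
  have 1: "char (distr (superposition_graph D n m) borel (\<lambda>G. (NF G - c) / s)) t = (\<integral>g. iexp (t * ((?U g - c) / s)) \<partial>?J)"
    unfolding superposition_graph_eq_distr[OF prob_D sets_D] char_def
    by (subst distr_distr, simp, simp add: measurable_layers_measure[OF prob_D sets_D], subst integral_distr)
       (auto simp: measurable_layers_measure[OF prob_D sets_D] NF_def num_copies_full_vertex_set[unfolded One_nat_def])
  have 2: "cmod ((\<integral>g. iexp (t * ((?U g - c) / s)) \<partial>?J) - (\<integral>g. iexp (t * ((?S g - c) / s)) \<partial>?J)) \<le> \<bar>t\<bar> / s * expected_overlap D F n m"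
  proof -
    have "(\<integral>g. iexp (t * ((?U g - c) / s)) \<partial>?J) - (\<integral>g. iexp (t * ((?S g - c) / s)) \<partial>?J)
        = (\<integral>g. iexp (t * ((?U g - c) / s)) - iexp (t * ((?S g - c) / s)) \<partial>?J)"
      by (rule Bochner_Integration.integral_diff[symmetric]) (rule ie)+
    also have "cmod \<dots> \<le> (\<integral>g. \<bar>t\<bar> / s * \<bar>?U g - ?S g\<bar> \<partial>?J)"
    proof (rule order_trans[OF integral_norm_bound integral_mono])
      show "cmod (iexp (t * ((?U g - c) / s)) - iexp (t * ((?S g - c) / s))) \<le> \<bar>t\<bar> / s * \<bar>?U g - ?S g\<bar>" for g
      proof -
        have "t * ((?U g - c) / s) - t * ((?S g - c) / s) = t / s * (?U g - ?S g)"
          using s by (simp add: field_simps)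
        then show ?thesis
          using norm_iexp_diff_le[of "t * ((?U g - c) / s)" "t * ((?S g - c) / s)"] s by (simp add: abs_mult)
      qed
    qed (intro integrable_norm Bochner_Integration.integrable_diff ie integrable_mult_right integrable_abs iU iS)+
    also have "\<dots> = \<bar>t\<bar> / s * (\<integral>g. \<bar>?U g - ?S g\<bar> \<partial>?J)" by (rule integral_mult_right_zero)
    also have "\<dots> \<le> \<bar>t\<bar> / s * expected_overlap D F n m"
      using s by (intro mult_left_mono copies_within_union_L1[OF prob_D sets_D F(1) e0]) auto
    finally show ?thesis .
  qed
  let ?\<psi> = "layer_expectation D n (\<lambda>G. iexp (t / s * ?N (edges G)))"
  let ?\<phi> = "char (distr (mixed_bernoulli_graph D) borel NF) (t / s)"
  have 3: "(\<integral>g. iexp (t * ((?S g - c) / s)) \<partial>?J) = iexp (- (t * c / s)) * ?\<psi> ^ m"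
  proof -
    have "(\<integral>g. iexp (t * ((?S g - c) / s)) \<partial>?J) = (\<integral>g. iexp (- (t * c / s)) * (\<Prod>i=1..m. iexp (t / s * ?N (edges (g i)))) \<partial>?J)"
    proof (intro Bochner_Integration.integral_cong refl)
      fix g :: "nat \<Rightarrow> nat graph"
      have "t * ((?S g - c) / s) = - (t * c / s) + (\<Sum>i=1..m. t / s * ?N (edges (g i)))"
        unfolding sum_distrib_left[symmetric] using s by (simp add: field_simps)
      then have "iexp (t * ((?S g - c) / s)) = exp (\<i> * complex_of_real (- (t * c / s)) + (\<Sum>i=1..m. \<i> * complex_of_real (t / s * ?N (edges (g i)))))"
        by (simp only: of_real_add of_real_sum distrib_left sum_distrib_left)
      then show "iexp (t * ((?S g - c) / s)) = iexp (- (t * c / s)) * (\<Prod>i=1..m. iexp (t / s * ?N (edges (g i))))"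
        by (simp only: exp_add exp_sum[OF finite_atLeastAtMost])
    qed
    also have "\<dots> = iexp (- (t * c / s)) * (\<integral>g. (\<Prod>i=1..m. iexp (t / s * ?N (edges (g i)))) \<partial>?J)"
      by (rule integral_mult_right_zero)
    also have "(\<integral>g. (\<Prod>i=1..m. iexp (t / s * ?N (edges (g i)))) \<partial>?J) = (\<Prod>i=1..m. ?\<psi>)"
      by (rule integral_prod_layers_measure[OF prob_D sets_D, where B=1 and f="\<lambda>i G. iexp (t / s * ?N (edges G))"]) simp
    finally show ?thesis by simp
  qed
  have "real_distribution (distr (mixed_bernoulli_graph D) borel NF)"
    by (rule prob_space.real_distribution_distr[OF prob_space_mixed_bernoulli_graph(1)[OF prob_D sets_D]])
       (simp add: measurable_mixed_bernoulli_graph)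
  then have \<phi>1: "cmod ?\<phi> \<le> 1" by (rule real_distribution.cmod_char_le_1)
  have \<psi>1: "cmod ?\<psi> \<le> 1"
  proof -
    have "cmod ?\<psi> \<le> (\<integral>w. 1 \<partial>D)"
      by (rule order_trans[OF integral_norm_bound integral_mono])
         (auto intro!: integrable_norm integrable_layer_expectation[OF prob_D sets_D, where B=1] norm_expectation_pmf_le)
    then show ?thesis by (simp add: D.prob_space)
  qed
  have 4: "cmod (iexp (- (t * c / s)) * ?\<psi> ^ m - iexp (- (t * c / s)) * ?\<phi> ^ m) \<le> real m * (2 * D.prob {w \<in> space D. n < fst w})"
  proof -
    have "cmod (iexp (- (t * c / s)) * ?\<psi> ^ m - iexp (- (t * c / s)) * ?\<phi> ^ m) = cmod (?\<psi> ^ m - ?\<phi> ^ m)"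
      unfolding right_diff_distrib[symmetric] norm_mult norm_exp_i_times by simp
    also have "\<dots> \<le> real m * cmod (?\<psi> - ?\<phi>)" by (rule norm_power_diff[OF \<psi>1 \<phi>1])
    also have "\<dots> \<le> real m * (2 * D.prob {w \<in> space D. n < fst w})"
      unfolding NF_def by (intro mult_left_mono layer_char_near F) auto
    finally show ?thesis .
  qed
  show ?thesis
    unfolding 1 using norm_diff_triangle_le[OF 2[unfolded 3] 4] .
qed

end


section \<open>The variance of the number of copies in a Bernoulli graph\<close>

text \<open>The edge fixes two of the v vertices, which leaves at most x^(v - 2) vertex
  sets.\<close>

lemma card_copies_containing_edge_le:
  assumes F: "simple_graph F" "num_verts F \<ge> 2" and e: "card e = 2"
  shows "card {H \<in> copies_on F x. e \<in> edges H} \<le> copies_in_complete F * x ^ (num_verts F - 2)"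
proof -
  let ?v = "num_verts F"
  let ?S = "{W. W \<subseteq> {1..x} \<and> card W = ?v \<and> e \<subseteq> W}"
  have "{H \<in> copies_on F x. e \<in> edges H} \<subseteq> (\<Union>W\<in>?S. {H. subgraph H (complete_on W) \<and> graph_iso F H})"
  proof
    fix H assume "H \<in> {H \<in> copies_on F x. e \<in> edges H}"
    then have H: "H \<in> copies_on F x" "e \<in> edges H" by auto
    note HD = copies_onD[OF H(1) F(1)]
    have "verts H \<in> ?S"
      using H HD by (auto simp: copies_on_def subgraph_def complete_on_def simple_graph_def all_pairs_def)
    moreover have "subgraph H (complete_on (verts H))"
      using HD(2) by (auto simp: subgraph_def complete_on_def simple_graph_def)
    ultimately show "H \<in> (\<Union>W\<in>?S. {H. subgraph H (complete_on W) \<and> graph_iso F H})"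
      using HD(1) by blast
  qed
  moreover have finS: "finite ?S" by (rule finite_subset[of _ "Pow {1..x}"]) auto
  moreover have fin: "finite W" if "W \<in> ?S" for W using that by (auto intro: finite_subset)
  ultimately have "card {H \<in> copies_on F x. e \<in> edges H}
      \<le> card (\<Union>W\<in>?S. {H. subgraph H (complete_on W) \<and> graph_iso F H})"
    by (intro card_mono finite_UN_I finite_complete_subgraphs)
  also have "\<dots> \<le> (\<Sum>W\<in>?S. card {H. subgraph H (complete_on W) \<and> graph_iso F H})"
    by (rule card_UN_le[OF finS])
  also have "\<dots> = (\<Sum>W\<in>?S. copies_in_complete F)"
  proof (intro sum.cong refl)
    fix W assume W: "W \<in> ?S"
    then have "card W = ?v" by blast
    then show "card {H. subgraph H (complete_on W) \<and> graph_iso F H} = copies_in_complete F"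
      using num_copies_complete[OF F(1) fin[OF W]] by (simp add: num_copies_def)
  qed
  also have "\<dots> = copies_in_complete F * card ?S" by simp
  also have "card ?S \<le> x ^ (?v - 2)"
  proof -
    have "card ?S \<le> (x - 2) choose (?v - 2)"
      using card_supersets_le[of "{1..x}" ?v e] e by simp
    also have "\<dots> \<le> x ^ (?v - 2)"
    proof (cases "?v - 2 \<le> x - 2")
      case True
      have "(x - 2) choose (?v - 2) \<le> (x - 2) ^ (?v - 2)" by (rule binomial_le_pow[OF True])
      also have "\<dots> \<le> x ^ (?v - 2)" by (intro power_mono) auto
      finally show ?thesis .
    qed (simp add: binomial_eq_0)
    finally show ?thesis .
  qed
  finally show ?thesis by simp
qed

lemma real_binomial_le_power: "real (n choose k) \<le> real n ^ k"
proof (cases "k \<le> n")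
  case True
  then show ?thesis using binomial_le_pow[OF True] by (metis of_nat_le_iff of_nat_power)
qed (simp add: binomial_eq_0)

lemma AE_bernoulli_graph_num_copies:
  "AE G in bernoulli_graph {1..x} q. num_copies F G = copies_within F x (edges G)"
proof (rule AE_pmfI)
  fix G assume "G \<in> set_pmf (bernoulli_graph {1..x} q)"
  then have "G \<in> {{1..x}} \<times> Pow (all_pairs {1..x})" using set_pmf_bernoulli_graph by blast
  then have "G = ({1..x}, edges G)" by (cases G) auto
  then show "num_copies F G = copies_within F x (edges G)" using num_copies_full_vertex_set by metis
qed

text \<open>Copies without a common edge are uncorrelated, and any other pair has covariance at most
  1. Choosing H, an edge of H and a second copy through this edge leaves v + (v - 2) free vertices,
  whence the exponent 2 v - 2.\<close>

lemma variance_copies_bernoulli_graph: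
  assumes F: "simple_graph F" "num_verts F \<ge> 2" and q: "0 \<le> q" "q \<le> 1"
  shows "measure_pmf.expectation (bernoulli_graph {1..x} q) (\<lambda>G. (real (copies_within F x (edges G)) - mean_copies F x q)\<^sup>2)
      \<le> (real (copies_in_complete F))\<^sup>2 * real (num_edges F) * real x ^ (2 * num_verts F - 2)"
proof -
  let ?p = "bernoulli_graph {1..x} q" and ?C = "copies_on F x" and ?e = "num_edges F" and ?v = "num_verts F"
  let ?a = "copies_in_complete F"
  let ?i = "\<lambda>H G. indicator {G. edges H \<subseteq> edges G} G :: real"
  have prob: "measure_pmf.prob ?p {G. A \<subseteq> edges G} = q ^ card A" if "A \<subseteq> all_pairs {1..x}" for A
    using that q by (intro prob_edges_subset_bernoulli_graph) auto
  have mean: "mean_copies F x q = (\<Sum>H\<in>?C. q ^ ?e)"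
    using card_copies_on[OF F(1), of x] by (simp add: mean_copies_def)
  have intb: "integrable (measure_pmf ?p) f" if "\<And>G. \<bar>f G\<bar> \<le> b" for f :: "nat graph \<Rightarrow> real" and b
    by (rule measure_pmf.integrable_const_bound[where B=b]) (use that in auto)
  have iH: "integrable (measure_pmf ?p) (?i H)" for H :: "nat graph" by (rule intb[of _ 1]) auto
  have iHK: "integrable (measure_pmf ?p) (\<lambda>G. ?i H G * ?i K G)" for H K :: "nat graph"
    by (rule intb[of _ 1]) (auto simp: indicator_def)
  have lin: "measure_pmf.expectation ?p (\<lambda>G. f G - c * g G - c * h G + d)
      = measure_pmf.expectation ?p f - c * measure_pmf.expectation ?p g - c * measure_pmf.expectation ?p h + d"
    if "integrable (measure_pmf ?p) f" "integrable (measure_pmf ?p) g" "integrable (measure_pmf ?p) h"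
    for f g h :: "nat graph \<Rightarrow> real" and c d
    using that by simp
  have cov: "measure_pmf.expectation ?p (\<lambda>G. (?i H G - q ^ ?e) * (?i K G - q ^ ?e)) \<le> (if edges H \<inter> edges K = {} then 0 else 1)"
    if H: "H \<in> ?C" and K: "K \<in> ?C" for H K
  proof -
    note HD = copies_onD[OF H F(1)] and KD = copies_onD[OF K F(1)]
    have "measure_pmf.expectation ?p (\<lambda>G. (?i H G - q ^ ?e) * (?i K G - q ^ ?e))
        = measure_pmf.expectation ?p (\<lambda>G. ?i H G * ?i K G - q ^ ?e * ?i H G - q ^ ?e * ?i K G + q ^ ?e * q ^ ?e)"
      by (simp add: algebra_simps)
    also have "\<dots> = measure_pmf.expectation ?p (\<lambda>G. ?i H G * ?i K G) - q ^ ?e * measure_pmf.expectation ?p (?i H)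
        - q ^ ?e * measure_pmf.expectation ?p (?i K) + q ^ ?e * q ^ ?e"
      by (rule lin[OF iHK iH iH])
    also have "(\<lambda>G. ?i H G * ?i K G) = indicator {G. edges H \<union> edges K \<subseteq> edges G}" by (auto simp: indicator_def)
    also have "measure_pmf.expectation ?p (indicator {G. edges H \<union> edges K \<subseteq> edges G}) = q ^ card (edges H \<union> edges K)"
      using prob[of "edges H \<union> edges K"] HD(4) KD(4) by simp
    also have "measure_pmf.expectation ?p (?i H) = q ^ ?e" using prob[OF HD(4)] HD(6) by simp
    also have "measure_pmf.expectation ?p (?i K) = q ^ ?e" using prob[OF KD(4)] KD(6) by simp
    finally have eq: "measure_pmf.expectation ?p (\<lambda>G. (?i H G - q ^ ?e) * (?i K G - q ^ ?e))
        = q ^ card (edges H \<union> edges K) - q ^ ?e * q ^ ?e" by simp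
    show ?thesis
    proof (cases "edges H \<inter> edges K = {}")
      case True
      then have "card (edges H \<union> edges K) = ?e + ?e"
        using HD KD by (simp add: card_Un_disjoint)
      then show ?thesis unfolding eq using True by (simp add: power_add)
    next
      case False
      have "q ^ card (edges H \<union> edges K) \<le> 1" "0 \<le> q ^ ?e * q ^ ?e" using q by (auto intro: power_le_one)
      then have "q ^ card (edges H \<union> edges K) - q ^ ?e * q ^ ?e \<le> 1" by linarith
      then show ?thesis unfolding eq using False by simp
    qed
  qed
  have "measure_pmf.expectation ?p (\<lambda>G. (real (copies_within F x (edges G)) - mean_copies F x q)\<^sup>2)
      = measure_pmf.expectation ?p (\<lambda>G. \<Sum>H\<in>?C. \<Sum>K\<in>?C. (?i H G - q ^ ?e) * (?i K G - q ^ ?e))"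
  proof (intro Bochner_Integration.integral_cong refl)
    fix G
    have "real (copies_within F x (edges G)) - mean_copies F x q = (\<Sum>H\<in>?C. ?i H G - q ^ ?e)"
      unfolding mean copies_within_eq_sum sum_subtractf by (simp add: indicator_def)
    then show "(real (copies_within F x (edges G)) - mean_copies F x q)\<^sup>2 = (\<Sum>H\<in>?C. \<Sum>K\<in>?C. (?i H G - q ^ ?e) * (?i K G - q ^ ?e))"
      by (simp add: power2_eq_square sum_product)
  qed
  also have "\<dots> = (\<Sum>H\<in>?C. \<Sum>K\<in>?C. measure_pmf.expectation ?p (\<lambda>G. (?i H G - q ^ ?e) * (?i K G - q ^ ?e)))"
  proof -
    have "integrable (measure_pmf ?p) (\<lambda>G. (?i H G - q ^ ?e) * (?i K G - q ^ ?e))" for H K :: "nat graph"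
    proof (rule intb[of _ 1])
      have "0 \<le> q ^ ?e" "q ^ ?e \<le> 1" using q by (auto intro: power_le_one)
      then show "\<bar>(?i H G - q ^ ?e) * (?i K G - q ^ ?e)\<bar> \<le> 1" for G
        unfolding abs_mult by (intro mult_le_one) (auto simp: indicator_def)
    qed
    then show ?thesis
      by (subst Bochner_Integration.integral_sum, intro Bochner_Integration.integrable_sum, assumption)
         (intro sum.cong refl Bochner_Integration.integral_sum)
  qed
  also have "\<dots> \<le> (\<Sum>H\<in>?C. \<Sum>K\<in>?C. if edges H \<inter> edges K = {} then 0 else 1)"
    by (intro sum_mono cov)
  also have "\<dots> \<le> (\<Sum>H\<in>?C. \<Sum>K\<in>?C. \<Sum>d\<in>edges H. if d \<in> edges K then 1 else 0)"
  proof (intro sum_mono)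
    fix H K assume H: "H \<in> ?C"
    note HD = copies_onD[OF H F(1)]
    show "(if edges H \<inter> edges K = {} then 0 else 1) \<le> (\<Sum>d\<in>edges H. if d \<in> edges K then 1 else 0 :: real)"
    proof (cases "edges H \<inter> edges K = {}")
      case False
      then have "card (edges H \<inter> edges K) \<ge> 1" using HD(3) by (simp add: Suc_le_eq card_gt_0_iff)
      then show ?thesis using HD(3) False by (simp add: sum.If_cases Int_def)
    qed (simp add: sum_nonneg)
  qed
  also have "\<dots> = (\<Sum>H\<in>?C. \<Sum>d\<in>edges H. \<Sum>K\<in>?C. if d \<in> edges K then 1 else 0)"
    by (intro sum.cong refl sum.swap)
  also have "\<dots> = (\<Sum>H\<in>?C. \<Sum>d\<in>edges H. real (card {K \<in> ?C. d \<in> edges K}))"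
    by (intro sum.cong refl) (simp add: sum.inter_filter[OF finite_copies_on, symmetric])
  also have "\<dots> \<le> (\<Sum>H\<in>?C. \<Sum>d\<in>edges H. real ?a * real x ^ (?v - 2))"
  proof (intro sum_mono)
    fix H d assume H: "H \<in> ?C" "d \<in> edges H"
    then have "card d = 2" using copies_onD(4)[OF H(1) F(1)] by (auto simp: all_pairs_def)
    from card_copies_containing_edge_le[OF F this, of x]
    have "real (card {K \<in> ?C. d \<in> edges K}) \<le> real (?a * x ^ (?v - 2))" by (rule of_nat_mono)
    then show "real (card {K \<in> ?C. d \<in> edges K}) \<le> real ?a * real x ^ (?v - 2)" by simp
  qed
  also have "\<dots> = (\<Sum>H\<in>?C. real ?e * (real ?a * real x ^ (?v - 2)))"
    using copies_onD(6)[OF _ F(1)] by (intro sum.cong refl) simp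
  also have "\<dots> = real ?a * real (x choose ?v) * (real ?e * (real ?a * real x ^ (?v - 2)))"
    using card_copies_on[OF F(1), of x] by simp
  also have "\<dots> \<le> real ?a * real x ^ ?v * (real ?e * (real ?a * real x ^ (?v - 2)))"
    by (intro mult_right_mono mult_left_mono real_binomial_le_power) auto
  also have "\<dots> = (real ?a)\<^sup>2 * real ?e * real x ^ (2 * ?v - 2)"
  proof -
    have "2 * ?v - 2 = ?v + (?v - 2)" using F(2) by simp
    then show ?thesis by (simp add: power_add power2_eq_square)
  qed
  finally show ?thesis .
qed

text \<open>The linear Taylor term has mean zero, so the difference is at most y, which is u^2 times
  the bound on the variance, and trivially at most 2. The power \<kappa> interpolates, as the
  minimum of 2 and y is at most 2 y^\<kappa>. This lowers the order of the moment of X that is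
  needed from 2 v - 2, where it may be infinite, to \<kappa> (2 v - 2).\<close>

lemma iexp_num_copies_minus_mean_le:
  assumes F: "simple_graph F" "num_verts F \<ge> 2" and q: "0 \<le> q" "q \<le> 1" and \<kappa>: "0 < \<kappa>" "\<kappa> \<le> 1"
  shows "cmod (measure_pmf.expectation (bernoulli_graph {1..x} q) (\<lambda>G. iexp (u * real (num_copies F G))) - iexp (u * mean_copies F x q))
      \<le> 2 * (u\<^sup>2 * ((real (copies_in_complete F))\<^sup>2 * real (num_edges F))) powr \<kappa> * real x powr (\<kappa> * real (2 * num_verts F - 2))"
proof -
  let ?p = "bernoulli_graph {1..x} q" and ?\<mu> = "mean_copies F x q"
  let ?N = "\<lambda>G :: nat graph. real (copies_within F x (edges G))"
  let ?B = "(real (copies_in_complete F))\<^sup>2 * real (num_edges F) * real x ^ (2 * num_verts F - 2)"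
  let ?K = "real (card (copies_on F x))"
  have NK: "?N G \<le> ?K" for G using copies_within_le[of F x "edges G"] by simp
  have iN: "integrable (measure_pmf ?p) ?N"
    by (rule measure_pmf.integrable_const_bound[where B="?K"]) (use NK in auto)
  have N2: "(?N G - ?\<mu>)\<^sup>2 \<le> (?K + \<bar>?\<mu>\<bar>)\<^sup>2" for G
    by (rule power2_le_iff_abs_le[THEN iffD2]) (use NK[of G] in auto)
  have iN2: "integrable (measure_pmf ?p) (\<lambda>G. (?N G - ?\<mu>)\<^sup>2)"
    by (rule measure_pmf.integrable_const_bound[where B="(?K + \<bar>?\<mu>\<bar>)\<^sup>2"]) (use N2 in auto)
  have ie: "integrable (measure_pmf ?p) (\<lambda>G. iexp (f G))" for f :: "nat graph \<Rightarrow> real"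
    by (rule measure_pmf.integrable_const_bound[where B=1]) auto
  have eN: "measure_pmf.expectation ?p ?N = ?\<mu>"
  proof -
    have "measure_pmf.expectation ?p ?N = measure_pmf.expectation ?p (\<lambda>G. real (num_copies F G))"
      by (intro integral_cong_AE) (use AE_bernoulli_graph_num_copies[where x=x and q=q and F=F] in \<open>auto elim: AE_mp\<close>)
    then show ?thesis using expectation_num_copies_bernoulli_graph[OF F(1) q] by simp
  qed
  have e1: "measure_pmf.expectation ?p (\<lambda>G. iexp (u * real (num_copies F G))) = measure_pmf.expectation ?p (\<lambda>G. iexp (u * ?N G))"
    by (intro integral_cong_AE) (use AE_bernoulli_graph_num_copies[where x=x and q=q and F=F] in \<open>auto elim: AE_mp\<close>)
  have le2: "cmod (measure_pmf.expectation ?p (\<lambda>G. iexp (u * ?N G)) - iexp (u * ?\<mu>)) \<le> 2"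
  proof -
    have "cmod (measure_pmf.expectation ?p (\<lambda>G. iexp (u * ?N G))) \<le> 1" by (rule norm_expectation_pmf_le) simp
    then show ?thesis using norm_triangle_ineq4[of "measure_pmf.expectation ?p (\<lambda>G. iexp (u * ?N G))" "iexp (u * ?\<mu>)"] by simp
  qed
  have leB: "cmod (measure_pmf.expectation ?p (\<lambda>G. iexp (u * ?N G)) - iexp (u * ?\<mu>)) \<le> u\<^sup>2 * ?B"
  proof -
    let ?r = "\<lambda>G. iexp (u * (?N G - ?\<mu>)) - 1 - \<i> * complex_of_real (u * (?N G - ?\<mu>))"
    have ic: "integrable (measure_pmf ?p) (\<lambda>G. complex_of_real (u * (?N G - ?\<mu>)))"
      by (intro integrable_of_real integrable_mult_right Bochner_Integration.integrable_diff iN) auto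
    have "measure_pmf.expectation ?p (\<lambda>G. complex_of_real (u * (?N G - ?\<mu>))) = complex_of_real (measure_pmf.expectation ?p (\<lambda>G. u * (?N G - ?\<mu>)))"
      by (rule integral_complex_of_real)
    also have "measure_pmf.expectation ?p (\<lambda>G. u * (?N G - ?\<mu>)) = 0" using iN eN by simp
    finally have z: "measure_pmf.expectation ?p (\<lambda>G. complex_of_real (u * (?N G - ?\<mu>))) = 0" by simp
    have "measure_pmf.expectation ?p ?r
        = measure_pmf.expectation ?p (\<lambda>G. iexp (u * (?N G - ?\<mu>))) - 1 - \<i> * measure_pmf.expectation ?p (\<lambda>G. complex_of_real (u * (?N G - ?\<mu>)))"
      using ie[of "\<lambda>G. u * (?N G - ?\<mu>)"] ic
      by (subst Bochner_Integration.integral_diff, (auto intro!: Bochner_Integration.integrable_diff)[2])+ simp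
    then have r: "measure_pmf.expectation ?p ?r = measure_pmf.expectation ?p (\<lambda>G. iexp (u * (?N G - ?\<mu>))) - 1"
      unfolding z by simp
    have ir: "integrable (measure_pmf ?p) ?r"
      using ie[of "\<lambda>G. u * (?N G - ?\<mu>)"] ic by (intro Bochner_Integration.integrable_diff integrable_mult_right) auto
    have "measure_pmf.expectation ?p (\<lambda>G. iexp (u * ?N G)) - iexp (u * ?\<mu>) = iexp (u * ?\<mu>) * measure_pmf.expectation ?p ?r"
    proof -
      have "measure_pmf.expectation ?p (\<lambda>G. iexp (u * ?N G)) = measure_pmf.expectation ?p (\<lambda>G. iexp (u * ?\<mu>) * iexp (u * (?N G - ?\<mu>)))"
        by (intro Bochner_Integration.integral_cong refl) (simp add: algebra_simps flip: exp_add)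
      also have "\<dots> = iexp (u * ?\<mu>) * measure_pmf.expectation ?p (\<lambda>G. iexp (u * (?N G - ?\<mu>)))"
        by (rule integral_mult_right_zero)
      finally show ?thesis unfolding r by (simp add: algebra_simps)
    qed
    then have "cmod (measure_pmf.expectation ?p (\<lambda>G. iexp (u * ?N G)) - iexp (u * ?\<mu>)) = cmod (measure_pmf.expectation ?p ?r)"
      by (simp add: norm_mult)
    also have "\<dots> \<le> measure_pmf.expectation ?p (\<lambda>G. u\<^sup>2 * (?N G - ?\<mu>)\<^sup>2)"
    proof (rule order_trans[OF integral_norm_bound integral_mono[OF integrable_norm[OF ir] integrable_mult_right[OF iN2]]])
      show "cmod (?r G) \<le> u\<^sup>2 * (?N G - ?\<mu>)\<^sup>2" for G
      proof -
        have "cmod (?r G) \<le> \<bar>u * (?N G - ?\<mu>)\<bar>\<^sup>2 / 2"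
          using iexp_approx1[of "u * (?N G - ?\<mu>)" 1] by (simp add: numeral_2_eq_2 diff_diff_eq)
        also have "\<dots> \<le> u\<^sup>2 * (?N G - ?\<mu>)\<^sup>2" by (simp add: power_mult_distrib abs_mult)
        finally show ?thesis .
      qed
    qed
    also have "\<dots> = u\<^sup>2 * measure_pmf.expectation ?p (\<lambda>G. (?N G - ?\<mu>)\<^sup>2)" by (rule integral_mult_right_zero)
    also have "\<dots> \<le> u\<^sup>2 * ?B" by (intro mult_left_mono variance_copies_bernoulli_graph F q) auto
    finally show ?thesis .
  qed
  have "cmod (measure_pmf.expectation ?p (\<lambda>G. iexp (u * ?N G)) - iexp (u * ?\<mu>)) \<le> 2 * (u\<^sup>2 * ?B) powr \<kappa>"
  proof (cases "u\<^sup>2 * ?B \<ge> 1")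
    case True
    then have "1 \<le> (u\<^sup>2 * ?B) powr \<kappa>" using \<kappa> by (intro ge_one_powr_ge_zero) auto
    then show ?thesis using le2 by linarith
  next
    case False
    have nn: "0 \<le> u\<^sup>2 * ?B" by simp
    have "u\<^sup>2 * ?B \<le> (u\<^sup>2 * ?B) powr \<kappa>"
    proof (cases "u\<^sup>2 * ?B = 0")
      case False
      then have "u\<^sup>2 * ?B = (u\<^sup>2 * ?B) powr 1" using nn by simp
      also have "\<dots> \<le> (u\<^sup>2 * ?B) powr \<kappa>" using \<open>\<not> u\<^sup>2 * ?B \<ge> 1\<close> nn False \<kappa> by (intro powr_mono') auto
      finally show ?thesis .
    qed (simp only: powr_0 order_refl powr_ge_zero)
    then show ?thesis using leB powr_ge_zero[of "u\<^sup>2 * ?B" \<kappa>] by linarith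
  qed
  also have "(u\<^sup>2 * ?B) powr \<kappa> = (u\<^sup>2 * ((real (copies_in_complete F))\<^sup>2 * real (num_edges F))) powr \<kappa> * (real x ^ (2 * num_verts F - 2)) powr \<kappa>"
    by (simp add: powr_mult flip: mult.assoc)
  also have "(real x ^ (2 * num_verts F - 2)) powr \<kappa> = real x powr (\<kappa> * real (2 * num_verts F - 2))"
  proof (cases "x = 0")
    case False
    then show ?thesis by (simp add: powr_powr mult.commute flip: powr_realpow)
  qed (use F(2) \<kappa> in \<open>simp add: zero_power\<close>)
  finally show ?thesis unfolding e1 by (simp add: mult.assoc)
qed


section \<open>Moments of the layer sizes and the limit of the characteristic functions\<close>

context
  fixes D :: "(nat \<times> real) measure"
  assumes prob_D: "prob_space D" and sets_D: "sets D = sets (count_space UNIV \<Otimes>\<^sub>M borel)"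
begin

interpretation D: prob_space D by (rule prob_D)

text \<open>The ratio is at most 1, so its exponent may be lowered from k to \<kappa> before the
  truncation at n is dropped. This gives decay of order \<kappa> even when X has no moment of order
  k.\<close>

lemma vertex_moment_le:
  assumes \<kappa>: "0 < \<kappa>" "\<kappa> \<le> real k" and int: "integrable D (\<lambda>w. real (fst w) powr \<kappa>)" and n: "n > 0"
  shows "vertex_moment D n k \<le> (\<integral>w. real (fst w) powr \<kappa> \<partial>D) * real n powr (- \<kappa>)"
proof -
  have "vertex_moment D n k \<le> (\<integral>w. real (fst w) powr \<kappa> * real n powr (- \<kappa>) \<partial>D)"
    unfolding vertex_moment_def[OF prob_D sets_D]
  proof (rule integral_mono[OF integrable_vertex_ratio[OF prob_D sets_D] integrable_mult_left[OF int]])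
    fix w :: "nat \<times> real"
    let ?r = "real (min (fst w) n) / real n"
    show "?r ^ k \<le> real (fst w) powr \<kappa> * real n powr (- \<kappa>)"
    proof (cases "fst w = 0")
      case True
      then show ?thesis using \<kappa> by (auto simp: power_0_left)
    next
      case False
      then have r: "?r > 0" using n by simp
      have "?r ^ k = ?r powr (real k)" using r by (simp add: powr_realpow)
      also have "\<dots> \<le> ?r powr \<kappa>"
        using \<kappa> r vertex_ratio_bounds(2)[of "fst w" n] by (intro powr_mono') auto
      also have "\<dots> \<le> (real (fst w) / real n) powr \<kappa>"
        using \<kappa> r n by (intro powr_mono2 divide_right_mono) auto
      finally show ?thesis using n by (simp add: powr_divide powr_minus field_simps)
    qed
  qed
  then show ?thesis by simp
qed

lemma vertex_moment_le_low:
  assumes \<kappa>: "real k \<le> \<kappa>" and int: "integrable D (\<lambda>w. real (fst w) powr \<kappa>)" and n: "n > 0"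
  shows "vertex_moment D n k \<le> (1 + (\<integral>w. real (fst w) powr \<kappa> \<partial>D)) * real n powr (- real k)"
proof -
  have "vertex_moment D n k \<le> (\<integral>w. (1 + real (fst w) powr \<kappa>) * real n powr (- real k) \<partial>D)"
    unfolding vertex_moment_def[OF prob_D sets_D]
  proof (rule integral_mono[OF integrable_vertex_ratio[OF prob_D sets_D]])
    show "integrable D (\<lambda>w. (1 + real (fst w) powr \<kappa>) * real n powr (- real k))"
      using int by (intro integrable_mult_left Bochner_Integration.integrable_add) auto
    fix w :: "nat \<times> real"
    have "(real (min (fst w) n) / real n) ^ k \<le> (real (fst w) / real n) ^ k"
      using n by (intro power_mono divide_right_mono) auto
    also have "\<dots> = real (fst w) ^ k * real n powr (- real k)"
      using n by (simp add: power_divide powr_minus powr_realpow field_simps)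
    also have "\<dots> \<le> (1 + real (fst w) powr \<kappa>) * real n powr (- real k)"
    proof (rule mult_right_mono)
      \<comment> \<open>For k = 0 the left side is 1 even at size 0, where
        \<open>real (fst w) powr \<kappa>\<close> is 0; hence the summand 1.\<close>
      show "real (fst w) ^ k \<le> 1 + real (fst w) powr \<kappa>"
      proof (cases "fst w = 0")
        case False
        then have "real (fst w) ^ k = real (fst w) powr real k" by (simp add: powr_realpow)
        also have "\<dots> \<le> real (fst w) powr \<kappa>" using False \<kappa> by (intro powr_mono) auto
        finally show ?thesis by simp
      qed (auto simp: power_0_left)
    qed simp
    finally show "(real (min (fst w) n) / real n) ^ k \<le> (1 + real (fst w) powr \<kappa>) * real n powr (- real k)" .
  qed
  also have "\<dots> = (1 + (\<integral>w. real (fst w) powr \<kappa> \<partial>D)) * real n powr (- real k)"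
    using int by (simp add: D.prob_space)
  finally show ?thesis .
qed

lemma prob_greater_le_moment:
  assumes \<kappa>: "0 < \<kappa>" and int: "integrable D (\<lambda>w. real (fst w) powr \<kappa>)" and n: "n > 0"
  shows "D.prob {w \<in> space D. n < fst w} \<le> (\<integral>w. real (fst w) powr \<kappa> \<partial>D) * real n powr (- \<kappa>)"
proof -
  have S: "{w \<in> space D. n < fst w} \<in> sets D"
    using borel_measurable_less[OF borel_measurable_const measurable_fst_D[OF prob_D sets_D, of real], of "real n"] by simp
  have "D.prob {w \<in> space D. n < fst w} = (\<integral>w. indicator {w \<in> space D. n < fst w} w \<partial>D)" using S by simp
  also have "\<dots> \<le> (\<integral>w. real (fst w) powr \<kappa> * real n powr (- \<kappa>) \<partial>D)"
  proof (rule integral_mono[OF _ integrable_mult_left[OF int]])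
    show "integrable D (indicat_real {w \<in> space D. n < fst w})"
      using S by (intro integrable_real_indicator) (auto simp: D.emeasure_eq_measure)
    fix w :: "nat \<times> real"
    show "indicat_real {w \<in> space D. n < fst w} w \<le> real (fst w) powr \<kappa> * real n powr (- \<kappa>)"
    proof (cases "n < fst w")
      case True
      then have "1 \<le> (real (fst w) / real n) powr \<kappa>" using n \<kappa> by (intro ge_one_powr_ge_zero) auto
      then show ?thesis using n by (simp add: powr_divide powr_minus field_simps indicator_def)
    qed simp
  qed
  finally show ?thesis by simp
qed

text \<open>Missing moments of X can only affect the moment of order v of the ratio, since \<kappa>
  \<ge> v - 1 covers all lower orders; its loss \<theta> = v - \<kappa> \<le> 1 is passed on to the
  overlap.\<close>

lemma expected_overlap_sequence:
  fixes F :: "'v graph" and n m :: "nat \<Rightarrow> nat"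
  assumes F: "simple_graph F" "two_connected F" "num_verts F \<ge> 3"
    and nm: "filterlim n at_top sequentially" "(\<lambda>k. real (m k) / real (n k)) \<longlonglongrightarrow> \<nu>"
    and \<kappa>: "real (num_verts F) - 1 \<le> \<kappa>" "\<kappa> \<le> real (num_verts F)"
    and int: "integrable D (\<lambda>w. real (fst w) powr \<kappa>)"
  shows "\<exists>K. \<forall>\<^sub>F k in sequentially. expected_overlap D F (n k) (m k) \<le> K * real (n k) powr (real (num_verts F) - \<kappa>)"
proof -
  let ?v = "num_verts F"
  define \<theta> where "\<theta> = real ?v - \<kappa>"
  define C where "C = 1 + (\<integral>w. real (fst w) powr \<kappa> \<partial>D)"
  have C: "C \<ge> 1" unfolding C_def by (simp add: Bochner_Integration.integral_nonneg)
  have \<theta>: "0 \<le> \<theta>" "\<theta> \<le> 1" using \<kappa> by (auto simp: \<theta>_def)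
  have "\<forall>\<^sub>F k in sequentially. real (m k) / real (n k) < \<nu> + 1" by (rule order_tendstoD(2)[OF nm(2)]) simp
  moreover have "\<forall>\<^sub>F k in sequentially. n k > 0" by (rule eventually_compose_filterlim[OF eventually_gt_at_top nm(1)])
  ultimately have "\<forall>\<^sub>F k in sequentially. expected_overlap D F (n k) (m k) \<le> real (copies_in_complete F) * (((\<nu> + 1) * C)\<^sup>2 + C ^ num_edges F * (real (num_edges F) + (\<nu> + 1)) ^ num_edges F) * real (n k) powr \<theta>"
  proof eventually_elim
    case (elim k)
    show ?case
    proof (rule expected_overlap_le[OF prob_D sets_D F elim(2) _ \<theta> C])
      show "real (m k) \<le> (\<nu> + 1) * real (n k)" using elim by (simp add: field_simps)
      show "vertex_moment D (n k) j \<le> C * real (n k) powr (- real j)" if "j < ?v" for j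
        unfolding C_def using that \<kappa> by (intro vertex_moment_le_low int elim(2)) auto
      have "vertex_moment D (n k) ?v \<le> (\<integral>w. real (fst w) powr \<kappa> \<partial>D) * real (n k) powr (- \<kappa>)"
        using \<kappa> F(3) by (intro vertex_moment_le int elim(2)) auto
      also have "\<dots> \<le> C * real (n k) powr (- \<kappa>)" by (intro mult_right_mono) (auto simp: C_def)
      finally show "vertex_moment D (n k) ?v \<le> C * real (n k) powr (\<theta> - real ?v)" by (simp add: \<theta>_def)
    qed
  qed
  then show ?thesis unfolding \<theta>_def by blast
qed

text \<open>As \<kappa> \<ge> v - 1 > 1, Markov's inequality gives m P(X > n) = O(n^(1 - \<kappa>)),
  which vanishes. What remains to be asked of the normalization s is that it outgrows the overlap
  n^(v - \<kappa>).\<close>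

theorem char_superposition_limit:
  fixes F :: "'v graph" and n m :: "nat \<Rightarrow> nat" and s c :: "nat \<Rightarrow> real"
  defines "NF \<equiv> (\<lambda>G :: nat graph. real (num_copies F G))"
  assumes F: "simple_graph F" "two_connected F" "num_verts F \<ge> 3"
    and nm: "filterlim n at_top sequentially" "(\<lambda>k. real (m k) / real (n k)) \<longlonglongrightarrow> \<nu>"
    and \<kappa>: "real (num_verts F) - 1 \<le> \<kappa>" "\<kappa> \<le> real (num_verts F)"
    and int: "integrable D (\<lambda>w. real (fst w) powr \<kappa>)"
    and s: "\<forall>\<^sub>F k in sequentially. s k > 0" "(\<lambda>k. real (n k) powr (real (num_verts F) - \<kappa>) / s k) \<longlonglongrightarrow> 0"
  shows "(\<lambda>k. char (distr (superposition_graph D (n k) (m k)) borel (\<lambda>G. (NF G - c k) / s k)) t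
        - iexp (- (t * c k / s k)) * char (distr (mixed_bernoulli_graph D) borel NF) (t / s k) ^ m k) \<longlonglongrightarrow> 0"
proof -
  let ?L = "\<lambda>k. expected_overlap D F (n k) (m k)"
  let ?p = "\<lambda>k. D.prob {w \<in> space D. n k < fst w}"
  obtain K where K: "\<forall>\<^sub>F k in sequentially. ?L k \<le> K * real (n k) powr (real (num_verts F) - \<kappa>)"
    using expected_overlap_sequence[OF F nm \<kappa> int] by blast
  define E where "E = (\<integral>w. real (fst w) powr \<kappa> \<partial>D)"
  have E: "E \<ge> 0" by (simp add: E_def)
  have npos: "\<forall>\<^sub>F k in sequentially. n k > 0" by (rule eventually_compose_filterlim[OF eventually_gt_at_top nm(1)])
  have "(\<lambda>k. real (m k) / real (n k) * (2 * E * real (n k) powr (1 - \<kappa>))) \<longlonglongrightarrow> \<nu> * (2 * E * 0)"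
  proof (intro tendsto_mult nm(2) tendsto_const)
    have "filterlim (\<lambda>k. real (n k)) at_top sequentially"
      by (rule filterlim_compose[OF filterlim_real_sequentially nm(1)])
    then show "(\<lambda>k. real (n k) powr (1 - \<kappa>)) \<longlonglongrightarrow> 0"
      using \<kappa> F(3) by (intro tendsto_neg_powr) auto
  qed
  then have lim2: "(\<lambda>k. real (m k) / real (n k) * (2 * E * real (n k) powr (1 - \<kappa>))) \<longlonglongrightarrow> 0" by simp
  have "(\<lambda>k. \<bar>t\<bar> * K * (real (n k) powr (real (num_verts F) - \<kappa>) / s k)
      + real (m k) / real (n k) * (2 * E * real (n k) powr (1 - \<kappa>))) \<longlonglongrightarrow> 0"
    using tendsto_add[OF tendsto_mult_right_zero[OF s(2), of "\<bar>t\<bar> * K"] lim2] by simp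
  then show ?thesis
  proof (rule Lim_null_comparison[rotated])
    show "\<forall>\<^sub>F k in sequentially. norm (char (distr (superposition_graph D (n k) (m k)) borel (\<lambda>G. (NF G - c k) / s k)) t
        - iexp (- (t * c k / s k)) * char (distr (mixed_bernoulli_graph D) borel NF) (t / s k) ^ m k)
       \<le> \<bar>t\<bar> * K * (real (n k) powr (real (num_verts F) - \<kappa>) / s k) + real (m k) / real (n k) * (2 * E * real (n k) powr (1 - \<kappa>))"
      using K s(1) npos
    proof eventually_elim
      case (elim k)
      have "norm (char (distr (superposition_graph D (n k) (m k)) borel (\<lambda>G. (NF G - c k) / s k)) t
        - iexp (- (t * c k / s k)) * char (distr (mixed_bernoulli_graph D) borel NF) (t / s k) ^ m k)
          \<le> \<bar>t\<bar> / s k * ?L k + real (m k) * (2 * ?p k)"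
        unfolding NF_def by (rule char_superposition_near[OF prob_D sets_D F elim(2)])
      also have "\<dots> \<le> \<bar>t\<bar> / s k * (K * real (n k) powr (real (num_verts F) - \<kappa>)) + real (m k) * (2 * (E * real (n k) powr (- \<kappa>)))"
        unfolding E_def using elim \<kappa> F(3)
        by (intro add_mono mult_left_mono prob_greater_le_moment int) auto
      also have "\<dots> = \<bar>t\<bar> * K * (real (n k) powr (real (num_verts F) - \<kappa>) / s k) + real (m k) / real (n k) * (2 * E * real (n k) powr (1 - \<kappa>))"
        using elim(3) by (simp add: powr_diff powr_minus field_simps)
      finally show ?case .
    qed
  qed
qed

end

section \<open>Transfer of weak convergence\<close>

lemma weak_conv_m_if_char_close:
  assumes rd: "\<And>k. real_distribution (\<mu> k)" "\<And>k. real_distribution (\<rho> k)" "real_distribution L"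
    and w: "weak_conv_m \<rho> L" and close: "\<And>t. (\<lambda>k. char (\<mu> k) t - char (\<rho> k) t) \<longlonglongrightarrow> 0"
  shows "weak_conv_m \<mu> L"
proof (rule levy_continuity[OF rd(1) rd(3)])
  fix t
  have "(\<lambda>k. (char (\<mu> k) t - char (\<rho> k) t) + char (\<rho> k) t) \<longlonglongrightarrow> 0 + char L t"
    by (intro tendsto_add close levy_continuity1 rd w)
  then show "(\<lambda>k. char (\<mu> k) t) \<longlonglongrightarrow> char L t" by simp
qed

lemma weak_conv_m_compose:
  assumes "weak_conv_m \<mu> L" and "filterlim f sequentially sequentially"
  shows "weak_conv_m (\<lambda>k. \<mu> (f k)) L"
  using assms unfolding weak_conv_m_def weak_conv_def by (auto intro: filterlim_compose)


section \<open>The tail of the conditional mean\<close>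

lemma real_binomial_eq_prod: "real (x choose v) = (\<Prod>i<v. real x - real i) / fact v"
  by (simp add: binomial_gbinomial gbinomial_prod_rev lessThan_atLeast0)

lemma fact_binomial_le_power: "real (x choose v) * fact v \<le> real x ^ v"
  using binomial_fact_pow[of x v] by (metis of_nat_fact of_nat_le_iff of_nat_mult of_nat_power)

lemma power_le_fact_binomial:
  assumes "v \<le> x"
  shows "(real x - real v) ^ v \<le> real (x choose v) * fact v"
proof -
  have "(real x - real v) ^ v = (\<Prod>i<v. real x - real v)" by simp
  also have "\<dots> \<le> (\<Prod>i<v. real x - real i)" using assms by (intro prod_mono) auto
  finally show ?thesis by (simp add: real_binomial_eq_prod)
qed

lemma copies_in_complete_pos:
  assumes "simple_graph F"
  shows "copies_in_complete F > 0"
proof -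
  have fin: "finite (verts F)" using assms by (simp add: simple_graph_def)
  obtain f where f: "bij_betw f (verts F) {1..num_verts F}"
    using finite_same_card_bij[OF fin, of "{1..num_verts F}"] by auto
  let ?H = "({1..num_verts F}, (\<lambda>e. f ` e) ` edges F)"
  have "f ` e \<in> all_pairs {1..num_verts F}" if "e \<in> edges F" for e
  proof -
    have e: "e \<subseteq> verts F" "card e = 2" using assms that by (auto simp: simple_graph_def all_pairs_def)
    have "f ` e \<subseteq> {1..num_verts F}" using e(1) bij_betw_imp_surj_on[OF f] by blast
    moreover have "card (f ` e) = 2"
      using e inj_on_subset[OF bij_betw_imp_inj_on[OF f] e(1)] by (simp add: card_image)
    ultimately show ?thesis by (simp add: all_pairs_def)
  qed
  then have "?H \<in> {H. subgraph H (complete_on {1..num_verts F}) \<and> graph_iso F H}"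
    using f by (auto simp: subgraph_def simple_graph_def complete_on_def graph_iso_def intro!: exI[of _ f])
  then show ?thesis
    unfolding copies_in_complete_def num_copies_def
    using finite_complete_subgraphs[of "{1..num_verts F}"] by (auto simp: card_gt_0_iff)
qed

text \<open>For x \<ge> v the number v! (x choose v) lies between (x - v)^v and x^v. So the event is
  caught between X > z + v and X > z, where z is the v-th root of y v! / c, and the shift by v does
  not change the asymptotics.\<close>

lemma (in prob_space) scaled_binomial_tail:
  fixes X :: "'a \<Rightarrow> nat" and b \<gamma> c :: real
  assumes X [measurable]: "X \<in> measurable M (count_space UNIV)" and v: "v > 0" and c: "c > 0" and \<gamma>: "\<gamma> > 0"
    and tail: "((\<lambda>t. prob {\<omega> \<in> space M. real (X \<omega>) > t} * t powr \<gamma>) \<longlongrightarrow> b) at_top"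
  shows "((\<lambda>y. prob {\<omega> \<in> space M. c * real (X \<omega> choose v) > y} * y powr (\<gamma> / real v))
      \<longlongrightarrow> b * (c / fact v) powr (\<gamma> / real v)) at_top"
proof -
  let ?P = "\<lambda>t. prob {\<omega> \<in> space M. real (X \<omega>) > t}"
  let ?R = "\<lambda>y. prob {\<omega> \<in> space M. c * real (X \<omega> choose v) > y}"
  define \<alpha> where "\<alpha> = \<gamma> / real v"
  define k where "k = c / fact v"
  have k: "k > 0" using c by (simp add: k_def)
  define z where "z y = (y / k) powr (1 / real v)" for y
  have zv: "z y ^ v = y / k" "z y > 0" if "y > 0" for y
    using that k v by (auto simp: z_def powr_powr powr_realpow[symmetric])
  have zg: "y powr \<alpha> = z y powr \<gamma> * k powr \<alpha>" if "y > 0" for y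
    using that k v by (simp add: z_def \<alpha>_def powr_powr powr_divide)
  have ztop: "filterlim z at_top at_top"
  proof -
    have "filterlim (\<lambda>y. inverse k * y) at_top at_top"
      using k by (intro filterlim_tendsto_pos_mult_at_top[OF tendsto_const]) (auto simp: filterlim_ident)
    from filterlim_compose[OF filterlim_powr_at_top this, of "1 / real v"] v
    show ?thesis by (simp add: z_def[abs_def] divide_inverse mult.commute)
  qed
  have meas: "{\<omega> \<in> space M. real (X \<omega>) > t} \<in> events" "{\<omega> \<in> space M. c * real (X \<omega> choose v) > y} \<in> events" for t y
    by measurable
  have upper: "?R y \<le> ?P (z y)" if y: "y > 0" for y
  proof (rule finite_measure_mono[OF subsetI meas(1)])
    fix \<omega> assume \<omega>: "\<omega> \<in> {\<omega> \<in> space M. c * real (X \<omega> choose v) > y}"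
    then have "y < c * real (X \<omega> choose v)" by simp
    also have "\<dots> = k * (real (X \<omega> choose v) * fact v)" by (simp add: k_def)
    also have "\<dots> \<le> k * real (X \<omega>) ^ v" using k by (intro mult_left_mono fact_binomial_le_power) auto
    also have "y = k * z y ^ v" using zv(1)[OF y] k by simp
    finally have "z y ^ v < real (X \<omega>) ^ v" using k by simp
    then have "z y < real (X \<omega>)" by (rule power_less_imp_less_base) simp
    then show "\<omega> \<in> {\<omega> \<in> space M. real (X \<omega>) > z y}" using \<omega> by simp
  qed
  have lower: "?P (z y + real v) \<le> ?R y" if y: "y > 0" for y
  proof (rule finite_measure_mono[OF subsetI meas(2)])
    fix \<omega> assume \<omega>: "\<omega> \<in> {\<omega> \<in> space M. real (X \<omega>) > z y + real v}"
    then have x: "z y < real (X \<omega>) - real v" by simp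
    then have vx: "v \<le> X \<omega>" using zv(2)[OF y] by linarith
    have "y = k * z y ^ v" using zv(1)[OF y] k by simp
    also have "\<dots> < k * (real (X \<omega>) - real v) ^ v"
      using k x zv(2)[OF y] v by (intro mult_strict_left_mono power_strict_mono) auto
    also have "\<dots> \<le> k * (real (X \<omega> choose v) * fact v)"
      using k by (intro mult_left_mono power_le_fact_binomial vx) auto
    also have "\<dots> = c * real (X \<omega> choose v)" by (simp add: k_def)
    finally show "\<omega> \<in> {\<omega> \<in> space M. c * real (X \<omega> choose v) > y}" using \<omega> by simp
  qed
  have U: "((\<lambda>y. ?P (z y) * z y powr \<gamma> * k powr \<alpha>) \<longlongrightarrow> b * k powr \<alpha>) at_top"
    by (intro tendsto_mult_right filterlim_compose[OF tail ztop])
  \<comment> \<open>The factor (z / (z + v))^\<gamma> tends to 1 and trades the power of z + v for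
    that of z.\<close>
  have L: "((\<lambda>y. ?P (z y + real v) * (z y + real v) powr \<gamma> * ((z y / (z y + real v)) powr \<gamma>) * k powr \<alpha>) \<longlongrightarrow> b * 1 powr \<gamma> * k powr \<alpha>) at_top"
  proof (intro tendsto_mult_right tendsto_mult tendsto_powr tendsto_const)
    have zt: "filterlim (\<lambda>y. z y + real v) at_top at_top"
      using filterlim_tendsto_add_at_top[OF tendsto_const ztop, of "real v"] by (simp add: add.commute)
    show "((\<lambda>y. ?P (z y + real v) * (z y + real v) powr \<gamma>) \<longlongrightarrow> b) at_top"
      by (rule filterlim_compose[OF tail zt])
    have "((\<lambda>y. 1 - real v / (z y + real v)) \<longlongrightarrow> 1 - 0) at_top"
      by (intro tendsto_diff tendsto_const tendsto_divide_0[OF tendsto_const] filterlim_at_top_imp_at_infinity zt)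
    then have "((\<lambda>y. 1 - real v / (z y + real v)) \<longlongrightarrow> 1) at_top" by simp
    then show "((\<lambda>y. z y / (z y + real v)) \<longlongrightarrow> 1) at_top"
    proof (rule Lim_transform_eventually)
      show "\<forall>\<^sub>F y in at_top. 1 - real v / (z y + real v) = z y / (z y + real v)"
        using eventually_gt_at_top[of 0]
      proof eventually_elim
        case (elim y)
        have "z y + real v > 0" using zv(2)[OF elim] by simp
        then show ?case by (simp add: field_simps)
      qed
    qed
  qed simp
  show ?thesis
    unfolding \<alpha>_def[symmetric] k_def[symmetric]
  proof (rule tendsto_sandwich[OF _ _ L[simplified] U])
    show "\<forall>\<^sub>F y in at_top. ?R y * y powr \<alpha> \<le> ?P (z y) * z y powr \<gamma> * k powr \<alpha>"
      using eventually_gt_at_top[of 0]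
      by eventually_elim (use upper in \<open>auto simp: zg mult.assoc intro!: mult_right_mono\<close>)
    show "\<forall>\<^sub>F y in at_top. ?P (z y + real v) * (z y + real v) powr \<gamma> * ((z y / (z y + real v)) powr \<gamma>) * k powr \<alpha> \<le> ?R y * y powr \<alpha>"
      using eventually_gt_at_top[of 0]
    proof eventually_elim
      case (elim y)
      have zp: "z y > 0" by (rule zv(2)[OF elim])
      have "(z y + real v) powr \<gamma> * ((z y / (z y + real v)) powr \<gamma>) = z y powr \<gamma>"
        using zp by (simp add: powr_divide)
      then have "?P (z y + real v) * (z y + real v) powr \<gamma> * ((z y / (z y + real v)) powr \<gamma>) * k powr \<alpha>
          = ?P (z y + real v) * (z y powr \<gamma> * k powr \<alpha>)" by (simp add: mult.assoc)
      also have "\<dots> \<le> ?R y * (z y powr \<gamma> * k powr \<alpha>)" by (intro mult_right_mono lower elim) auto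
      finally show ?case by (simp add: zg[OF elim])
    qed
  qed
qed

text \<open>Given Q = q > 0, the tail at t is that of the scaled binomial coefficient at t / q^e,
  hence asymptotically q^(\<alpha> e) times the tail at t. Averaging over q is justified by
  dominated convergence: as q \<le> 1, the bound C t^(-\<alpha>) on the tail holds for all q at
  once.\<close>

lemma (in prob_space) power_tail_law_mean_copies:
  fixes X :: "'a \<Rightarrow> nat" and Q :: "'a \<Rightarrow> real" and F :: "'v graph"
  assumes X [measurable]: "X \<in> measurable M (count_space UNIV)"
    and Q [measurable]: "Q \<in> borel_measurable M" and Q01: "\<And>\<omega>. \<omega> \<in> space M \<Longrightarrow> 0 \<le> Q \<omega> \<and> Q \<omega> \<le> 1"
    and indep: "indep_var borel (\<lambda>\<omega>. real (X \<omega>)) borel Q"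
    and F: "simple_graph F" "num_verts F > 0" "num_edges F > 0" and \<gamma>: "\<gamma> > 0"
    and tail: "((\<lambda>t. prob {\<omega> \<in> space M. real (X \<omega>) > t} * t powr \<gamma>) \<longlongrightarrow> b) at_top"
  shows "power_tail_law (\<gamma> / real (num_verts F))
      (b * (real (copies_in_complete F) / fact (num_verts F)) powr (\<gamma> / real (num_verts F))
         * expectation (\<lambda>\<omega>. Q \<omega> powr (\<gamma> * real (num_edges F) / real (num_verts F))))
      (distr M borel (\<lambda>\<omega>. mean_copies F (X \<omega>) (Q \<omega>)))"
proof -
  let ?v = "num_verts F" and ?e = "num_edges F" and ?c = "real (copies_in_complete F)"
  let ?N = "\<lambda>\<omega>. mean_copies F (X \<omega>) (Q \<omega>)"
  define \<alpha> where "\<alpha> = \<gamma> / real ?v"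
  define b' where "b' = b * (?c / fact ?v) powr \<alpha>"
  have \<alpha>: "\<alpha> > 0" using \<gamma> F by (simp add: \<alpha>_def)
  have c: "?c > 0" using copies_in_complete_pos[OF F(1)] by simp
  have Nmeas [measurable]: "?N \<in> borel_measurable M" unfolding mean_copies_def by measurable
  define R where "R y = prob {\<omega> \<in> space M. ?c * real (X \<omega> choose ?v) > y}" for y
  have R: "((\<lambda>y. R y * y powr \<alpha>) \<longlongrightarrow> b') at_top"
    unfolding R_def b'_def \<alpha>_def by (rule scaled_binomial_tail[OF X F(2) c \<gamma> tail])
  obtain C where C: "C > 0" "\<And>y. y > 0 \<Longrightarrow> R y \<le> C * y powr (- \<alpha>)"
    using power_tail_bound[OF R _ \<alpha>] by (auto simp: R_def)
  let ?DX = "distr M borel (\<lambda>\<omega>. real (X \<omega>))" and ?DQ = "distr M borel Q"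
  interpret DX: prob_space ?DX by (rule prob_space_distr) measurable
  interpret DQ: prob_space ?DQ by (rule prob_space_distr) measurable
  interpret DXQ: pair_prob_space ?DX ?DQ ..
  \<comment> \<open>Independence is given for the real-valued \<open>real (X \<omega>)\<close>; the
    floor recovers the natural number.\<close>
  let ?g = "\<lambda>x::real. ?c * real (nat \<lfloor>x\<rfloor> choose ?v)"
  have g [measurable]: "?g \<in> borel_measurable borel" by measurable
  have joint: "distr M (borel \<Otimes>\<^sub>M borel) (\<lambda>\<omega>. (real (X \<omega>), Q \<omega>)) = ?DX \<Otimes>\<^sub>M ?DQ"
    using indep by (simp add: indep_var_distribution_eq)
  have tailN: "prob {\<omega> \<in> space M. ?N \<omega> > t} = (\<integral>q. indicator {0<..} q * R (t / q ^ ?e) \<partial>?DQ)" if t: "t > 0" for t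
  proof -
    \<comment> \<open>The part q = 0 is split off, since the threshold t / q^e makes no sense there;
      the conditional mean vanishes on it because e > 0.\<close>
    let ?A = "{p. ?g (fst p) * snd p ^ ?e > t \<and> snd p > 0} :: (real \<times> real) set"
    have A [measurable]: "?A \<in> sets (borel \<Otimes>\<^sub>M borel)"
    proof -
      have [measurable]: "(\<lambda>p. ?g (fst p)) \<in> borel_measurable (borel \<Otimes>\<^sub>M (borel :: real measure))"
        by (rule measurable_compose[OF measurable_fst g])
      have "{p \<in> space (borel \<Otimes>\<^sub>M borel). ?g (fst p) * snd p ^ ?e > t \<and> snd p > 0} \<in> sets (borel \<Otimes>\<^sub>M borel)"
        by measurable
      then show ?thesis by (simp add: space_pair_measure)
    qed
    have "prob {\<omega> \<in> space M. ?N \<omega> > t} = prob ((\<lambda>\<omega>. (real (X \<omega>), Q \<omega>)) -` ?A \<inter> space M)"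
    proof (rule arg_cong[where f=prob])
      show "{\<omega> \<in> space M. ?N \<omega> > t} = (\<lambda>\<omega>. (real (X \<omega>), Q \<omega>)) -` ?A \<inter> space M"
      proof (intro equalityI subsetI)
        fix \<omega> assume \<omega>: "\<omega> \<in> {\<omega> \<in> space M. ?N \<omega> > t}"
        then have "Q \<omega> \<noteq> 0" using t F(3) by (auto simp: mean_copies_def zero_power)
        then show "\<omega> \<in> (\<lambda>\<omega>. (real (X \<omega>), Q \<omega>)) -` ?A \<inter> space M"
          using \<omega> Q01[of \<omega>] by (auto simp: mean_copies_def)
      qed (auto simp: mean_copies_def)
    qed
    also have "\<dots> = measure (?DX \<Otimes>\<^sub>M ?DQ) ?A"
      unfolding joint[symmetric] by (subst measure_distr) auto
    also have "\<dots> = (\<integral>p. indicat_real ?A p \<partial>(?DX \<Otimes>\<^sub>M ?DQ))" by simp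
    also have "\<dots> = (\<integral>q. (\<integral>x. indicat_real ?A (x, q) \<partial>?DX) \<partial>?DQ)"
    proof -
      have "integrable (?DX \<Otimes>\<^sub>M ?DQ) (\<lambda>(x, q). indicat_real ?A (x, q) :: real)"
        by (simp add: case_prod_eta) (intro integrable_real_indicator, auto simp: DXQ.P.emeasure_eq_measure)
      from DXQ.integral_snd[OF this] show ?thesis by simp
    qed
    also have "\<dots> = (\<integral>q. indicator {0<..} q * R (t / q ^ ?e) \<partial>?DQ)"
    proof (intro Bochner_Integration.integral_cong refl)
      fix q :: real
      show "(\<integral>x. indicat_real ?A (x, q) \<partial>?DX) = indicator {0<..} q * R (t / q ^ ?e)"
      proof (cases "q > 0")
        case True
        have "(\<integral>x. indicat_real ?A (x, q) \<partial>?DX) = (\<integral>\<omega>. indicat_real ?A (real (X \<omega>), q) \<partial>M)"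
          by (rule integral_distr) measurable
        also have "\<dots> = (\<integral>\<omega>. indicat_real {\<omega> \<in> space M. ?c * real (X \<omega> choose ?v) > t / q ^ ?e} \<omega> \<partial>M)"
          by (intro Bochner_Integration.integral_cong refl) (use True in \<open>auto simp: indicator_def field_simps\<close>)
        also have "\<dots> = R (t / q ^ ?e)" unfolding R_def by (simp add: Int_absorb1 subset_eq)
        finally show ?thesis using True by simp
      qed simp
    qed
    finally show ?thesis .
  qed
  have Rmeas [measurable]: "R \<in> borel_measurable borel"
  proof -
    have "mono (\<lambda>y. - R y)" unfolding R_def
      by (intro monoI le_imp_neg_le finite_measure_mono) auto
    from borel_measurable_mono[OF this] show ?thesis by simp
  qed
  have AEQ: "AE q in ?DQ. 0 \<le> q \<and> q \<le> 1"
    using Q01 by (subst AE_distr_iff) auto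
  have lim: "((\<lambda>t. \<integral>q. t powr \<alpha> * (indicator {0<..} q * R (t / q ^ ?e)) \<partial>?DQ) \<longlongrightarrow> (\<integral>q. b' * q powr (\<alpha> * real ?e) \<partial>?DQ)) at_top"
  proof (rule integral_dominated_convergence_at_top[where w="\<lambda>_. C"])
    show "AE q in ?DQ. ((\<lambda>t. t powr \<alpha> * (indicator {0<..} q * R (t / q ^ ?e))) \<longlongrightarrow> b' * q powr (\<alpha> * real ?e)) at_top"
      using AEQ
    proof eventually_elim
      case (elim q)
      show ?case
      proof (cases "q = 0")
        case False
        then have q: "q > 0" using elim by simp
        have "filterlim (\<lambda>t. inverse (q ^ ?e) * t) at_top at_top"
          using q by (intro filterlim_tendsto_pos_mult_at_top[OF tendsto_const]) (auto simp: filterlim_ident)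
        from filterlim_compose[OF R this]
        have "((\<lambda>t. R (inverse (q ^ ?e) * t) * (inverse (q ^ ?e) * t) powr \<alpha> * q powr (\<alpha> * real ?e)) \<longlongrightarrow> b' * q powr (\<alpha> * real ?e)) at_top"
          by (intro tendsto_mult_right)
        then show ?thesis
        proof (rule Lim_transform_eventually)
          show "\<forall>\<^sub>F t in at_top. R (inverse (q ^ ?e) * t) * (inverse (q ^ ?e) * t) powr \<alpha> * q powr (\<alpha> * real ?e)
              = t powr \<alpha> * (indicator {0<..} q * R (t / q ^ ?e))"
            using eventually_gt_at_top[of 0]
          proof eventually_elim
            case (elim t)
            have "(inverse (q ^ ?e) * t) powr \<alpha> * q powr (\<alpha> * real ?e) = t powr \<alpha>"
            proof -
              have "q powr (\<alpha> * real ?e) = (q ^ ?e) powr \<alpha>"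
                using q by (simp add: powr_powr mult.commute flip: powr_realpow)
              then show ?thesis using q elim by (simp add: powr_divide divide_inverse[symmetric] mult.commute[of "inverse _"])
            qed
            then show ?case using q by (simp add: mult.assoc) (simp add: divide_inverse mult.commute)
          qed
        qed
      qed simp
    qed
    show "\<forall>\<^sub>F t in at_top. AE q in ?DQ. norm (t powr \<alpha> * (indicator {0<..} q * R (t / q ^ ?e))) \<le> C"
      using eventually_gt_at_top[of 0]
    proof eventually_elim
      case (elim t)
      note t = elim
      show ?case using AEQ
      proof eventually_elim
        case (elim q)
        show ?case
        proof (cases "q = 0")
          case False
          then have q: "q > 0" using elim by simp
          have R0: "0 \<le> R y" for y by (simp add: R_def)
          have "R (t / q ^ ?e) \<le> C * (t / q ^ ?e) powr (- \<alpha>)" using t q by (intro C) simp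
          also have "\<dots> \<le> C * t powr (- \<alpha>)"
          proof (intro mult_left_mono)
            have "q ^ ?e \<le> 1" using elim by (auto intro: power_le_one)
            then have "t \<le> t / q ^ ?e" using t q by (simp add: field_simps)
            then show "(t / q ^ ?e) powr (- \<alpha>) \<le> t powr (- \<alpha>)"
              using t \<alpha> by (intro powr_mono2') auto
          qed (use C in simp)
          finally have "t powr \<alpha> * R (t / q ^ ?e) \<le> t powr \<alpha> * (C * t powr (- \<alpha>))" by (intro mult_left_mono) auto
          also have "\<dots> = C" using t by (simp add: powr_minus)
          finally show ?thesis using q R0 by simp
        qed (use C in simp)
      qed
    qed
  qed measurable
  have eQ: "(\<integral>q. b' * q powr (\<alpha> * real ?e) \<partial>?DQ) = b' * expectation (\<lambda>\<omega>. Q \<omega> powr (\<gamma> * real ?e / real ?v))"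
    by (subst integral_distr) (auto simp: \<alpha>_def)
  have "((\<lambda>t. measure (distr M borel ?N) {t<..} * t powr \<alpha>) \<longlongrightarrow> b' * expectation (\<lambda>\<omega>. Q \<omega> powr (\<gamma> * real ?e / real ?v))) at_top"
    using lim unfolding eQ
  proof (rule Lim_transform_eventually)
    show "\<forall>\<^sub>F t in at_top. (\<integral>q. t powr \<alpha> * (indicator {0<..} q * R (t / q ^ ?e)) \<partial>?DQ) = measure (distr M borel ?N) {t<..} * t powr \<alpha>"
      using eventually_gt_at_top[of 0]
    proof eventually_elim
      case (elim t)
      have "measure (distr M borel ?N) {t<..} = prob {\<omega> \<in> space M. ?N \<omega> > t}"
        by (subst measure_distr) (auto intro!: arg_cong[where f=prob])
      then show ?case using tailN[OF elim] by simp
    qed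
  qed
  moreover have "AE z in distr M borel ?N. 0 \<le> z"
    using Q01 by (subst AE_distr_iff) (auto simp: mean_copies_def intro!: AE_I2)
  moreover have "real_distribution (distr M borel ?N)" by (rule real_distribution_distr) measurable
  ultimately show ?thesis unfolding power_tail_law_def \<alpha>_def b'_def by blast
qed


section \<open>The central limit theorem and growth rates\<close>

text \<open>Stated for characteristic functions, so that it can be composed with the sequence of
  layer numbers and added to the error terms of \<open>char_superposition_limit\<close>.\<close>

lemma clt_char_limit:
  assumes \<mu>: "real_distribution \<mu>" and int: "integrable \<mu> (\<lambda>x. x)" "integrable \<mu> (\<lambda>x. x\<^sup>2)"
    and var: "(\<integral>x. (x - (\<integral>y. y \<partial>\<mu>))\<^sup>2 \<partial>\<mu>) = \<sigma>2" and \<sigma>2: "\<sigma>2 > 0"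
  shows "(\<lambda>m. iexp (- (t * (real m * (\<integral>y. y \<partial>\<mu>)) / (sqrt \<sigma>2 * sqrt (real m)))) * char \<mu> (t / (sqrt \<sigma>2 * sqrt (real m))) ^ m)
    \<longlonglongrightarrow> exp (- complex_of_real (t\<^sup>2) / 2)"
proof -
  interpret real_distribution \<mu> by fact
  define e where "e = (\<integral>y. y \<partial>\<mu>)"
  define \<rho> where "\<rho> = distr \<mu> borel (\<lambda>x. x - e)"
  define u where "u m = t / (sqrt \<sigma>2 * sqrt (real m))" for m :: nat
  define w where "w m = char \<rho> (u m)" for m
  have [measurable_cong]: "sets \<mu> = sets borel" by simp
  interpret R: real_distribution \<rho> unfolding \<rho>_def by (rule real_distribution_distr) measurable
  have w_eq: "w m = iexp (- (u m * e)) * char \<mu> (u m)" for m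
  proof -
    have "w m = (\<integral>x. iexp (u m * (x - e)) \<partial>\<mu>)"
      unfolding w_def \<rho>_def char_def by (rule integral_distr) measurable
    also have "\<dots> = (\<integral>x. iexp (- (u m * e)) * iexp (u m * x) \<partial>\<mu>)"
    proof (intro Bochner_Integration.integral_cong refl)
      fix x
      have "u m * (x - e) = - (u m * e) + u m * x" by (simp add: right_diff_distrib)
      then show "iexp (u m * (x - e)) = iexp (- (u m * e)) * iexp (u m * x)"
        by (simp only: of_real_add distrib_left exp_add)
    qed
    also have "\<dots> = iexp (- (u m * e)) * char \<mu> (u m)" unfolding char_def by (rule integral_mult_right_zero)
    finally show ?thesis .
  qed
  have i1: "integrable \<rho> (\<lambda>x. x)"
  proof -
    have "integrable \<mu> (\<lambda>x. x - e)" by (intro Bochner_Integration.integrable_diff int(1) integrable_const)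
    then show ?thesis unfolding \<rho>_def by (subst integrable_distr_eq) measurable
  qed
  have i2: "integrable \<rho> (\<lambda>x. x\<^sup>2)"
  proof -
    have "integrable \<mu> (\<lambda>x. x\<^sup>2 + e\<^sup>2 - 2 * e * x)"
      by (intro Bochner_Integration.integrable_diff Bochner_Integration.integrable_add integrable_mult_right int integrable_const)
    then have "integrable \<mu> (\<lambda>x. (x - e)\<^sup>2)" by (simp only: power2_diff mult.commute mult.left_commute)
    then show ?thesis unfolding \<rho>_def by (subst integrable_distr_eq) measurable
  qed
  have m0: "(\<integral>x. x \<partial>\<rho>) = 0"
  proof -
    have "(\<integral>x. x \<partial>\<rho>) = (\<integral>x. x - e \<partial>\<mu>)" unfolding \<rho>_def by (rule integral_distr) measurable
    also have "\<dots> = (\<integral>x. x \<partial>\<mu>) - (\<integral>x. e \<partial>\<mu>)"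
      by (rule Bochner_Integration.integral_diff[OF int(1) integrable_const])
    also have "(\<integral>x. e \<partial>\<mu>) = measure \<mu> (space \<mu>) *\<^sub>R e" by (rule lebesgue_integral_const)
    finally show ?thesis by (simp only: prob_space scaleR_one e_def diff_self)
  qed
  have v: "R.variance (\<lambda>x. x) = \<sigma>2"
  proof -
    have "(\<integral>x. (x - 0)\<^sup>2 \<partial>\<rho>) = (\<integral>x. (x - e - 0)\<^sup>2 \<partial>\<mu>)" unfolding \<rho>_def by (rule integral_distr) measurable
    then show ?thesis unfolding m0 using var by (simp only: e_def diff_zero)
  qed
  \<comment> \<open>The remainder of \<open>char_approx3\<close>. The first entry of the minimum
    gives domination by the second moment alone, the second makes the integrand vanish as u tends to
    0.\<close>
  define r where "r m = (\<integral>x. min (6 * x\<^sup>2) (\<bar>u m\<bar> * \<bar>x\<bar> ^ 3) \<partial>\<rho>)" for m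
  have u0: "u \<longlonglongrightarrow> 0"
  proof -
    have "filterlim (\<lambda>m. sqrt \<sigma>2 * sqrt (real m)) at_top sequentially"
      using \<sigma>2 by (intro filterlim_tendsto_pos_mult_at_top[OF tendsto_const] filterlim_compose[OF sqrt_at_top filterlim_real_sequentially]) auto
    then show ?thesis unfolding u_def[abs_def]
      by (intro tendsto_divide_0[OF tendsto_const] filterlim_at_top_imp_at_infinity)
  qed
  have r0: "r \<longlonglongrightarrow> 0"
  proof -
    have "(\<lambda>m. r m) \<longlonglongrightarrow> (\<integral>x. 0 \<partial>\<rho>)"
      unfolding r_def
    proof (rule integral_dominated_convergence[where w="\<lambda>x. 6 * x\<^sup>2"])
      show "AE x in \<rho>. (\<lambda>m. min (6 * x\<^sup>2) (\<bar>u m\<bar> * \<bar>x\<bar> ^ 3)) \<longlonglongrightarrow> 0"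
      proof (intro AE_I2)
        fix x :: real
        have "(\<lambda>m. min (6 * x\<^sup>2) (\<bar>u m\<bar> * \<bar>x\<bar> ^ 3)) \<longlonglongrightarrow> min (6 * x\<^sup>2) (\<bar>0\<bar> * \<bar>x\<bar> ^ 3)"
          by (intro tendsto_intros u0)
        then show "(\<lambda>m. min (6 * x\<^sup>2) (\<bar>u m\<bar> * \<bar>x\<bar> ^ 3)) \<longlonglongrightarrow> 0" by simp
      qed
    qed (use i2 in auto)
    then show ?thesis by simp
  qed
  have approx: "cmod (of_nat m * (w m - 1) - (- complex_of_real (t\<^sup>2) / 2)) \<le> t\<^sup>2 / (6 * \<sigma>2) * r m" if m: "m > 0" for m
  proof -
    have u2: "real m * (u m)\<^sup>2 = t\<^sup>2 / \<sigma>2"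
      using m \<sigma>2 by (simp add: u_def power_divide power_mult_distrib)
    have b: "cmod (w m - (1 - (u m)\<^sup>2 * \<sigma>2 / 2)) \<le> (u m)\<^sup>2 / 6 * r m"
      unfolding w_def r_def by (rule R.char_approx3[OF i1 m0 i2 v])
    have half: "real m * ((u m)\<^sup>2 * \<sigma>2 / 2) = t\<^sup>2 / 2"
      using u2 \<sigma>2 by (simp add: field_simps)
    have "of_nat m * (w m - (1 - (u m)\<^sup>2 * \<sigma>2 / 2)) = of_nat m * (w m - 1) + complex_of_real (real m * ((u m)\<^sup>2 * \<sigma>2 / 2))"
      by (simp add: algebra_simps)
    then have eq: "of_nat m * (w m - 1) - (- complex_of_real (t\<^sup>2) / 2) = of_nat m * (w m - (1 - (u m)\<^sup>2 * \<sigma>2 / 2))"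
      unfolding half by simp
    have "cmod (of_nat m * (w m - (1 - (u m)\<^sup>2 * \<sigma>2 / 2))) = real m * cmod (w m - (1 - (u m)\<^sup>2 * \<sigma>2 / 2))"
      by (simp only: norm_mult norm_of_nat)
    also have "\<dots> \<le> real m * ((u m)\<^sup>2 / 6 * r m)" using b by (intro mult_left_mono) auto
    also have "\<dots> = (real m * (u m)\<^sup>2) / 6 * r m" by simp
    also have "\<dots> = t\<^sup>2 / (6 * \<sigma>2) * r m" unfolding u2 by simp
    finally show ?thesis unfolding eq .
  qed
  have "(\<lambda>m. of_nat m * (w m - 1)) \<longlonglongrightarrow> - complex_of_real (t\<^sup>2) / 2"
  proof (rule LIM_zero_cancel, rule Lim_null_comparison)
    show "\<forall>\<^sub>F m in sequentially. norm (of_nat m * (w m - 1) - (- complex_of_real (t\<^sup>2) / 2)) \<le> t\<^sup>2 / (6 * \<sigma>2) * r m"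
      using eventually_gt_at_top[of 0] by eventually_elim (rule approx)
    show "(\<lambda>m. t\<^sup>2 / (6 * \<sigma>2) * r m) \<longlonglongrightarrow> 0" by (intro tendsto_mult_right_zero r0)
  qed
  moreover have "cmod (w m) \<le> 1" for m unfolding w_def by (rule R.cmod_char_le_1)
  ultimately have "(\<lambda>m. w m ^ m) \<longlonglongrightarrow> exp (- complex_of_real (t\<^sup>2) / 2)" by (intro power_tendsto_exp)
  moreover have "w m ^ m = iexp (- (t * (real m * e) / (sqrt \<sigma>2 * sqrt (real m)))) * char \<mu> (t / (sqrt \<sigma>2 * sqrt (real m))) ^ m" for m
  proof -
    have "iexp (- (u m * e)) ^ m = iexp (- (t * (real m * e) / (sqrt \<sigma>2 * sqrt (real m))))"
      unfolding exp_of_nat_mult[symmetric] by (simp add: u_def algebra_simps)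
    then show ?thesis unfolding w_eq power_mult_distrib u_def by simp
  qed
  ultimately show ?thesis by (simp add: e_def)
qed

text \<open>Eventually m exceeds \<nu> n / 2, so powers of m may be replaced by powers of n.\<close>

lemma powr_ratio_tendsto_0:
  fixes n m :: "nat \<Rightarrow> nat"
  assumes n: "filterlim n at_top sequentially" and nm: "(\<lambda>k. real (m k) / real (n k)) \<longlonglongrightarrow> \<nu>" and \<nu>: "\<nu> > 0"
    and \<theta>: "\<theta> < p" "p > 0" and c: "c > 0"
  shows "(\<lambda>k. real (n k) powr \<theta> / (c * real (m k) powr p)) \<longlonglongrightarrow> 0"
proof -
  have npos: "\<forall>\<^sub>F k in sequentially. n k > 0" by (rule eventually_compose_filterlim[OF eventually_gt_at_top n])
  have ev: "\<forall>\<^sub>F k in sequentially. \<nu> / 2 < real (m k) / real (n k)" using \<nu> by (intro order_tendstoD(1)[OF nm]) simp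
  have "filterlim (\<lambda>k. real (n k)) at_top sequentially" by (rule filterlim_compose[OF filterlim_real_sequentially n])
  then have "(\<lambda>k. 1 / (c * (\<nu> / 2) powr p) * real (n k) powr (\<theta> - p)) \<longlonglongrightarrow> 0"
    using \<theta> by (intro tendsto_mult_right_zero tendsto_neg_powr) auto
  then show ?thesis
  proof (rule Lim_null_comparison[rotated])
    show "\<forall>\<^sub>F k in sequentially. norm (real (n k) powr \<theta> / (c * real (m k) powr p)) \<le> 1 / (c * (\<nu> / 2) powr p) * real (n k) powr (\<theta> - p)"
      using npos ev
    proof eventually_elim
      case (elim k)
      have "m k > 0" using elim \<nu> by (cases "m k = 0") auto
      have "(\<nu> / 2 * real (n k)) powr p \<le> real (m k) powr p"
        using elim \<nu> \<theta> by (intro powr_mono2) (auto simp: field_simps)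
      then have "(\<nu> / 2) powr p * real (n k) powr p \<le> real (m k) powr p"
        using \<nu> by (simp add: powr_mult del: times_divide_eq_left)
      then have "real (n k) powr \<theta> / (c * real (m k) powr p) \<le> real (n k) powr \<theta> / (c * ((\<nu> / 2) powr p * real (n k) powr p))"
        using c \<nu> elim \<open>m k > 0\<close> by (intro divide_left_mono mult_left_mono mult_pos_pos) (auto intro: less_le_trans[of 0 "(\<nu> / 2) powr p * real (n k) powr p"])
      also have "\<dots> = 1 / (c * (\<nu> / 2) powr p) * real (n k) powr (\<theta> - p)"
        by (simp add: powr_diff)
      finally show ?case using c by simp
    qed
  qed
qed

lemma iexp_mult_power_diff_tendsto_0:
  fixes z z' :: "nat \<Rightarrow> complex" and m :: "nat \<Rightarrow> nat"
  assumes "\<And>k. cmod (z k) \<le> 1" "\<And>k. cmod (z' k) \<le> 1" and lim: "(\<lambda>k. real (m k) * cmod (z k - z' k)) \<longlonglongrightarrow> 0"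
  shows "(\<lambda>k. iexp (a k) * z k ^ m k - iexp (a k) * z' k ^ m k) \<longlonglongrightarrow> 0"
proof (rule Lim_null_comparison[OF _ lim])
  show "\<forall>\<^sub>F k in sequentially. norm (iexp (a k) * z k ^ m k - iexp (a k) * z' k ^ m k) \<le> real (m k) * cmod (z k - z' k)"
  proof (intro always_eventually allI)
    fix k
    have "norm (iexp (a k) * z k ^ m k - iexp (a k) * z' k ^ m k) = cmod (z k ^ m k - z' k ^ m k)"
      unfolding right_diff_distrib[symmetric] norm_mult norm_exp_i_times by simp
    also have "\<dots> \<le> real (m k) * cmod (z k - z' k)" by (intro norm_power_diff assms)
    finally show "norm (iexp (a k) * z k ^ m k - iexp (a k) * z' k ^ m k) \<le> real (m k) * cmod (z k - z' k)" .
  qed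
qed


section \<open>Comparison with the conditional means\<close>

lemma num_copies_bernoulli_graph_le:
  assumes "simple_graph F" "G \<in> set_pmf (bernoulli_graph {1..x} q)"
  shows "real (num_copies F G) \<le> real (copies_in_complete F) * real x ^ num_verts F"
proof -
  have "G \<in> {{1..x}} \<times> Pow (all_pairs {1..x})" using assms(2) set_pmf_bernoulli_graph by blast
  then have "num_copies F G = copies_within F x (edges G)"
    using num_copies_full_vertex_set[of F x "edges G"] by (metis SigmaE prod.collapse prod.inject singletonD snd_conv)
  then have "real (num_copies F G) \<le> real (card (copies_on F x))" using copies_within_le[of F x "edges G"] by simp
  also have "\<dots> \<le> real (copies_in_complete F) * real x ^ num_verts F"
    unfolding card_copies_on[OF assms(1)] of_nat_mult by (intro mult_left_mono real_binomial_le_power) simp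
  finally show ?thesis .
qed

lemma mean_copies_bounds:
  assumes "0 \<le> q" "q \<le> 1"
  shows "0 \<le> mean_copies F x q" "mean_copies F x q \<le> real (copies_in_complete F) * real x ^ num_verts F"
proof -
  show "0 \<le> mean_copies F x q" using assms by (simp add: mean_copies_def)
  have "mean_copies F x q \<le> real (copies_in_complete F) * real (x choose num_verts F) * 1"
    unfolding mean_copies_def using assms by (intro mult_left_mono) (auto intro: power_le_one)
  also have "\<dots> \<le> real (copies_in_complete F) * real x ^ num_verts F"
    unfolding mult_1_right by (intro mult_left_mono real_binomial_le_power) simp
  finally show "mean_copies F x q \<le> real (copies_in_complete F) * real x ^ num_verts F" .
qed

context
  fixes D :: "(nat \<times> real) measure"
  assumes prob_D: "prob_space D" and sets_D: "sets D = sets (count_space UNIV \<Otimes>\<^sub>M borel)"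
begin

interpretation D: prob_space D by (rule prob_D)

lemma measurable_mean_copies: "(\<lambda>w. mean_copies F (fst w) (snd w)) \<in> borel_measurable D"
proof -
  have "(\<lambda>w. mean_copies F (fst w) (snd w)) \<in> borel_measurable (count_space UNIV \<Otimes>\<^sub>M borel)"
    by (rule measurable_pair_measure_countable1) (auto simp: mean_copies_def)
  then show ?thesis using measurable_cong_sets[OF sets_D refl] by blast
qed

text \<open>The conditional estimate averaged over (X, Q). In the application u = t / s, and the
  factor u^(2 \<kappa>) has to beat the number m of layers.\<close>

lemma char_mixed_near_char_mean:
  assumes F: "simple_graph F" "num_verts F \<ge> 2" and q: "AE w in D. 0 \<le> snd w \<and> snd w \<le> 1"
    and \<kappa>: "0 < \<kappa>" "\<kappa> \<le> 1"
    and int: "integrable D (\<lambda>w. real (fst w) powr (\<kappa> * real (2 * num_verts F - 2)))"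
  shows "cmod (char (distr (mixed_bernoulli_graph D) borel (\<lambda>G. real (num_copies F G))) u
        - char (distr D borel (\<lambda>w. mean_copies F (fst w) (snd w))) u)
     \<le> 2 * (u\<^sup>2 * ((real (copies_in_complete F))\<^sup>2 * real (num_edges F))) powr \<kappa>
        * (\<integral>w. real (fst w) powr (\<kappa> * real (2 * num_verts F - 2)) \<partial>D)"
proof -
  let ?e = "\<lambda>G. iexp (u * real (num_copies F G))"
  let ?f = "\<lambda>w. measure_pmf.expectation (bernoulli_graph {1..fst w} (snd w)) ?e"
  let ?g = "\<lambda>w. iexp (u * mean_copies F (fst w) (snd w))"
  let ?B = "\<lambda>w. 2 * (u\<^sup>2 * ((real (copies_in_complete F))\<^sup>2 * real (num_edges F))) powr \<kappa> * real (fst w) powr (\<kappa> * real (2 * num_verts F - 2))"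
  have i1: "integrable D ?f"
    using integrable_bernoulli_expectation[OF prob_D sets_D, where B=1 and h="\<lambda>_. ?e" and r="\<lambda>x. x"] by simp
  have "?g \<in> borel_measurable D" using measurable_mean_copies[of F] by measurable
  then have i2: "integrable D ?g" by (intro D.integrable_const_bound[where B=1]) auto
  have "char (distr D borel (\<lambda>w. mean_copies F (fst w) (snd w))) u = (\<integral>w. ?g w \<partial>D)"
    unfolding char_def by (rule integral_distr[OF measurable_mean_copies]) measurable
  then have "char (distr (mixed_bernoulli_graph D) borel (\<lambda>G. real (num_copies F G))) u
        - char (distr D borel (\<lambda>w. mean_copies F (fst w) (snd w))) u = (\<integral>w. ?f w - ?g w \<partial>D)"
    unfolding char_mixed_bernoulli_graph[OF prob_D sets_D] by (simp only: Bochner_Integration.integral_diff[OF i1 i2])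
  also have "cmod \<dots> \<le> (\<integral>w. ?B w \<partial>D)"
  proof (rule order_trans[OF integral_norm_bound integral_mono_AE])
    show "integrable D (\<lambda>w. cmod (?f w - ?g w))" by (intro integrable_norm Bochner_Integration.integrable_diff i1 i2)
    show "integrable D ?B" by (intro integrable_mult_right int)
    show "AE w in D. cmod (?f w - ?g w) \<le> ?B w"
      using q by eventually_elim (rule iexp_num_copies_minus_mean_le[OF F _ _ \<kappa>], auto)
  qed
  also have "\<dots> = 2 * (u\<^sup>2 * ((real (copies_in_complete F))\<^sup>2 * real (num_edges F))) powr \<kappa>
        * (\<integral>w. real (fst w) powr (\<kappa> * real (2 * num_verts F - 2)) \<partial>D)"
    by (rule integral_mult_right_zero)
  finally show ?thesis .
qed

text \<open>For unbounded h the mixture formula is first obtained for nonnegative integrals; the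
  envelope B then provides integrability.\<close>

lemma mixed_bernoulli_graph_integral:
  fixes h :: "nat graph \<Rightarrow> real"
  assumes h0: "\<And>G. 0 \<le> h G" and hB: "\<And>x q G. G \<in> set_pmf (bernoulli_graph {1..x} q) \<Longrightarrow> h G \<le> B x"
    and B: "integrable D (\<lambda>w. B (fst w))"
  shows "integrable (mixed_bernoulli_graph D) h"
    and "(\<integral>G. h G \<partial>mixed_bernoulli_graph D) = (\<integral>w. measure_pmf.expectation (bernoulli_graph {1..fst w} (snd w)) h \<partial>D)"
proof -
  let ?f = "\<lambda>w. measure_pmf.expectation (bernoulli_graph {1..fst w} (snd w)) h"
  have fin: "finite (set_pmf (bernoulli_graph {1..x} q))" for x q
    by (rule finite_subset[OF set_pmf_bernoulli_graph]) (auto simp: finite_all_pairs)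
  have f0: "0 \<le> ?f w" for w by (intro Bochner_Integration.integral_nonneg h0)
  have fB: "?f w \<le> B (fst w)" for w
  proof -
    have "?f w \<le> measure_pmf.expectation (bernoulli_graph {1..fst w} (snd w)) (\<lambda>_. B (fst w))"
      by (intro integral_mono_AE integrable_measure_pmf_finite fin) (auto simp: AE_measure_pmf_iff intro: hB)
    then show ?thesis by simp
  qed
  have fm: "?f \<in> borel_measurable D"
    using measurable_bernoulli_expectation[OF prob_D sets_D, of "\<lambda>x. x" "\<lambda>_. h"] by simp
  have fi: "integrable D ?f"
    by (rule Bochner_Integration.integrable_bound[OF B fm]) (use f0 fB in \<open>auto intro!: AE_I2 order_trans[OF _ abs_ge_self]\<close>)
  have "(\<integral>\<^sup>+G. ennreal (h G) \<partial>mixed_bernoulli_graph D)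
      = (\<integral>\<^sup>+w. \<integral>\<^sup>+G. ennreal (h G) \<partial>(case w of (x, q) \<Rightarrow> measure_pmf (bernoulli_graph {1..x} q)) \<partial>D)"
    unfolding mixed_bernoulli_graph_def
    by (rule nn_integral_bind[OF _ measurable_bernoulli_kernel_D[OF prob_D sets_D]]) simp
  also have "\<dots> = (\<integral>\<^sup>+w. ennreal (?f w) \<partial>D)"
  proof (intro nn_integral_cong)
    fix w :: "nat \<times> real"
    have "(\<integral>\<^sup>+G. ennreal (h G) \<partial>bernoulli_graph {1..fst w} (snd w)) = ennreal (?f w)"
      by (intro nn_integral_eq_integral integrable_measure_pmf_finite fin) (use h0 in auto)
    then show "(\<integral>\<^sup>+G. ennreal (h G) \<partial>(case w of (x, q) \<Rightarrow> measure_pmf (bernoulli_graph {1..x} q))) = ennreal (?f w)"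
      by (simp add: case_prod_beta)
  qed
  also have "\<dots> = ennreal (\<integral>w. ?f w \<partial>D)"
    by (intro nn_integral_eq_integral fi) (use f0 in auto)
  finally have nn: "(\<integral>\<^sup>+G. ennreal (h G) \<partial>mixed_bernoulli_graph D) = ennreal (\<integral>w. ?f w \<partial>D)" .
  have meas: "h \<in> borel_measurable (mixed_bernoulli_graph D)"
    by (simp add: measurable_mixed_bernoulli_graph[OF prob_D sets_D])
  show "integrable (mixed_bernoulli_graph D) h"
    by (rule integrableI_nonneg[OF meas]) (use nn h0 in auto)
  show "(\<integral>G. h G \<partial>mixed_bernoulli_graph D) = (\<integral>w. ?f w \<partial>D)"
    using integral_eq_nn_integral[OF meas] h0 nn f0 by (simp add: Bochner_Integration.integral_nonneg)
qed

text \<open>Part (i) centers at the mean in the superposition, the central limit theorem at m times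
  the mean in G(X, Q). The two differ by the expected overlap and by the truncation of the sizes at
  n; on X > n the factor (X / n)^v \<ge> 1 trades half of the moment of order 2 v for the power
  n^(-v).\<close>

lemma expectation_superposition_near:
  fixes F :: "'v graph"
  assumes F: "simple_graph F" "two_connected F" "num_verts F \<ge> 3" and n: "n > 0"
    and q: "AE w in D. 0 \<le> snd w \<and> snd w \<le> 1"
    and int: "integrable D (\<lambda>w. real (fst w) ^ (2 * num_verts F))"
  defines "NF \<equiv> (\<lambda>G :: nat graph. real (num_copies F G))"
  shows "\<bar>(\<integral>G. NF G \<partial>superposition_graph D n m) - real m * (\<integral>G. NF G \<partial>mixed_bernoulli_graph D)\<bar>
    \<le> expected_overlap D F n m
      + real m * (real (copies_in_complete F) * (\<integral>w. real (fst w) ^ (2 * num_verts F) \<partial>D) / real n ^ num_verts F)"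
proof -
  let ?J = "layers_measure D n m" and ?v = "num_verts F" and ?a = "real (copies_in_complete F)"
  let ?N = "\<lambda>E. real (copies_within F n E)"
  let ?U = "\<lambda>g :: nat \<Rightarrow> nat graph. ?N (\<Union>i\<in>{1..m}. edges (g i))"
  let ?S = "\<lambda>g :: nat \<Rightarrow> nat graph. \<Sum>i=1..m. ?N (edges (g i))"
  have e0: "num_edges F > 0" using two_connected_num_edges_ge[OF F] F(3) by linarith
  let ?K = "max 1 (real (card (copies_on F n)))"
  have NK: "\<bar>?N E\<bar> \<le> ?K" for E using copies_within_le[of F n E] by simp
  have iU: "integrable ?J ?U" by (rule integrable_layers_measure[OF prob_D sets_D, where B="?K"]) (use NK in simp)
  have iN: "integrable ?J (\<lambda>g. ?N (edges (g i)))" for i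
    by (rule integrable_layers_measure[OF prob_D sets_D, where B="?K"]) (use NK in simp)
  have iS: "integrable ?J ?S" by (intro Bochner_Integration.integrable_sum iN)
  have 1: "(\<integral>G. NF G \<partial>superposition_graph D n m) = (\<integral>g. ?U g \<partial>?J)"
    unfolding superposition_graph_eq_distr[OF prob_D sets_D]
    by (subst integral_distr)
       (auto simp: measurable_layers_measure[OF prob_D sets_D] NF_def num_copies_full_vertex_set[unfolded One_nat_def])
  have layer: "(\<integral>g. ?N (edges (g j)) \<partial>?J) = layer_expectation D n (\<lambda>G. ?N (edges G))" if j: "j \<in> {1..m}" for j
  proof -
    \<comment> \<open>The product formula is applied with all factors but one constant;
      \<open>?K\<close> is at least 1 to accommodate them.\<close>
    let ?f = "\<lambda>i G. if i = j then ?N (edges G) else 1"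
    have "(\<integral>g. (\<Prod>i=1..m. ?f i (g i)) \<partial>?J) = (\<Prod>i=1..m. layer_expectation D n (?f i))"
      by (rule integral_prod_layers_measure_real[OF prob_D sets_D, where B="?K"]) (use NK in auto)
    moreover have "(\<Prod>i=1..m. ?f i (g i)) = ?N (edges (g j))" for g :: "nat \<Rightarrow> nat graph"
      using j by (simp add: prod.delta)
    moreover have "(\<Prod>i=1..m. layer_expectation D n (?f i)) = (\<Prod>i=1..m. if i = j then layer_expectation D n (\<lambda>G. ?N (edges G)) else 1)"
      by (intro prod.cong refl) (simp add: D.prob_space)
    ultimately show ?thesis using j by (simp add: prod.delta)
  qed
  have 2: "(\<integral>g. ?S g \<partial>?J) = real m * layer_expectation D n (\<lambda>G. ?N (edges G))"
    by (subst Bochner_Integration.integral_sum[OF iN]) (simp add: layer)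
  let ?mean = "\<lambda>r w. mean_copies F (r (fst w)) (snd w)"
  have 3: "layer_expectation D n (\<lambda>G. ?N (edges G)) = (\<integral>w. ?mean (\<lambda>x. min x n) w \<partial>D)"
  proof (rule integral_cong_AE)
    show "(\<lambda>w. measure_pmf.expectation (layer_graph n (fst w) (snd w)) (\<lambda>G. ?N (edges G))) \<in> borel_measurable D"
      by (rule measurable_layer_expectation[OF prob_D sets_D])
    have "?mean (\<lambda>x. min x n) \<in> borel_measurable (count_space UNIV \<Otimes>\<^sub>M borel)"
      by (rule measurable_pair_measure_countable1) (auto simp: mean_copies_def)
    then show "?mean (\<lambda>x. min x n) \<in> borel_measurable D" using measurable_cong_sets[OF sets_D refl] by blast
    show "AE w in D. measure_pmf.expectation (layer_graph n (fst w) (snd w)) (\<lambda>G. ?N (edges G)) = ?mean (\<lambda>x. min x n) w"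
      using q by eventually_elim (simp add: expectation_layer_graph_copies[OF F, where h=real] expectation_num_copies_bernoulli_graph[OF F(1), unfolded One_nat_def])
  qed
  have iv: "integrable D (\<lambda>w. real (fst w) ^ ?v)"
  proof (rule Bochner_Integration.integrable_bound[OF int])
    show "(\<lambda>w. real (fst w) ^ ?v) \<in> borel_measurable D" by (rule measurable_fst_D[OF prob_D sets_D])
    show "AE w in D. norm (real (fst w) ^ ?v) \<le> norm (real (fst w) ^ (2 * ?v))"
    proof (rule AE_I2)
      fix w :: "nat \<times> real"
      show "norm (real (fst w) ^ ?v) \<le> norm (real (fst w) ^ (2 * ?v))"
        by (cases "fst w = 0") (use F(3) in \<open>auto simp: power_0_left intro!: power_increasing\<close>)
    qed
  qed
  have 4: "(\<integral>G. NF G \<partial>mixed_bernoulli_graph D) = (\<integral>w. ?mean (\<lambda>x. x) w \<partial>D)"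
  proof -
    have "(\<integral>G. NF G \<partial>mixed_bernoulli_graph D) = (\<integral>w. measure_pmf.expectation (bernoulli_graph {1..fst w} (snd w)) NF \<partial>D)"
      by (rule mixed_bernoulli_graph_integral(2)[where B="\<lambda>x. ?a * real x ^ ?v"])
         (auto simp: NF_def intro!: num_copies_bernoulli_graph_le[OF F(1), unfolded One_nat_def] iv)
    also have "\<dots> = (\<integral>w. ?mean (\<lambda>x. x) w \<partial>D)"
    proof (rule integral_cong_AE[OF _ measurable_mean_copies])
      show "(\<lambda>w. measure_pmf.expectation (bernoulli_graph {1..fst w} (snd w)) NF) \<in> borel_measurable D"
        using measurable_bernoulli_expectation[OF prob_D sets_D, of "\<lambda>x. x" "\<lambda>_. NF"] by simp
      show "AE w in D. measure_pmf.expectation (bernoulli_graph {1..fst w} (snd w)) NF = ?mean (\<lambda>x. x) w"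
        using q by eventually_elim (simp add: NF_def expectation_num_copies_bernoulli_graph[OF F(1), unfolded One_nat_def])
    qed
    finally show ?thesis .
  qed
  have im: "integrable D (?mean r)" if r: "\<And>x. r x \<le> x" "?mean r \<in> borel_measurable D" for r
  proof (rule Bochner_Integration.integrable_bound[OF integrable_mult_right[OF iv, of ?a] r(2)])
    show "AE w in D. norm (?mean r w) \<le> norm (?a * real (fst w) ^ ?v)"
      using q
    proof eventually_elim
      case (elim w)
      have "?mean r w \<le> ?a * real (r (fst w)) ^ ?v" using elim by (intro mean_copies_bounds(2)) auto
      also have "\<dots> \<le> ?a * real (fst w) ^ ?v" using r(1) by (intro mult_left_mono power_mono) auto
      finally show ?case using mean_copies_bounds(1)[of "snd w" F "r (fst w)"] elim by simp
    qed
  qed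
  have m1: "?mean (\<lambda>x. min x n) \<in> borel_measurable D"
  proof -
    have "?mean (\<lambda>x. min x n) \<in> borel_measurable (count_space UNIV \<Otimes>\<^sub>M borel)"
      by (rule measurable_pair_measure_countable1) (auto simp: mean_copies_def)
    then show ?thesis using measurable_cong_sets[OF sets_D refl] by blast
  qed
  have i1: "integrable D (?mean (\<lambda>x. min x n))" by (rule im[OF _ m1]) simp
  have i2: "integrable D (?mean (\<lambda>x. x))" by (rule im[OF _ measurable_mean_copies]) simp
  have 5: "\<bar>layer_expectation D n (\<lambda>G. ?N (edges G)) - (\<integral>G. NF G \<partial>mixed_bernoulli_graph D)\<bar>
      \<le> ?a * (\<integral>w. real (fst w) ^ (2 * ?v) \<partial>D) / real n ^ ?v"
  proof -
    have "\<bar>layer_expectation D n (\<lambda>G. ?N (edges G)) - (\<integral>G. NF G \<partial>mixed_bernoulli_graph D)\<bar>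
        = \<bar>\<integral>w. ?mean (\<lambda>x. min x n) w - ?mean (\<lambda>x. x) w \<partial>D\<bar>"
      unfolding 3 4 by (simp only: Bochner_Integration.integral_diff[OF i1 i2])
    also have "\<dots> \<le> (\<integral>w. ?a / real n ^ ?v * real (fst w) ^ (2 * ?v) \<partial>D)"
    proof (rule order_trans[OF integral_abs_bound integral_mono_AE])
      show "integrable D (\<lambda>w. \<bar>?mean (\<lambda>x. min x n) w - ?mean (\<lambda>x. x) w\<bar>)"
        by (intro integrable_abs Bochner_Integration.integrable_diff i1 i2)
      show "integrable D (\<lambda>w. ?a / real n ^ ?v * real (fst w) ^ (2 * ?v))" by (intro integrable_mult_right int)
      show "AE w in D. \<bar>?mean (\<lambda>x. min x n) w - ?mean (\<lambda>x. x) w\<bar> \<le> ?a / real n ^ ?v * real (fst w) ^ (2 * ?v)"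
        using q
      proof eventually_elim
        case (elim w)
        let ?x = "fst w"
        show ?case
        proof (cases "?x \<le> n")
          case False
          have b: "0 \<le> mean_copies F y (snd w)" for y using elim by (intro mean_copies_bounds(1)) auto
          have "mean_copies F n (snd w) \<le> mean_copies F ?x (snd w)"
            unfolding mean_copies_def using False elim
            by (intro mult_right_mono mult_left_mono) (auto intro: binomial_right_mono)
          then have "\<bar>?mean (\<lambda>x. min x n) w - ?mean (\<lambda>x. x) w\<bar> \<le> mean_copies F ?x (snd w)"
            using False b[of n] by (simp add: min_def)
          also have "\<dots> \<le> ?a * real ?x ^ ?v" using elim by (intro mean_copies_bounds(2)) auto
          also have "\<dots> = ?a * real ?x ^ ?v * 1" by simp
          also have "\<dots> \<le> ?a * real ?x ^ ?v * (real ?x / real n) ^ ?v"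
            using False n by (intro mult_left_mono one_le_power) auto
          also have "\<dots> = ?a / real n ^ ?v * real ?x ^ (2 * ?v)"
            by (simp add: power_divide mult_2 power_add)
          finally show ?thesis .
        qed (simp add: min_def)
      qed
    qed
    also have "\<dots> = ?a * (\<integral>w. real (fst w) ^ (2 * ?v) \<partial>D) / real n ^ ?v" by simp
    finally show ?thesis .
  qed
  have 6: "\<bar>(\<integral>g. ?U g \<partial>?J) - (\<integral>g. ?S g \<partial>?J)\<bar>
      \<le> expected_overlap D F n m"
  proof -
    have "\<bar>(\<integral>g. ?U g \<partial>?J) - (\<integral>g. ?S g \<partial>?J)\<bar> = \<bar>\<integral>g. ?U g - ?S g \<partial>?J\<bar>"
      by (simp only: Bochner_Integration.integral_diff[OF iU iS])
    also have "\<dots> \<le> (\<integral>g. \<bar>?U g - ?S g\<bar> \<partial>?J)" by (rule integral_abs_bound)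
    also have "\<dots> \<le> expected_overlap D F n m"
      by (rule copies_within_union_L1[OF prob_D sets_D F(1) e0])
    finally show ?thesis .
  qed
  define LE MX where "LE = layer_expectation D n (\<lambda>G. ?N (edges G))" and "MX = (\<integral>G. NF G \<partial>mixed_bernoulli_graph D)"
  have 7: "real m * \<bar>LE - MX\<bar> \<le> real m * (?a * (\<integral>w. real (fst w) ^ (2 * ?v) \<partial>D) / real n ^ ?v)"
    using 5 unfolding LE_def MX_def by (rule mult_left_mono) simp
  have 8: "\<bar>real m * LE - real m * MX\<bar> = real m * \<bar>LE - MX\<bar>"
    unfolding right_diff_distrib[symmetric] abs_mult by simp
  show ?thesis
    using 6 7 8 unfolding 1 2 LE_def[symmetric] MX_def[symmetric] by linarith
qed

end


section \<open>The limit theorems\<close>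

theorem corollary1:
  fixes M :: "'w measure" and X :: "'w \<Rightarrow> nat" and Q :: "'w \<Rightarrow> real"
    and F :: "'v graph" and n m :: "nat \<Rightarrow> nat" and \<nu> :: real
  defines "D \<equiv> distr M (count_space UNIV \<Otimes>\<^sub>M borel) (\<lambda>\<omega>. (X \<omega>, Q \<omega>))"
    and "v \<equiv> num_verts F" and "e \<equiv> num_edges F"
    and "NF \<equiv> (\<lambda>G :: nat graph. real (num_copies F G))"
  defines "\<sigma>2 \<equiv> prob_space.variance (mixed_bernoulli_graph D) NF"
    and "Nstar_law \<equiv> distr M borel (\<lambda>\<omega>. mean_copies F (X \<omega>) (Q \<omega>))"
  assumes M: "prob_space M"
    and X: "X \<in> measurable M (count_space UNIV)"
    and Q: "Q \<in> borel_measurable M" "\<And>\<omega>. \<omega> \<in> space M \<Longrightarrow> 0 \<le> Q \<omega> \<and> Q \<omega> \<le> 1"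
    and indep: "prob_space.indep_var M borel (\<lambda>\<omega>. real (X \<omega>)) borel Q"
    and Q_pos: "measure M {\<omega> \<in> space M. Q \<omega> > 0} > 0"
    and F: "simple_graph F" "two_connected F" "num_verts F \<ge> 3"
    and \<nu>: "\<nu> > 0"
    and nm: "filterlim n at_top sequentially" "filterlim m at_top sequentially"
      "(\<lambda>k. real (m k) / real (n k)) \<longlonglongrightarrow> \<nu>"
  shows
    "(integrable M (\<lambda>\<omega>. real (X \<omega>) ^ (2 * v)) \<and> \<sigma>2 > 0 \<longrightarrow>
        weak_conv_m
          (\<lambda>k. distr (superposition_graph D (n k) (m k)) borel
             (\<lambda>G. (NF G - prob_space.expectation (superposition_graph D (n k) (m k)) NF)
                    / (sqrt \<sigma>2 * sqrt (real (m k)))))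
          std_normal_distribution)
     \<and>
     (\<forall>b \<gamma> \<alpha> a :: real.
        b > 0 \<and> 1 < \<gamma> \<and> \<gamma> < 2 * real v \<and>
        ((\<lambda>t. measure M {\<omega> \<in> space M. real (X \<omega>) > t} * t powr \<gamma>) \<longlongrightarrow> b) at_top \<and>
        balanced F \<and>
        \<alpha> = \<gamma> / real v \<and>
        1 + (real v - 1) * (1 - 1 / (\<alpha> * real e)) < \<gamma> \<and>
        a = b * (real (copies_in_complete F) / fact v) powr (\<gamma> / real v)
              * prob_space.expectation M (\<lambda>\<omega>. Q \<omega> powr (\<gamma> * real e / real v))
        \<longrightarrow>
        weak_conv_m (normalized_sum \<alpha> (centering \<alpha> Nstar_law) Nstar_law) (stable_limit \<alpha> a) \<and>
        weak_conv_m
          (\<lambda>k. distr (superposition_graph D (n k) (m k)) borel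
             (\<lambda>G. (NF G - centering \<alpha> Nstar_law (m k)) / real (m k) powr (1 / \<alpha>)))
          (stable_limit \<alpha> a) \<and>
        (\<alpha> = 1 \<longrightarrow>
           (\<forall>B L. real_distribution L \<and> weak_conv_m (normalized_sum \<alpha> B Nstar_law) L \<longrightarrow>
              weak_conv_m
                (\<lambda>k. distr (superposition_graph D (n k) (m k)) borel
                   (\<lambda>G. (NF G - B (m k)) / real (m k) powr (1 / \<alpha>)))
                L)))"
proof -
  interpret M: prob_space M by (rule M)
  have XQ: "(\<lambda>\<omega>. (X \<omega>, Q \<omega>)) \<in> measurable M (count_space UNIV \<Otimes>\<^sub>M borel)"
    using X Q(1) by measurable
  have prob_D: "prob_space D" unfolding D_def by (rule M.prob_space_distr[OF XQ])
  have sets_D: "sets D = sets (count_space UNIV \<Otimes>\<^sub>M borel)" by (simp add: D_def)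
  interpret D: prob_space D by (rule prob_D)
  have int_D: "integrable D (\<lambda>w. h (fst w)) \<longleftrightarrow> integrable M (\<lambda>\<omega>. h (X \<omega>))" for h :: "nat \<Rightarrow> real"
  proof -
    have "(\<lambda>w. h (fst w)) \<in> borel_measurable (count_space UNIV \<Otimes>\<^sub>M (borel :: real measure))"
      by (rule measurable_compose[OF measurable_fst]) simp
    from integrable_distr_eq[OF XQ this] show ?thesis by (simp add: D_def)
  qed
  have q_D: "AE w in D. 0 \<le> snd w \<and> snd w \<le> 1"
    unfolding D_def by (rule AE_distr_iff[OF XQ, THEN iffD2]) (use Q(2) in auto)
  have F2: "num_verts F \<ge> 2" using F(3) by simp
  have e_ge: "num_edges F \<ge> num_verts F" by (rule two_connected_num_edges_ge[OF F])
  have Nstar: "Nstar_law = distr D borel (\<lambda>w. mean_copies F (fst w) (snd w))"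
  proof -
    have "(\<lambda>w. mean_copies F (fst w) (snd w)) \<in> borel_measurable (count_space UNIV \<Otimes>\<^sub>M (borel :: real measure))"
      by (rule measurable_pair_measure_countable1) (auto simp: mean_copies_def)
    from distr_distr[OF this XQ] show ?thesis by (simp add: D_def Nstar_law_def o_def)
  qed
  have rd_sup: "real_distribution (distr (superposition_graph D (n k) (m k)) borel f)" for k f
  proof -
    interpret S: prob_space "superposition_graph D (n k) (m k)" by (rule prob_space_superposition_graph(1)[OF prob_D sets_D])
    have "f \<in> borel_measurable (superposition_graph D (n k) (m k))"
      by (simp add: measurable_def prob_space_superposition_graph(2)[OF prob_D sets_D]
          sets_eq_imp_space_eq[of "superposition_graph D (n k) (m k)" "count_space UNIV"])
    then show ?thesis by (rule S.real_distribution_distr)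
  qed
  have n_top: "filterlim (\<lambda>k. real (n k)) at_top sequentially"
    and m_top: "filterlim (\<lambda>k. real (m k)) at_top sequentially"
    using nm by (auto intro: filterlim_compose[OF filterlim_real_sequentially])
  have m_pos: "\<forall>\<^sub>F k in sequentially. m k > 0" by (rule eventually_compose_filterlim[OF eventually_gt_at_top nm(2)])
  have n_pos: "\<forall>\<^sub>F k in sequentially. n k > 0" by (rule eventually_compose_filterlim[OF eventually_gt_at_top nm(1)])
  let ?\<mu> = "distr (mixed_bernoulli_graph D) borel NF"
  interpret G: prob_space "mixed_bernoulli_graph D" by (rule prob_space_mixed_bernoulli_graph(1)[OF prob_D sets_D])
  have NF_meas: "NF \<in> borel_measurable (mixed_bernoulli_graph D)"
    by (simp add: measurable_mixed_bernoulli_graph[OF prob_D sets_D])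
  have rd_\<mu>: "real_distribution ?\<mu>" by (rule G.real_distribution_distr[OF NF_meas])
  let ?E = "\<lambda>k. \<integral>G. NF G \<partial>superposition_graph D (n k) (m k)"
  have part_i: "weak_conv_m
          (\<lambda>k. distr (superposition_graph D (n k) (m k)) borel (\<lambda>G. (NF G - ?E k) / (sqrt \<sigma>2 * sqrt (real (m k)))))
          std_normal_distribution"
    if I: "integrable M (\<lambda>\<omega>. real (X \<omega>) ^ (2 * v))" and \<sigma>2: "\<sigma>2 > 0"
  proof (rule levy_continuity[OF rd_sup real_dist_normal_dist])
    fix t
    let ?a = "real (copies_in_complete F)"
    define e0 where "e0 = (\<integral>x. x \<partial>?\<mu>)"
    define s where "s k = sqrt \<sigma>2 * sqrt (real (m k))" for k
    have s_powr: "s k = sqrt \<sigma>2 * real (m k) powr (1 / 2)" for k by (simp add: s_def powr_half_sqrt)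
    have I2: "integrable D (\<lambda>w. real (fst w) ^ (2 * num_verts F))"
      using int_D[of "\<lambda>x. real x ^ (2 * num_verts F)"] I by (simp add: v_def)
    have I1: "integrable D (\<lambda>w. real (fst w) powr real (num_verts F))"
    proof (rule Bochner_Integration.integrable_bound[OF I2 measurable_fst_D[OF prob_D sets_D] AE_I2])
      fix w :: "nat \<times> real"
      show "norm (real (fst w) powr real (num_verts F)) \<le> norm (real (fst w) ^ (2 * num_verts F))"
        by (cases "fst w = 0") (auto simp: powr_realpow intro!: power_increasing)
    qed
    have NF2: "integrable (mixed_bernoulli_graph D) (\<lambda>G. (NF G)\<^sup>2)"
    proof (rule mixed_bernoulli_graph_integral(1)[OF prob_D sets_D, where B="\<lambda>x. (?a * real x ^ num_verts F)\<^sup>2"])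
      show "(NF G)\<^sup>2 \<le> (?a * real x ^ num_verts F)\<^sup>2" if "G \<in> set_pmf (bernoulli_graph {1..x} q)" for G x q
        unfolding NF_def by (intro power_mono num_copies_bernoulli_graph_le[OF F(1) that]) simp
      show "integrable D (\<lambda>w. (?a * real (fst w) ^ num_verts F)\<^sup>2)"
        using integrable_mult_right[OF I2, of "?a\<^sup>2"] by (simp add: power_mult_distrib power_mult mult.commute[of 2])
    qed simp
    have NF1: "integrable (mixed_bernoulli_graph D) NF"
      by (rule G.square_integrable_imp_integrable[OF NF_meas NF2])
    have e0_eq: "e0 = (\<integral>G. NF G \<partial>mixed_bernoulli_graph D)"
      unfolding e0_def by (rule integral_distr[OF NF_meas]) simp
    have var: "(\<integral>x. (x - (\<integral>y. y \<partial>?\<mu>))\<^sup>2 \<partial>?\<mu>) = \<sigma>2"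
      unfolding e0_def[symmetric] \<sigma>2_def e0_eq by (rule integral_distr[OF NF_meas]) measurable
    have clt: "(\<lambda>k. iexp (- (t * (real (m k) * e0) / s k)) * char ?\<mu> (t / s k) ^ m k) \<longlonglongrightarrow> exp (- complex_of_real (t\<^sup>2) / 2)"
    proof -
      have "integrable ?\<mu> (\<lambda>x. x)" "integrable ?\<mu> (\<lambda>x. x\<^sup>2)"
        using NF1 NF2 by (auto simp: integrable_distr_eq[OF NF_meas])
      from filterlim_compose[OF clt_char_limit[OF rd_\<mu> this var \<sigma>2] nm(2)]
      show ?thesis by (simp add: s_def e0_def)
    qed
    \<comment> \<open>With a finite moment of order \<kappa> = v the exponent of n is 0, so the
      expected overlap stays bounded.\<close>
    obtain K where K: "\<forall>\<^sub>F k in sequentially. expected_overlap D F (n k) (m k) \<le> K * real (n k) powr (real (num_verts F) - real (num_verts F))"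
      using expected_overlap_sequence[OF prob_D sets_D F nm(1,3) _ order_refl I1] by auto
    define c where "c = ?a * (\<integral>w. real (fst w) ^ (2 * num_verts F) \<partial>D)"
    have s_pos: "\<forall>\<^sub>F k in sequentially. s k > 0"
      using m_pos by eventually_elim (use \<sigma>2 in \<open>simp add: s_def\<close>)
    have ratio: "(\<lambda>k. real (n k) powr p / s k) \<longlonglongrightarrow> 0" if "p < 1 / 2" for p
      unfolding s_powr using that \<sigma>2 by (intro powr_ratio_tendsto_0[OF nm(1,3) \<nu>]) auto
    \<comment> \<open>The two centerings differ by O(1) + O(n^(1 - v)), which is negligible against
      the square root of m.\<close>
    have center: "(\<lambda>k. \<bar>t\<bar> * (\<bar>?E k - real (m k) * e0\<bar> / s k)) \<longlonglongrightarrow> 0"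
    proof (intro tendsto_mult_right_zero)
      have "(\<lambda>k. K * (real (n k) powr 0 / s k) + real (m k) / real (n k) * (c * (real (n k) powr (1 - real (num_verts F)) / s k))) \<longlonglongrightarrow> K * 0 + \<nu> * (c * 0)"
        by (intro tendsto_intros nm(3) ratio) (use F(3) in auto)
      then have lim: "(\<lambda>k. K * (real (n k) powr 0 / s k) + real (m k) / real (n k) * (c * (real (n k) powr (1 - real (num_verts F)) / s k))) \<longlonglongrightarrow> 0" by simp
      show "(\<lambda>k. \<bar>?E k - real (m k) * e0\<bar> / s k) \<longlonglongrightarrow> 0"
      proof (rule Lim_null_comparison[OF _ lim])
        show "\<forall>\<^sub>F k in sequentially. norm (\<bar>?E k - real (m k) * e0\<bar> / s k)
            \<le> K * (real (n k) powr 0 / s k) + real (m k) / real (n k) * (c * (real (n k) powr (1 - real (num_verts F)) / s k))"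
          using K s_pos n_pos
        proof eventually_elim
          case (elim k)
          have "\<bar>?E k - real (m k) * e0\<bar> \<le> K * real (n k) powr 0 + real (m k) * (c / real (n k) ^ num_verts F)"
            using expectation_superposition_near[OF prob_D sets_D F elim(3) q_D I2, of "m k"] elim(1)
            unfolding e0_eq NF_def c_def by (simp add: algebra_simps)
          then have "\<bar>?E k - real (m k) * e0\<bar> / s k \<le> (K * real (n k) powr 0 + real (m k) * (c / real (n k) ^ num_verts F)) / s k"
            using elim(2) by (intro divide_right_mono) auto
          also have "\<dots> = K * (real (n k) powr 0 / s k) + real (m k) / real (n k) * (c * (real (n k) powr (1 - real (num_verts F)) / s k))"
            using elim(3) by (simp add: powr_diff powr_realpow add_divide_distrib)
          finally show ?case using elim(2) by simp
        qed
      qed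
    qed
    have A: "(\<lambda>k. char (distr (superposition_graph D (n k) (m k)) borel (\<lambda>G. (NF G - ?E k) / s k)) t
        - iexp (- (t * ?E k / s k)) * char ?\<mu> (t / s k) ^ m k) \<longlonglongrightarrow> 0"
      unfolding NF_def
      by (rule char_superposition_limit[OF prob_D sets_D F nm(1,3) _ order_refl I1 s_pos]) (use ratio[of 0] in auto)
    have B: "(\<lambda>k. iexp (- (t * ?E k / s k)) * char ?\<mu> (t / s k) ^ m k - iexp (- (t * (real (m k) * e0) / s k)) * char ?\<mu> (t / s k) ^ m k) \<longlonglongrightarrow> 0"
    proof (rule Lim_null_comparison[OF _ center])
      show "\<forall>\<^sub>F k in sequentially. norm (iexp (- (t * ?E k / s k)) * char ?\<mu> (t / s k) ^ m k - iexp (- (t * (real (m k) * e0) / s k)) * char ?\<mu> (t / s k) ^ m k)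
          \<le> \<bar>t\<bar> * (\<bar>?E k - real (m k) * e0\<bar> / s k)"
        using s_pos
      proof eventually_elim
        case (elim k)
        have "norm (iexp (- (t * ?E k / s k)) * char ?\<mu> (t / s k) ^ m k - iexp (- (t * (real (m k) * e0) / s k)) * char ?\<mu> (t / s k) ^ m k)
            = cmod (iexp (- (t * ?E k / s k)) - iexp (- (t * (real (m k) * e0) / s k))) * cmod (char ?\<mu> (t / s k)) ^ m k"
          by (simp only: left_diff_distrib[symmetric] norm_mult norm_power)
        also have "\<dots> \<le> \<bar>- (t * ?E k / s k) - - (t * (real (m k) * e0) / s k)\<bar> * 1"
          by (intro mult_mono norm_iexp_diff_le power_le_one real_distribution.cmod_char_le_1[OF rd_\<mu>]) auto
        also have "- (t * ?E k / s k) - - (t * (real (m k) * e0) / s k) = - t * ((?E k - real (m k) * e0) / s k)"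
          using elim by (simp add: field_simps)
        finally show ?case using elim by (simp add: abs_mult)
      qed
    qed
    from tendsto_add[OF tendsto_add[OF A B] clt]
    have "(\<lambda>k. char (distr (superposition_graph D (n k) (m k)) borel (\<lambda>G. (NF G - ?E k) / s k)) t) \<longlonglongrightarrow> exp (- complex_of_real (t\<^sup>2) / 2)" by simp
    moreover have "char std_normal_distribution t = exp (- complex_of_real (t\<^sup>2) / 2)"
      unfolding char_std_normal_distribution by (simp flip: exp_of_real)
    ultimately show "(\<lambda>k. char (distr (superposition_graph D (n k) (m k)) borel (\<lambda>G. (NF G - ?E k) / (sqrt \<sigma>2 * sqrt (real (m k))))) t)
        \<longlonglongrightarrow> char std_normal_distribution t" by (simp add: s_def)
  qed
  have part_ii: "weak_conv_m (normalized_sum \<alpha> (centering \<alpha> Nstar_law) Nstar_law) (stable_limit \<alpha> a) \<and>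
        weak_conv_m
          (\<lambda>k. distr (superposition_graph D (n k) (m k)) borel
             (\<lambda>G. (NF G - centering \<alpha> Nstar_law (m k)) / real (m k) powr (1 / \<alpha>)))
          (stable_limit \<alpha> a) \<and>
        (\<forall>B L. real_distribution L \<and> weak_conv_m (normalized_sum \<alpha> B Nstar_law) L \<longrightarrow>
              weak_conv_m
                (\<lambda>k. distr (superposition_graph D (n k) (m k)) borel
                   (\<lambda>G. (NF G - B (m k)) / real (m k) powr (1 / \<alpha>)))
                L)"
    if b: "b > 0" and \<gamma>: "1 < \<gamma>" "\<gamma> < 2 * real v"
      and tail: "((\<lambda>t. measure M {\<omega> \<in> space M. real (X \<omega>) > t} * t powr \<gamma>) \<longlongrightarrow> b) at_top"
      and \<alpha>: "\<alpha> = \<gamma> / real v"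
      and cond: "1 + (real v - 1) * (1 - 1 / (\<alpha> * real e)) < \<gamma>"
      and a: "a = b * (real (copies_in_complete F) / fact v) powr (\<gamma> / real v)
              * prob_space.expectation M (\<lambda>\<omega>. Q \<omega> powr (\<gamma> * real e / real v))"
    for b \<gamma> \<alpha> a :: real
  proof -
    have v3: "v \<ge> 3" and ev: "e \<ge> v" using F(3) e_ge by (auto simp: v_def e_def)
    have \<alpha>02: "0 < \<alpha>" "\<alpha> < 2" using \<gamma> v3 by (auto simp: \<alpha> field_simps)
    \<comment> \<open>From e \<ge> v follows \<alpha> e = \<gamma> e / v \<ge> \<gamma>, so the
      hypothesis \<open>cond\<close> gives (v - 1) (1 - 1/\<gamma>) < \<gamma> - 1, and \<gamma> - 1
      > 0 may be cancelled after multiplication by \<gamma>.\<close>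
    have \<gamma>v: "real v - 1 < \<gamma>"
    proof -
      have "1 / (\<alpha> * real e) \<le> 1 / \<gamma>"
        using \<gamma> v3 ev by (simp add: \<alpha> field_simps)
      then have "(real v - 1) * (1 - 1 / \<gamma>) \<le> (real v - 1) * (1 - 1 / (\<alpha> * real e))"
        using v3 by (intro mult_left_mono) auto
      then have "(real v - 1) * (1 - 1 / \<gamma>) < \<gamma> - 1" using cond by linarith
      then have "(real v - 1) * (\<gamma> - 1) < \<gamma> * (\<gamma> - 1)" using \<gamma> by (simp add: field_simps)
      then show ?thesis using \<gamma> by simp
    qed
    have moments: "integrable D (\<lambda>w. real (fst w) powr p)" if p: "0 \<le> p" "p < \<gamma>" for p
    proof -
      obtain C where C: "C > 0" "\<And>t. t > 0 \<Longrightarrow> M.prob {\<omega> \<in> space M. real (X \<omega>) > t} \<le> C * t powr (- \<gamma>)"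
        using power_tail_bound[OF tail] \<gamma> by auto
      have "integrable M (\<lambda>\<omega>. real (X \<omega>) powr p)"
        by (rule M.integrable_powr_if_tail[OF _ C(2) p]) (use X C(1) in auto)
      then show ?thesis using int_D[of "\<lambda>x. real x powr p"] by simp
    qed
    \<comment> \<open>\<open>\<kappa>\<close> is a finite moment of \<open>X\<close> with \<open>v - 1 \<le> \<kappa> \<le> v\<close> and \<open>v - \<kappa> < 1 / \<alpha>\<close>.\<close>
    define \<kappa> where "\<kappa> = (if \<gamma> > real v then real v else (real v - 1 + \<gamma>) / 2)"
    have \<kappa>: "real (num_verts F) - 1 \<le> \<kappa>" "\<kappa> \<le> real (num_verts F)" "0 \<le> \<kappa>" "\<kappa> < \<gamma>"
      using \<gamma>v v3 by (auto simp: \<kappa>_def v_def)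
    have \<theta>: "real (num_verts F) - \<kappa> < 1 / \<alpha>"
    proof (cases "\<gamma> > real v")
      case True
      then show ?thesis using \<alpha>02 by (simp add: \<kappa>_def v_def)
    next
      \<comment> \<open>Here \<alpha> \<le> 1, so 1 / \<alpha> \<ge> 1, whereas \<kappa> lies
        strictly above v - 1.\<close>
      case False
      then have "1 \<le> 1 / \<alpha>" using \<gamma> v3 by (simp add: \<alpha>)
      moreover have "real (num_verts F) - \<kappa> < 1" using False \<gamma>v by (simp add: \<kappa>_def v_def field_simps)
      ultimately show ?thesis by linarith
    qed
    have law: "power_tail_law \<alpha> a Nstar_law"
      unfolding \<alpha> a Nstar_law_def v_def e_def
      by (rule M.power_tail_law_mean_copies[OF X Q indep F(1) _ _ _ tail]) (use F(3) e_ge \<gamma> in auto)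
    have rd_Nstar: "real_distribution Nstar_law" using law by (simp add: power_tail_law_def)
    \<comment> \<open>A vanishing moment of Q would force Q = 0 almost surely, against
      \<open>Q_pos\<close>.\<close>
    have a_pos: "a > 0"
    proof -
      let ?q = "\<lambda>\<omega>. Q \<omega> powr (\<gamma> * real e / real v)"
      have iq: "integrable M ?q"
      proof (rule M.integrable_const_bound[where B=1])
        show "AE \<omega> in M. norm (?q \<omega>) \<le> 1"
          using Q(2) \<gamma> v3 by (intro AE_I2) (auto intro!: powr_le1)
      qed (use Q(1) in measurable)
      have "M.expectation ?q \<noteq> 0"
      proof
        assume "M.expectation ?q = 0"
        then have "AE \<omega> in M. ?q \<omega> = 0" by (subst (asm) integral_nonneg_eq_0_iff_AE[OF iq]) auto
        then have "AE \<omega> in M. \<not> Q \<omega> > 0" by eventually_elim auto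
        then have "M.prob {\<omega> \<in> space M. Q \<omega> > 0} = 0"
          using Q(1) by (subst M.prob_eq_0) auto
        then show False using Q_pos by simp
      qed
      moreover have "M.expectation ?q \<ge> 0" by (intro Bochner_Integration.integral_nonneg) simp
      ultimately have "M.expectation ?q > 0" by linarith
      then show ?thesis using b copies_in_complete_pos[OF F(1)] by (simp add: a)
    qed
    \<comment> \<open>\<open>\<kappa>' > \<gamma> / (2v)\<close> gives \<open>m s\<^bsup>-2\<kappa>'\<^esup> \<longlonglongrightarrow> 0\<close>, and \<open>\<kappa>' < \<gamma> / (2v - 2)\<close> makes the required moment of \<open>X\<close> finite.\<close>
    define \<kappa>' where "\<kappa>' = (\<gamma> / (2 * real v) + min 1 (\<gamma> / real (2 * v - 2))) / 2"
    have v2: "real (2 * v - 2) = 2 * real v - 2" using v3 by (simp add: of_nat_diff)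
    have avg: "x < (x + y) / 2 \<and> (x + y) / 2 < y" if "x < y" for x y :: real using that by simp
    \<comment> \<open>By \<gamma> < 2 v there is room for an exponent below 1, as the interpolation
      needs.\<close>
    have lt: "\<gamma> / (2 * real v) < min 1 (\<gamma> / real (2 * v - 2))"
      using \<gamma> v3 unfolding v2 by (auto simp: field_simps)
    have "\<gamma> / (2 * real v) < \<kappa>'" "\<kappa>' < min 1 (\<gamma> / real (2 * v - 2))"
      using avg[OF lt] unfolding \<kappa>'_def by blast+
    then have \<kappa>': "\<gamma> / (2 * real v) < \<kappa>'" "\<kappa>' < 1" "\<kappa>' < \<gamma> / real (2 * v - 2)"
      by simp_all
    have \<kappa>'0: "\<kappa>' > 0" using \<kappa>'(1) \<gamma> v3 by (auto intro: less_trans[rotated])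
    define s where "s k = real (m k) powr (1 / \<alpha>)" for k
    \<comment> \<open>The centering enters both sides through the same factor of modulus 1 and may
      be arbitrary.\<close>
    have close: "(\<lambda>k. char (distr (superposition_graph D (n k) (m k)) borel (\<lambda>G. (NF G - B (m k)) / s k)) t
        - char (normalized_sum \<alpha> B Nstar_law (m k)) t) \<longlonglongrightarrow> 0" for B t
    proof -
      have s_pos: "\<forall>\<^sub>F k in sequentially. s k > 0" using m_pos by eventually_elim (simp add: s_def)
      have A: "(\<lambda>k. char (distr (superposition_graph D (n k) (m k)) borel (\<lambda>G. (NF G - B (m k)) / s k)) t
        - iexp (- (t * B (m k) / s k)) * char ?\<mu> (t / s k) ^ m k) \<longlonglongrightarrow> 0"
        unfolding NF_def
      proof (rule char_superposition_limit[OF prob_D sets_D F nm(1,3) \<kappa>(1,2) moments[OF \<kappa>(3,4)] s_pos])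
        show "(\<lambda>k. real (n k) powr (real (num_verts F) - \<kappa>) / s k) \<longlonglongrightarrow> 0"
          using powr_ratio_tendsto_0[OF nm(1,3) \<nu> \<theta>, of 1] \<alpha>02 by (simp add: s_def)
      qed
      let ?p = "\<kappa>' * real (2 * num_verts F - 2)"
      let ?c = "(real (copies_in_complete F))\<^sup>2 * real (num_edges F)"
      define E where "E = (\<integral>w. real (fst w) powr ?p \<partial>D)"
      have ip: "integrable D (\<lambda>w. real (fst w) powr ?p)"
        using \<kappa>'(3) \<kappa>'0 v3 by (intro moments) (auto simp: v_def[symmetric] field_simps)
      have "(\<lambda>k. real (m k) * cmod (char ?\<mu> (t / s k) - char Nstar_law (t / s k))) \<longlonglongrightarrow> 0"
      proof (rule Lim_null_comparison)
        show "(\<lambda>k. 2 * (t\<^sup>2 * ?c) powr \<kappa>' * E * real (m k) powr (1 - 2 * \<kappa>' / \<alpha>)) \<longlonglongrightarrow> 0"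
          using \<kappa>'(1) \<alpha>02 v3 \<gamma> by (intro tendsto_mult_right_zero tendsto_neg_powr m_top) (simp add: \<alpha> field_simps)
        show "\<forall>\<^sub>F k in sequentially. norm (real (m k) * cmod (char ?\<mu> (t / s k) - char Nstar_law (t / s k)))
            \<le> 2 * (t\<^sup>2 * ?c) powr \<kappa>' * E * real (m k) powr (1 - 2 * \<kappa>' / \<alpha>)"
          using m_pos
        proof eventually_elim
          case (elim k)
          have "cmod (char ?\<mu> (t / s k) - char Nstar_law (t / s k)) \<le> 2 * ((t / s k)\<^sup>2 * ?c) powr \<kappa>' * E"
            unfolding Nstar NF_def E_def
            using \<kappa>'(2) by (intro char_mixed_near_char_mean[OF prob_D sets_D F(1) F2 q_D \<kappa>'0 _ ip]) simp
          also have "((t / s k)\<^sup>2 * ?c) powr \<kappa>' = (t\<^sup>2 * ?c) powr \<kappa>' * real (m k) powr (- (2 * \<kappa>' / \<alpha>))"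
          proof -
            have "(s k)\<^sup>2 = real (m k) powr (1 / \<alpha> + 1 / \<alpha>)"
              by (simp only: s_def power2_eq_square powr_add)
            also have "1 / \<alpha> + 1 / \<alpha> = 2 / \<alpha>" by simp
            finally have eq: "(t / s k)\<^sup>2 * ?c = (t\<^sup>2 * ?c) * real (m k) powr (- (2 / \<alpha>))"
              by (simp add: power_divide powr_minus field_simps)
            show ?thesis unfolding eq by (subst powr_mult) (simp_all add: powr_powr mult.commute)
          qed
          finally have "real (m k) * cmod (char ?\<mu> (t / s k) - char Nstar_law (t / s k))
              \<le> real (m k) * (2 * ((t\<^sup>2 * ?c) powr \<kappa>' * real (m k) powr (- (2 * \<kappa>' / \<alpha>))) * E)"
            by (intro mult_left_mono) auto
          also have "\<dots> = 2 * (t\<^sup>2 * ?c) powr \<kappa>' * E * real (m k) powr (1 - 2 * \<kappa>' / \<alpha>)"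
            using elim by (simp add: powr_diff powr_minus field_simps)
          finally show ?case by simp
        qed
      qed
      then have "(\<lambda>k. iexp (- (t * B (m k) / s k)) * char ?\<mu> (t / s k) ^ m k - iexp (- (t * B (m k) / s k)) * char Nstar_law (t / s k) ^ m k) \<longlonglongrightarrow> 0"
        by (intro iexp_mult_power_diff_tendsto_0 real_distribution.cmod_char_le_1 rd_\<mu> rd_Nstar)
      from tendsto_add[OF A this]
      have "(\<lambda>k. char (distr (superposition_graph D (n k) (m k)) borel (\<lambda>G. (NF G - B (m k)) / s k)) t
        - iexp (- (t * B (m k) / s k)) * char Nstar_law (t / s k) ^ m k) \<longlonglongrightarrow> 0" by simp
      moreover have "char (normalized_sum \<alpha> B Nstar_law (m k)) t = iexp (- (t * B (m k) / s k)) * char Nstar_law (t / s k) ^ m k" for k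
      proof -
        have "real (m k) powr (- 1 / \<alpha>) = inverse (s k)" by (simp add: s_def powr_minus[symmetric])
        then show ?thesis unfolding char_normalized_sum[OF rd_Nstar] by (simp add: divide_inverse mult_ac)
      qed
      ultimately show ?thesis by simp
    qed
    \<comment> \<open>Since B is arbitrary in \<open>close\<close>, every centering for which the
      normalized sums with law \<open>Nstar_law\<close> converge carries over to the superposition.
      This gives the clause for \<alpha> = 1.\<close>
    have transfer: "weak_conv_m (\<lambda>k. distr (superposition_graph D (n k) (m k)) borel
           (\<lambda>G. (NF G - B (m k)) / real (m k) powr (1 / \<alpha>))) L"
      if "real_distribution L" "weak_conv_m (normalized_sum \<alpha> B Nstar_law) L" for B L
      unfolding s_def[symmetric]
      by (rule weak_conv_m_if_char_close[OF rd_sup real_distribution_normalized_sum[OF rd_Nstar] that(1)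
            weak_conv_m_compose[OF that(2) nm(2)] close])
    note gclt = generalized_central_limit[OF law \<alpha>02 a_pos]
    show ?thesis
      using gclt(2) transfer[OF gclt] transfer by blast
  qed
  show ?thesis
    using part_i part_ii by blast
qed

end
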